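(* Suppose $\vec K=\langle K_\xi\mid\xi<\omega_1\rangle$ is an adequate model sequence and $\vec K$-$\mathsf{SCFA}$ holds. Then $\vec K$ is strongly adequate. If in addition $\vec K$ is a $\diamondsuit$-model sequence, then $\vec K$ is a $\diamondsuit^+_{\omega_1}$-sequence.
   Context: **Models.** $\mathcal L_{\mathrm{ST}}=\{\in\}$ and $\mathcal L_{\mathrm{ST}}^+=\{\in,\tilde P\}$ with $\tilde P$ a unary predicate. $\mathrm{ZF}^-$, $\mathrm{ZFC}^-$ are $\mathrm{ZF}$, $\mathrm{ZFC}$ without Power Set (for $\mathcal L_{\mathrm{ST}}^+$-structures, Separation and Replacement are for all $\mathcal L_{\mathrm{ST}}^+$-formulas). Structures are identified with their universes; a structure is transitive if its universe is a transitive set and its membership relation is the true $\in$. $\sigma:M\prec N$ means $\sigma$ is an elementary embedding of $M$ into $N$. For a set $A$ and ordinal $\chi$, $L^A_\chi=\langle L_\chi[A],\in,A\cap L_\chi[A]\rangle$. A transitive $\mathcal L_{\mathrm{ST}}^+$-model $M$ of $\mathrm{ZFC}^-$ is *full* if there is a transitive $\mathcal L_{\mathrm{ST}}$-model $N$ of $\mathrm{ZF}^-$ with $M\in N$ such that for all $x\in M$ and all $f:x\to M$ with $f\in N$ we have $f\in M$. **Model sequences.** $\vec K=\langle K_\xi\mid\xi<\omega_1\rangle$ is an *adequate model sequence* if (i) each $K_\xi$ is a transitive (set) $\mathcal L_{\mathrm{ST}}$-model of $\mathrm{ZFC}^-$, $\xi\in K_\xi$ and $\xi$ is countable in $K_\xi$;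 (ii) for every $B\subseteq\omega_1$ there are stationarily many $\xi<\omega_1$ with $B\cap\xi\in K_\xi$. It is a *$\diamondsuit$-model sequence* if moreover each $K_\xi$ is countable. It is *strongly adequate* if for every $B\subseteq\omega_1$ there are club many $\xi<\omega_1$ with $B\cap\xi\in K_\xi$. A *$\vec K$-good model* is a transitive full $\mathcal L_{\mathrm{ST}}^+$-model $\bar M$ of $\mathrm{ZFC}^-$ such that $\bar M\in K_{\omega_1^{\bar M}}$ and $\bar M$ is countable in $K_{\omega_1^{\bar M}}$. A *$\diamondsuit^+_{\omega_1}$-sequence* is a sequence $\langle\mathcal B_\xi\mid\xi<\omega_1\rangle$ of countable sets such that for any $B\subseteq\omega_1$ there is a club $C\subseteq\omega_1$ with $B\cap\xi,\,C\cap\xi\in\mathcal B_\xi$ for all $\xi\in C$. **$\vec K$-subcompleteness.** A forcing notion is a separative preorder with a largest element. A regular cardinal $\theta$ and $a\in\mathcal H_\theta$ *verify the $\vec K$-subcompleteness* of a forcing notion $\mathbb P$ if $\mathbb P\in\mathcal H_\theta$ and for all $A,\chi,\bar M,\bar{\mathbb P},\bar b,\sigma,b,\bar G$: if (i) $A$ is a set, $\chi$ is an ordinal, $\mathcal H_\theta\subseteq L^A_\chi\models\mathrm{ZFC}^-$; (ii) $\bar M$ is a $\vec K$-good model with $\bar{\mathbb P},\bar b\in\bar M$; (iii) $\sigma:\bar M\prec L^A_\chi$, $a\in\mathrm{ran}(\sigma)$, $\sigma(\langle\bar{\mathbb P},\bar b\rangle)=\langle\mathbb P,b\rangle$; (iv)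 $\bar G$ is a $\bar{\mathbb P}$-generic filter over $\bar M$ with $\bar G\in K_{\omega_1^{\bar M}}$; then there is $p^*\in\mathbb P$ forcing that there is $\sigma^*:\bar M\prec L^A_\chi$ with $\sigma^*(\langle\bar{\mathbb P},\bar b\rangle)=\langle\mathbb P,b\rangle$ and $\sigma^*[\bar G]\subseteq\dot G$, where $\dot G$ is the canonical name for the generic filter. $\mathbb P$ is *$\vec K$-subcomplete* if some regular $\theta$ and $a\in\mathcal H_\theta$ verify this. **$\vec K$-$\mathsf{SCFA}$**: for any $\vec K$-subcomplete forcing notion $\mathbb P$ and any family $\mathcal D$ of dense subsets of $\mathbb P$ with $|\mathcal D|\le\omega_1$, there is a filter $g$ on $\mathbb P$ with $g\cap D\ne\emptyset$ for all $D\in\mathcal D$. *)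

theory Defs
  imports Main "HOL-Library.Countable_Set" "HOL-Library.Equipollence"
begin

section \<open>The set-theoretic universe\<close>

text \<open>
  A type of class \<open>zfc\<close> plays the role of the universe \<open>V\<close>; HOL sets over it are its classes.
  As usual in HOL, Separation and Replacement range over all HOL predicates and functions, and
  Foundation is stated as well-foundedness of \<open>\<in>\<close>. Choice is not listed because it follows
  from Replacement and HOL's choice operator. A consequence used throughout: a class
  contained in a set is a set, every HOL function restricted to a set is (the graph of) a set, and
  the finite ordinals are exactly the images of the HOL natural numbers. Cardinality comparisons
  in \<open>V\<close> and formulas in \<open>V\<close> may therefore be rendered by the HOL notions.
\<close>

class zfc =
  fixes elts :: "'a \<Rightarrow> 'a set"
  assumes extensionality: "elts x = elts y \<Longrightarrow> x = y"
    and foundation: "wf {(x, y). x \<in> elts y}"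
    and pairing: "\<exists>z. elts z = {x, y}"
    and union: "\<exists>z. elts z = (\<Union>y\<in>elts x. elts y)"
    and powerset: "\<exists>z. elts z = {y. elts y \<subseteq> elts x}"
    and separation: "\<exists>z. elts z = {y \<in> elts x. Q y}"
    and replacement: "\<exists>z. elts z = f ` elts x"
    and infinity: "\<exists>z. (\<exists>e\<in>elts z. elts e = {}) \<and>
                       (\<forall>y\<in>elts z. \<exists>s\<in>elts z. elts s = insert y (elts y))"

text \<open>\<open>mkset X\<close> is meaningful only if the class \<open>X\<close> is a set.\<close>

definition mkset :: "'v::zfc set \<Rightarrow> 'v" where
  "mkset X = (THE x. elts x = X)"

lemma elts_mkset: "\<exists>x. elts x = X \<Longrightarrow> elts (mkset X) = X"
  unfolding mkset_def by (rule theI') (metis extensionality)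

definition opair :: "'v::zfc \<Rightarrow> 'v \<Rightarrow> 'v" where
  "opair x y = mkset {mkset {x}, mkset {x, y}}"

definition inter :: "'v::zfc \<Rightarrow> 'v \<Rightarrow> 'v" where
  "inter x y = mkset (elts x \<inter> elts y)"

definition is_map :: "'v::zfc \<Rightarrow> 'v set \<Rightarrow> 'v set \<Rightarrow> bool" where
  "is_map f X Y \<longleftrightarrow> (\<forall>z\<in>elts f. \<exists>x\<in>X. \<exists>y\<in>Y. z = opair x y) \<and>
                   (\<forall>x\<in>X. \<exists>!y. opair x y \<in> elts f)"

definition trans_set :: "'v::zfc \<Rightarrow> bool" where
  "trans_set x \<longleftrightarrow> (\<forall>y\<in>elts x. elts y \<subseteq> elts x)"

definition Ord :: "'v::zfc \<Rightarrow> bool" where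
  "Ord x \<longleftrightarrow> trans_set x \<and> (\<forall>y\<in>elts x. trans_set y)"

primrec ord_of_nat :: "nat \<Rightarrow> 'v::zfc" where
  "ord_of_nat 0 = mkset {}"
| "ord_of_nat (Suc n) = mkset (insert (ord_of_nat n) (elts (ord_of_nat n)))"

definition omega :: "'v::zfc" where
  "omega = mkset (range ord_of_nat)"

definition omega1 :: "'v::zfc" where
  "omega1 = mkset {\<alpha>. Ord \<alpha> \<and> countable (elts \<alpha>)}"

definition regular_cardinal :: "'v::zfc \<Rightarrow> bool" where
  "regular_cardinal \<theta> \<longleftrightarrow> Ord \<theta> \<and> elts omega \<subseteq> elts \<theta> \<and>
     (\<forall>\<alpha>\<in>elts \<theta>. \<forall>f. f ` elts \<alpha> \<subseteq> elts \<theta> \<longrightarrow> (\<exists>\<beta>\<in>elts \<theta>. f ` elts \<alpha> \<subseteq> elts \<beta>))"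

definition trcl :: "'v::zfc \<Rightarrow> 'v set" where
  "trcl x = {y. (y, x) \<in> {(u, v). u \<in> elts v}\<^sup>+}"

definition Hset :: "'v::zfc \<Rightarrow> 'v set" where
  "Hset \<theta> = {x. trcl x \<prec> elts \<theta>}"

definition club :: "'v::zfc set \<Rightarrow> bool" where
  "club C \<longleftrightarrow> C \<subseteq> elts omega1 \<and>
     (\<forall>\<alpha>\<in>elts omega1. \<exists>\<beta>\<in>C. \<alpha> \<in> elts \<beta>) \<and>
     (\<forall>\<gamma>\<in>elts omega1. elts \<gamma> \<noteq> {} \<and> (\<forall>\<alpha>\<in>elts \<gamma>. \<exists>\<beta>\<in>C \<inter> elts \<gamma>. \<alpha> \<in> elts \<beta>) \<longrightarrow> \<gamma> \<in> C)"

definition stationary :: "'v::zfc set \<Rightarrow> bool" where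
  "stationary S \<longleftrightarrow> S \<subseteq> elts omega1 \<and> (\<forall>C. club C \<longrightarrow> S \<inter> C \<noteq> {})"

section \<open>Formulas and structures\<close>

text \<open>
  Formulas of the language with \<open>\<in>\<close> and one unary predicate. Variables are numbered by \<open>nat\<close>.
  A structure is given by its universe and its predicate; membership is always the true one.
  A structure for the language of \<open>\<in>\<close> alone is treated as one with empty predicate; this adds
  no definable relations, hence does not affect the axiom schemes below.
\<close>

datatype form =
    FEq nat nat
  | FMem nat nat
  | FPred nat
  | FNeg form
  | FAnd form form
  | FEx nat form

primrec fv :: "form \<Rightarrow> nat set" where
  "fv (FEq i j) = {i, j}"
| "fv (FMem i j) = {i, j}"
| "fv (FPred i) = {i}"
| "fv (FNeg \<phi>) = fv \<phi>"
| "fv (FAnd \<phi> \<psi>) = fv \<phi> \<union> fv \<psi>"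
| "fv (FEx i \<phi>) = fv \<phi> - {i}"

primrec sat :: "'v::zfc set \<Rightarrow> 'v set \<Rightarrow> form \<Rightarrow> (nat \<Rightarrow> 'v) \<Rightarrow> bool" where
  "sat M P (FEq i j) s \<longleftrightarrow> s i = s j"
| "sat M P (FMem i j) s \<longleftrightarrow> s i \<in> elts (s j)"
| "sat M P (FPred i) s \<longleftrightarrow> s i \<in> P"
| "sat M P (FNeg \<phi>) s \<longleftrightarrow> \<not> sat M P \<phi> s"
| "sat M P (FAnd \<phi> \<psi>) s \<longleftrightarrow> sat M P \<phi> s \<and> sat M P \<psi> s"
| "sat M P (FEx i \<phi>) s \<longleftrightarrow> (\<exists>x\<in>M. sat M P \<phi> (s(i := x)))"

text \<open>The axioms of \<open>ZF\<close> without Power Set, evaluated in the structure: Extensionality,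
  Foundation, Pairing, Union, Infinity, Separation, Replacement. The schemes allow arbitrary
  parameters, supplied by the assignment \<open>s\<close>.\<close>

definition ZF_minus :: "'v::zfc set \<Rightarrow> 'v set \<Rightarrow> bool" where
  "ZF_minus M P \<longleftrightarrow>
     (\<forall>x\<in>M. \<forall>y\<in>M. (\<forall>z\<in>M. z \<in> elts x \<longleftrightarrow> z \<in> elts y) \<longrightarrow> x = y) \<and>
     (\<forall>x\<in>M. (\<exists>y\<in>M. y \<in> elts x) \<longrightarrow>
        (\<exists>y\<in>M. y \<in> elts x \<and> \<not> (\<exists>z\<in>M. z \<in> elts y \<and> z \<in> elts x))) \<and>
     (\<forall>x\<in>M. \<forall>y\<in>M. \<exists>z\<in>M. \<forall>w\<in>M. w \<in> elts z \<longleftrightarrow> w = x \<or> w = y) \<and>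
     (\<forall>x\<in>M. \<exists>u\<in>M. \<forall>z\<in>M. z \<in> elts u \<longleftrightarrow> (\<exists>y\<in>M. y \<in> elts x \<and> z \<in> elts y)) \<and>
     (\<exists>w\<in>M. (\<exists>e\<in>M. e \<in> elts w \<and> (\<forall>z\<in>M. z \<notin> elts e)) \<and>
        (\<forall>y\<in>M. y \<in> elts w \<longrightarrow>
           (\<exists>u\<in>M. u \<in> elts w \<and> (\<forall>z\<in>M. z \<in> elts u \<longleftrightarrow> z \<in> elts y \<or> z = y)))) \<and>
     (\<forall>\<phi> s. range s \<subseteq> M \<longrightarrow>
        (\<forall>a\<in>M. \<exists>b\<in>M. \<forall>x\<in>M. x \<in> elts b \<longleftrightarrow> x \<in> elts a \<and> sat M P \<phi> (s(0 := x)))) \<and>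
     (\<forall>\<phi> s. range s \<subseteq> M \<longrightarrow>
        (\<forall>a\<in>M.
           (\<forall>x\<in>M. x \<in> elts a \<longrightarrow> (\<exists>!y. y \<in> M \<and> sat M P \<phi> (s(0 := x, 1 := y)))) \<longrightarrow>
           (\<exists>b\<in>M. \<forall>y\<in>M. y \<in> elts b \<longleftrightarrow>
              (\<exists>x\<in>M. x \<in> elts a \<and> sat M P \<phi> (s(0 := x, 1 := y))))))"

text \<open>Choice in the form: every family of nonempty, pairwise disjoint sets has a transversal.\<close>

definition ZFC_minus :: "'v::zfc set \<Rightarrow> 'v set \<Rightarrow> bool" where
  "ZFC_minus M P \<longleftrightarrow> ZF_minus M P \<and>
     (\<forall>F\<in>M.
        (\<forall>x\<in>M. x \<in> elts F \<longrightarrow> (\<exists>z\<in>M. z \<in> elts x)) \<and>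
        (\<forall>x\<in>M. \<forall>y\<in>M. x \<in> elts F \<and> y \<in> elts F \<and> x \<noteq> y \<longrightarrow>
           \<not> (\<exists>z\<in>M. z \<in> elts x \<and> z \<in> elts y)) \<longrightarrow>
        (\<exists>c\<in>M. \<forall>x\<in>M. x \<in> elts F \<longrightarrow> (\<exists>!z. z \<in> M \<and> z \<in> elts x \<and> z \<in> elts c)))"

definition elementary :: "('v::zfc \<Rightarrow> 'v) \<Rightarrow> 'v set \<Rightarrow> 'v set \<Rightarrow> 'v set \<Rightarrow> 'v set \<Rightarrow> bool" where
  "elementary \<sigma> M P N Q \<longleftrightarrow> \<sigma> ` M \<subseteq> N \<and>
     (\<forall>\<phi> s. range s \<subseteq> M \<longrightarrow> (sat M P \<phi> s \<longleftrightarrow> sat N Q \<phi> (\<sigma> \<circ> s)))"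

text \<open>The parameters are constrained only on the free variables, so that the definable subsets
  of the empty structure come out as \<open>{\<emptyset>}\<close>.\<close>

definition definable_subsets :: "'v::zfc set \<Rightarrow> 'v set \<Rightarrow> 'v set" where
  "definable_subsets X P =
     {y. \<exists>\<phi> s. (\<forall>i \<in> fv \<phi> - {0}. s i \<in> X) \<and> elts y = {x \<in> X. sat X P \<phi> (s(0 := x))}}"

text \<open>\<open>Llevel A \<alpha>\<close> is \<open>L\<^sub>\<alpha>[A]\<close>; the equation covers zero, successor and limit steps at once.\<close>

function Llevel :: "'v::zfc \<Rightarrow> 'v \<Rightarrow> 'v set" where
  "Llevel A \<alpha> =
     (\<Union>\<beta>\<in>elts \<alpha>. definable_subsets (Llevel A \<beta>) (elts A \<inter> Llevel A \<beta>))"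
  by pat_completeness auto
termination
  by (relation "inv_image {(x, y). x \<in> elts y} snd") (auto simp: foundation)

declare Llevel.simps [simp del]

section \<open>Model sequences\<close>

text \<open>Being an injection into \<open>\<omega>\<close> is absolute for transitive models of \<open>ZF\<^sup>-\<close>, so the following
  two notions are ``\<open>x\<close> is countable'' and ``\<open>\<delta>\<close> is the first uncountable ordinal'' in the
  sense of such a model \<open>M\<close>.\<close>

definition countable_in :: "'v::zfc \<Rightarrow> 'v \<Rightarrow> bool" where
  "countable_in M x \<longleftrightarrow> (\<exists>f\<in>elts M. is_map f (elts x) (elts omega) \<and>
     (\<forall>u v n. opair u n \<in> elts f \<and> opair v n \<in> elts f \<longrightarrow> u = v))"

definition is_omega1_of :: "'v::zfc \<Rightarrow> 'v \<Rightarrow> bool" where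
  "is_omega1_of M \<delta> \<longleftrightarrow> \<delta> \<in> elts M \<and> Ord \<delta> \<and> \<not> countable_in M \<delta> \<and>
     (\<forall>\<alpha>\<in>elts \<delta>. countable_in M \<alpha>)"

text \<open>A sequence \<open>\<langle>K\<^sub>\<xi> | \<xi> < \<omega>\<^sub>1\<rangle>\<close> is a HOL function, of which only the values on \<open>\<omega>\<^sub>1\<close> matter.\<close>

definition adequate :: "('v::zfc \<Rightarrow> 'v) \<Rightarrow> bool" where
  "adequate K \<longleftrightarrow>
     (\<forall>\<xi>\<in>elts omega1. trans_set (K \<xi>) \<and> ZFC_minus (elts (K \<xi>)) {} \<and>
        \<xi> \<in> elts (K \<xi>) \<and> countable_in (K \<xi>) \<xi>) \<and>
     (\<forall>B. elts B \<subseteq> elts omega1 \<longrightarrow>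
        stationary {\<xi> \<in> elts omega1. inter B \<xi> \<in> elts (K \<xi>)})"

definition diamond_model_sequence :: "('v::zfc \<Rightarrow> 'v) \<Rightarrow> bool" where
  "diamond_model_sequence K \<longleftrightarrow> adequate K \<and> (\<forall>\<xi>\<in>elts omega1. countable (elts (K \<xi>)))"

definition strongly_adequate :: "('v::zfc \<Rightarrow> 'v) \<Rightarrow> bool" where
  "strongly_adequate K \<longleftrightarrow> adequate K \<and>
     (\<forall>B. elts B \<subseteq> elts omega1 \<longrightarrow>
        (\<exists>C. club C \<and> C \<subseteq> {\<xi> \<in> elts omega1. inter B \<xi> \<in> elts (K \<xi>)}))"

definition diamond_plus_sequence :: "('v::zfc \<Rightarrow> 'v) \<Rightarrow> bool" where
  "diamond_plus_sequence \<B> \<longleftrightarrow>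
     (\<forall>\<xi>\<in>elts omega1. countable (elts (\<B> \<xi>))) \<and>
     (\<forall>B. elts B \<subseteq> elts omega1 \<longrightarrow>
        (\<exists>C. club (elts C) \<and>
           (\<forall>\<xi>\<in>elts C. inter B \<xi> \<in> elts (\<B> \<xi>) \<and> inter C \<xi> \<in> elts (\<B> \<xi>))))"

text \<open>In \<open>full\<close> and \<open>good_model\<close> the structure with universe \<open>M\<close> and predicate \<open>P\<close> is the
  object \<open>opair M P\<close>.\<close>

definition full :: "'v::zfc \<Rightarrow> 'v \<Rightarrow> bool" where
  "full M P \<longleftrightarrow> (\<exists>N. trans_set N \<and> ZF_minus (elts N) {} \<and> opair M P \<in> elts N \<and>
     (\<forall>x\<in>elts M. \<forall>f\<in>elts N. is_map f (elts x) (elts M) \<longrightarrow> f \<in> elts M))"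

definition good_model :: "('v::zfc \<Rightarrow> 'v) \<Rightarrow> 'v \<Rightarrow> 'v \<Rightarrow> 'v \<Rightarrow> bool" where
  "good_model K M P \<delta> \<longleftrightarrow>
     trans_set M \<and> elts P \<subseteq> elts M \<and> ZFC_minus (elts M) (elts P) \<and> full M P \<and>
     is_omega1_of M \<delta> \<and> \<delta> \<in> elts omega1 \<and>
     opair M P \<in> elts (K \<delta>) \<and> countable_in (K \<delta>) M"

section \<open>Forcing notions\<close>

text \<open>A preorder is coded as the pair of its carrier and its order relation.\<close>

definition cond :: "'v::zfc \<Rightarrow> 'v set" where
  "cond \<P> = elts (THE C. \<exists>R. \<P> = opair C R)"

definition le :: "'v::zfc \<Rightarrow> 'v \<Rightarrow> 'v \<Rightarrow> bool" where
  "le \<P> p q \<longleftrightarrow> p \<in> cond \<P> \<and> q \<in> cond \<P> \<and> opair p q \<in> elts (THE R. \<exists>C. \<P> = opair C R)"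

definition largest :: "'v::zfc \<Rightarrow> 'v set" where
  "largest \<P> = {t \<in> cond \<P>. \<forall>p\<in>cond \<P>. le \<P> p t}"

definition forcing_notion :: "'v::zfc \<Rightarrow> bool" where
  "forcing_notion \<P> \<longleftrightarrow>
     (\<exists>C R. \<P> = opair C R \<and> (\<forall>z\<in>elts R. \<exists>p\<in>elts C. \<exists>q\<in>elts C. z = opair p q)) \<and>
     (\<forall>p\<in>cond \<P>. le \<P> p p) \<and>
     (\<forall>p q r. le \<P> p q \<and> le \<P> q r \<longrightarrow> le \<P> p r) \<and>
     (\<forall>p\<in>cond \<P>. \<forall>q\<in>cond \<P>. \<not> le \<P> p q \<longrightarrow>
        (\<exists>r. le \<P> r p \<and> \<not> (\<exists>t. le \<P> t r \<and> le \<P> t q))) \<and>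
     largest \<P> \<noteq> {}"

definition dense_in :: "'v::zfc \<Rightarrow> 'v set \<Rightarrow> bool" where
  "dense_in \<P> D \<longleftrightarrow> D \<subseteq> cond \<P> \<and> (\<forall>p\<in>cond \<P>. \<exists>q\<in>D. le \<P> q p)"

definition pfilter :: "'v::zfc \<Rightarrow> 'v set \<Rightarrow> bool" where
  "pfilter \<P> g \<longleftrightarrow> g \<subseteq> cond \<P> \<and> g \<noteq> {} \<and>
     (\<forall>p\<in>g. \<forall>q. le \<P> p q \<longrightarrow> q \<in> g) \<and>
     (\<forall>p\<in>g. \<forall>q\<in>g. \<exists>r\<in>g. le \<P> r p \<and> le \<P> r q)"

definition generic_over :: "'v::zfc \<Rightarrow> 'v \<Rightarrow> 'v set \<Rightarrow> bool" where
  "generic_over M \<P> g \<longleftrightarrow> pfilter \<P> g \<and>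
     (\<forall>D\<in>elts M. dense_in \<P> (elts D) \<longrightarrow> g \<inter> elts D \<noteq> {})"

section \<open>The forcing relation\<close>

inductive is_name :: "'v::zfc \<Rightarrow> 'v \<Rightarrow> bool" for \<P> where
  "(\<forall>z\<in>elts \<tau>. \<exists>\<pi> p. z = opair \<pi> p \<and> p \<in> cond \<P> \<and> is_name \<P> \<pi>) \<Longrightarrow> is_name \<P> \<tau>"

text \<open>If the preorder has several (equivalent) largest conditions, all of them are used here.\<close>

function check :: "'v::zfc \<Rightarrow> 'v \<Rightarrow> 'v" where
  "check \<P> x = mkset (\<Union>y\<in>elts x. opair (check \<P> y) ` largest \<P>)"
  by pat_completeness auto
termination
  by (relation "inv_image {(x, y). x \<in> elts y} snd") (auto simp: foundation)

declare check.simps [simp del]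

definition gen_name :: "'v::zfc \<Rightarrow> 'v" where
  "gen_name \<P> = mkset ((\<lambda>p. opair (check \<P> p) p) ` cond \<P>)"

text \<open>
  A statement of the forcing language is represented by the predicate ``\<open>p\<close> forces it'' on the
  conditions \<open>p\<close>. The atomic cases are the usual recursion on names (as in Kunen's
  \<^emph>\<open>Set Theory\<close>, 1980). The recursive call is positive, so the recursion can be given
  as an inductive predicate; as \<open>\<in>\<close> is well-founded, the equation \<open>forces_eq.simps\<close> has only one
  solution.
\<close>

type_synonym 'v statement = "'v \<Rightarrow> bool"

inductive forces_eq :: "'v::zfc \<Rightarrow> 'v \<Rightarrow> 'v \<Rightarrow> 'v \<Rightarrow> bool" for \<P> where
  "\<lbrakk>\<forall>\<pi>\<^sub>1 s\<^sub>1. opair \<pi>\<^sub>1 s\<^sub>1 \<in> elts \<tau>\<^sub>1 \<longrightarrow> (\<forall>q. le \<P> q p \<longrightarrow> (\<exists>r. le \<P> r q \<and>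
      (le \<P> r s\<^sub>1 \<longrightarrow> (\<exists>\<pi>\<^sub>2 s\<^sub>2. opair \<pi>\<^sub>2 s\<^sub>2 \<in> elts \<tau>\<^sub>2 \<and> le \<P> r s\<^sub>2 \<and> forces_eq \<P> \<pi>\<^sub>1 \<pi>\<^sub>2 r))));
    \<forall>\<pi>\<^sub>2 s\<^sub>2. opair \<pi>\<^sub>2 s\<^sub>2 \<in> elts \<tau>\<^sub>2 \<longrightarrow> (\<forall>q. le \<P> q p \<longrightarrow> (\<exists>r. le \<P> r q \<and>
      (le \<P> r s\<^sub>2 \<longrightarrow> (\<exists>\<pi>\<^sub>1 s\<^sub>1. opair \<pi>\<^sub>1 s\<^sub>1 \<in> elts \<tau>\<^sub>1 \<and> le \<P> r s\<^sub>1 \<and> forces_eq \<P> \<pi>\<^sub>1 \<pi>\<^sub>2 r))))\<rbrakk>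
   \<Longrightarrow> forces_eq \<P> \<tau>\<^sub>1 \<tau>\<^sub>2 p"

definition forces_mem :: "'v::zfc \<Rightarrow> 'v \<Rightarrow> 'v \<Rightarrow> 'v statement" where
  "forces_mem \<P> \<tau>\<^sub>1 \<tau>\<^sub>2 p \<longleftrightarrow> (\<forall>q. le \<P> q p \<longrightarrow>
     (\<exists>r. le \<P> r q \<and> (\<exists>\<pi> s. opair \<pi> s \<in> elts \<tau>\<^sub>2 \<and> le \<P> r s \<and> forces_eq \<P> \<pi> \<tau>\<^sub>1 r)))"

definition f_not :: "'v::zfc \<Rightarrow> 'v statement \<Rightarrow> 'v statement" where
  "f_not \<P> \<Phi> p \<longleftrightarrow> (\<forall>q. le \<P> q p \<longrightarrow> \<not> \<Phi> q)"

definition f_and :: "'v statement \<Rightarrow> 'v statement \<Rightarrow> 'v statement" where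
  "f_and \<Phi> \<Psi> p \<longleftrightarrow> \<Phi> p \<and> \<Psi> p"

definition f_all :: "'v::zfc \<Rightarrow> ('v \<Rightarrow> 'v statement) \<Rightarrow> 'v statement" where
  "f_all \<P> \<Phi> p \<longleftrightarrow> (\<forall>\<tau>. is_name \<P> \<tau> \<longrightarrow> \<Phi> \<tau> p)"

definition f_or :: "'v::zfc \<Rightarrow> 'v statement \<Rightarrow> 'v statement \<Rightarrow> 'v statement" where
  "f_or \<P> \<Phi> \<Psi> = f_not \<P> (f_and (f_not \<P> \<Phi>) (f_not \<P> \<Psi>))"

definition f_imp :: "'v::zfc \<Rightarrow> 'v statement \<Rightarrow> 'v statement \<Rightarrow> 'v statement" where
  "f_imp \<P> \<Phi> \<Psi> = f_not \<P> (f_and \<Phi> (f_not \<P> \<Psi>))"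

definition f_iff :: "'v::zfc \<Rightarrow> 'v statement \<Rightarrow> 'v statement \<Rightarrow> 'v statement" where
  "f_iff \<P> \<Phi> \<Psi> = f_and (f_imp \<P> \<Phi> \<Psi>) (f_imp \<P> \<Psi> \<Phi>)"

definition f_ex :: "'v::zfc \<Rightarrow> ('v \<Rightarrow> 'v statement) \<Rightarrow> 'v statement" where
  "f_ex \<P> \<Phi> = f_not \<P> (f_all \<P> (\<lambda>\<tau>. f_not \<P> (\<Phi> \<tau>)))"

definition f_ball :: "'v::zfc \<Rightarrow> 'v \<Rightarrow> ('v \<Rightarrow> 'v statement) \<Rightarrow> 'v statement" where
  "f_ball \<P> M \<Phi> = f_all \<P> (\<lambda>\<tau>. f_imp \<P> (forces_mem \<P> \<tau> M) (\<Phi> \<tau>))"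

definition f_bex :: "'v::zfc \<Rightarrow> 'v \<Rightarrow> ('v \<Rightarrow> 'v statement) \<Rightarrow> 'v statement" where
  "f_bex \<P> M \<Phi> = f_ex \<P> (\<lambda>\<tau>. f_and (forces_mem \<P> \<tau> M) (\<Phi> \<tau>))"

text \<open>\<open>w = {x, y}\<close>, \<open>z = \<langle>x, y\<rangle>\<close>, \<open>\<langle>x, y\<rangle> \<in> f\<close> and \<open>f : M \<rightarrow> N\<close> in the forcing language:\<close>

definition f_is_upair :: "'v::zfc \<Rightarrow> 'v \<Rightarrow> 'v \<Rightarrow> 'v \<Rightarrow> 'v statement" where
  "f_is_upair \<P> w x y =
     f_all \<P> (\<lambda>u. f_iff \<P> (forces_mem \<P> u w) (f_or \<P> (forces_eq \<P> u x) (forces_eq \<P> u y)))"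

definition f_is_opair :: "'v::zfc \<Rightarrow> 'v \<Rightarrow> 'v \<Rightarrow> 'v \<Rightarrow> 'v statement" where
  "f_is_opair \<P> z x y =
     f_all \<P> (\<lambda>w. f_iff \<P> (forces_mem \<P> w z) (f_or \<P> (f_is_upair \<P> w x x) (f_is_upair \<P> w x y)))"

definition f_apply :: "'v::zfc \<Rightarrow> 'v \<Rightarrow> 'v \<Rightarrow> 'v \<Rightarrow> 'v statement" where
  "f_apply \<P> f x y = f_bex \<P> f (\<lambda>z. f_is_opair \<P> z x y)"

definition f_is_map :: "'v::zfc \<Rightarrow> 'v \<Rightarrow> 'v \<Rightarrow> 'v \<Rightarrow> 'v statement" where
  "f_is_map \<P> f M N =
     f_and (f_ball \<P> f (\<lambda>z. f_bex \<P> M (\<lambda>x. f_bex \<P> N (\<lambda>y. f_is_opair \<P> z x y))))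
           (f_ball \<P> M (\<lambda>x. f_ex \<P> (\<lambda>y. f_and (f_apply \<P> f x y)
              (f_all \<P> (\<lambda>y'. f_imp \<P> (f_apply \<P> f x y') (forces_eq \<P> y' y))))))"

text \<open>Satisfaction in the structure (of the extension) with universe \<open>M\<close> and predicate \<open>P\<close>.\<close>

primrec f_sat :: "'v::zfc \<Rightarrow> 'v \<Rightarrow> 'v \<Rightarrow> form \<Rightarrow> (nat \<Rightarrow> 'v) \<Rightarrow> 'v statement" where
  "f_sat \<P> M P (FEq i j) s = forces_eq \<P> (s i) (s j)"
| "f_sat \<P> M P (FMem i j) s = forces_mem \<P> (s i) (s j)"
| "f_sat \<P> M P (FPred i) s = forces_mem \<P> (s i) P"
| "f_sat \<P> M P (FNeg \<phi>) s = f_not \<P> (f_sat \<P> M P \<phi> s)"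
| "f_sat \<P> M P (FAnd \<phi> \<psi>) s = f_and (f_sat \<P> M P \<phi> s) (f_sat \<P> M P \<psi> s)"
| "f_sat \<P> M P (FEx i \<phi>) s = f_bex \<P> M (\<lambda>x. f_sat \<P> M P \<phi> (s(i := x)))"

text \<open>
  Forcing does not add formulas, so ``for all formulas'' is a conjunction over the HOL type
  \<open>form\<close>; a conjunction is forced iff all its members are. The names \<open>s i\<close> denote the arguments
  and the names \<open>t i\<close> their images under \<open>f\<close>; only the finitely many \<open>i \<in> fv \<phi>\<close> are relevant.
\<close>

definition f_elementary :: "'v::zfc \<Rightarrow> 'v \<Rightarrow> 'v \<Rightarrow> 'v \<Rightarrow> 'v \<Rightarrow> 'v \<Rightarrow> 'v statement" where
  "f_elementary \<P> f M P N Q = f_and (f_is_map \<P> f M N)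
     (\<lambda>p. \<forall>\<phi> s t. (\<forall>i. is_name \<P> (s i) \<and> is_name \<P> (t i)) \<longrightarrow>
        f_imp \<P> (\<lambda>q. \<forall>i\<in>fv \<phi>. forces_mem \<P> (s i) M q \<and> f_apply \<P> f (s i) (t i) q)
                (f_iff \<P> (f_sat \<P> M P \<phi> s) (f_sat \<P> N Q \<phi> t)) p)"

section \<open>Subcompleteness relative to a model sequence\<close>

definition verifies_subcomplete :: "('v::zfc \<Rightarrow> 'v) \<Rightarrow> 'v \<Rightarrow> 'v \<Rightarrow> 'v \<Rightarrow> bool" where
  "verifies_subcomplete K \<theta> a \<P> \<longleftrightarrow>
     regular_cardinal \<theta> \<and> a \<in> Hset \<theta> \<and> \<P> \<in> Hset \<theta> \<and>
     (\<forall>A \<chi> M P \<delta> \<P>' b' \<sigma> b G.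
        Ord \<chi> \<and> Hset \<theta> \<subseteq> Llevel A \<chi> \<and> ZFC_minus (Llevel A \<chi>) (elts A \<inter> Llevel A \<chi>) \<and>
        good_model K M P \<delta> \<and> \<P>' \<in> elts M \<and> b' \<in> elts M \<and>
        elementary \<sigma> (elts M) (elts P) (Llevel A \<chi>) (elts A \<inter> Llevel A \<chi>) \<and>
        a \<in> \<sigma> ` elts M \<and> \<sigma> (opair \<P>' b') = opair \<P> b \<and>
        generic_over M \<P>' (elts G) \<and> G \<in> elts (K \<delta>)
        \<longrightarrow>
        (\<exists>p\<in>cond \<P>.
           f_ex \<P> (\<lambda>f. f_and
             (f_elementary \<P> f (check \<P> M) (check \<P> P)
                (check \<P> (mkset (Llevel A \<chi>))) (check \<P> (mkset (elts A \<inter> Llevel A \<chi>))))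
             (f_and
               (f_apply \<P> f (check \<P> (opair \<P>' b')) (check \<P> (opair \<P> b)))
               (f_ball \<P> (check \<P> G) (\<lambda>x. f_all \<P> (\<lambda>y.
                  f_imp \<P> (f_apply \<P> f x y) (forces_mem \<P> y (gen_name \<P>)))))))
           p))"

definition subcomplete :: "('v::zfc \<Rightarrow> 'v) \<Rightarrow> 'v \<Rightarrow> bool" where
  "subcomplete K \<P> \<longleftrightarrow> forcing_notion \<P> \<and> (\<exists>\<theta> a. verifies_subcomplete K \<theta> a \<P>)"

definition SCFA :: "('v::zfc \<Rightarrow> 'v) \<Rightarrow> bool" where
  "SCFA K \<longleftrightarrow> (\<forall>\<P> \<D>. subcomplete K \<P> \<and> (\<forall>D\<in>\<D>. dense_in \<P> D) \<and> \<D> \<lesssim> elts (omega1 :: 'v) \<longrightarrow>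
     (\<exists>g. pfilter \<P> g \<and> (\<forall>D\<in>\<D>. g \<inter> D \<noteq> {})))"

end

theory Submission
  imports Defs
begin

text \<open>
  Given \<open>B \<subseteq> \<omega>\<^sub>1\<close>, shoot a club through \<open>{\<xi>. B \<inter> \<xi> \<in> K\<^sub>\<xi>}\<close> with bounded closed conditions ordered by
  end-extension; adequacy makes the conditions extendible. This forcing is subcomplete with the
  given embedding \<open>\<sigma>\<close> as the required \<open>\<sigma>\<^sup>*\<close>: if \<open>\<delta> = \<omega>\<^sub>1\<close> of the good model, then \<open>\<sigma>\<close> is the identity
  on \<open>\<delta>\<close> and hence on the conditions of the good model, the union of the generic filter is a club
  \<open>c \<subseteq> \<delta>\<close>, and both \<open>c\<close> and \<open>B \<inter> \<delta>\<close> lie in \<open>K\<^sub>\<delta>\<close>, so that \<open>c \<union> {\<delta>}\<close> is a condition below every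
  member of the generic filter. The forcing axiom then yields strong adequacy. For the
  diamond-plus property the conditions are also required to satisfy \<open>c \<inter> \<xi> \<in> K\<^sub>\<xi>\<close> for \<open>\<xi> \<in> c\<close>; now
  conditions are extendible because a stationary set meets the club obtained before, which avoids
  coding \<open>B\<close> and \<open>c\<close> into a single set.
\<close>

section \<open>Sets and ordinals\<close>

text \<open>The forced statement is reduced to one fact of the ground model: some condition lies
  below \<open>\<sigma> c\<close> for every \<open>c\<close> in the generic filter. The check name
  of the graph of \<open>\<sigma>\<close> then names the required embedding, and the forcing
  relation is developed just far enough to show that statements about check names are decided by
  ground-model truth. What remains is to locate \<open>\<delta>\<close>. Only sets in the range of
  \<open>\<sigma>\<close> can be pulled back, so \<open>B\<close>, \<open>omega1\<close> and
  \<open>omega\<close> are put into the parameter. The preimage of \<open>omega1\<close> must be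
  what \<open>M\<close> takes to be its first uncountable ordinal; for this the target of
  \<open>\<sigma>\<close> has to see that each countable ordinal is countable, and
  \<open>\<theta>\<close> is chosen so large that \<open>H_\<theta>\<close> contains injections
  witnessing it. The two forcings differ only in what is demanded of a point \<open>\<xi>\<close>
  and of the part of the condition below it. This demand is a parameter \<open>R\<close>, so that
  the poset is treated once.\<close>

definition small :: "'v::zfc set \<Rightarrow> bool" where
  "small X \<longleftrightarrow> (\<exists>x. elts x = X)"

lemma elts_mkset_small [simp]: "small X \<Longrightarrow> elts (mkset X) = X"
  unfolding small_def by (rule elts_mkset)

lemma small_elts [simp, intro]: "small (elts x)"
  by (auto simp: small_def)

lemma small_subset: assumes "small X" "Y \<subseteq> X" shows "small Y"
proof -
  obtain x where x: "elts x = X" using assms(1) unfolding small_def by blast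
  obtain z where "elts z = {y \<in> elts x. y \<in> Y}" using separation[of x "\<lambda>y. y \<in> Y"] by blast
  then have "elts z = Y" using assms(2) x by blast
  then show ?thesis unfolding small_def by blast
qed

lemma small_image [intro]: fixes f :: "'v::zfc \<Rightarrow> 'v" shows "small X \<Longrightarrow> small (f ` X)"
  unfolding small_def by (metis replacement[of f])

lemma small_UN [intro]:
  fixes F :: "'v::zfc \<Rightarrow> 'v set"
  assumes "small X" "\<And>x. x \<in> X \<Longrightarrow> small (F x)"
  shows "small (\<Union>x\<in>X. F x)"
proof -
  obtain z where z: "elts z = (\<lambda>x. mkset (F x)) ` X"
    using small_image[OF assms(1), of "\<lambda>x. mkset (F x)"] unfolding small_def by blast
  obtain u where "elts u = (\<Union>y\<in>elts z. elts y)" using union[of z] by blast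
  then show ?thesis using assms(2) by (auto simp: small_def z)
qed

lemma small_pair [simp, intro]: "small {x, y}"
  using pairing unfolding small_def by blast

lemma small_singleton [simp, intro]: "small {x}"
  using small_pair[of x x] by simp

lemma small_empty [simp, intro]: "small {}"
  using small_subset[OF small_singleton] by blast

lemma small_Un [intro]:
  assumes "small X" "small Y" shows "small (X \<union> Y)"
proof -
  have "small (\<Union>z\<in>{mkset X, mkset Y}. elts z)" by (rule small_UN) auto
  then show ?thesis using assms by simp
qed

lemma small_insert [simp, intro]: "small X \<Longrightarrow> small (insert x X)"
  using small_Un[OF small_singleton] by (metis insert_is_Un)

lemma small_Pow [intro]: assumes "small X" shows "small {y. elts y \<subseteq> X}"
proof -
  obtain x where "elts x = X" using assms by (auto simp: small_def)
  then show ?thesis using powerset[of x] unfolding small_def by metis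
qed

lemma elts_inject [simp]: "elts x = elts y \<longleftrightarrow> x = y"
  using extensionality by blast

lemma mkset_elts [simp]: "mkset (elts x) = x"
  using elts_mkset_small[OF small_elts[of x]] by (rule extensionality)

lemma mkset_inject: "small X \<Longrightarrow> small Y \<Longrightarrow> mkset X = mkset Y \<longleftrightarrow> X = Y"
  by (metis elts_mkset_small)

lemma elts_induct [case_names step]:
  assumes "\<And>x. (\<And>y. y \<in> elts x \<Longrightarrow> P y) \<Longrightarrow> P x" shows "P x"
  by (rule wf_induct_rule[OF foundation]) (use assms in auto)

lemma mem_irrefl [simp]: "x \<notin> elts x"
  by (induction x rule: elts_induct) blast

lemma mem_asym: "x \<in> elts y \<Longrightarrow> y \<notin> elts x"
proof (induction y arbitrary: x rule: elts_induct)
  case (step y) then show ?case by blast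
qed

lemma elts_inter [simp]: "elts (inter x y) = elts x \<inter> elts y"
  unfolding inter_def by (rule elts_mkset_small) (auto intro: small_subset[of "elts x"])

lemma opair_inject [simp]: "opair a b = opair c d \<longleftrightarrow> a = c \<and> b = d"
  unfolding opair_def by (simp add: mkset_inject doubleton_eq_iff) metis

lemma elts_opair: "elts (opair x y) = {mkset {x}, mkset {x, y}}"
  unfolding opair_def by simp

section \<open>Ordinals and natural numbers as von Neumann ordinals\<close>

lemma Ord_in: "Ord x \<Longrightarrow> y \<in> elts x \<Longrightarrow> Ord y"
  unfolding Ord_def trans_set_def by blast

lemma Ord_trans: "Ord z \<Longrightarrow> x \<in> elts y \<Longrightarrow> y \<in> elts z \<Longrightarrow> x \<in> elts z"
  unfolding Ord_def trans_set_def by blast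

lemma Ord_elts_subset: "Ord y \<Longrightarrow> x \<in> elts y \<Longrightarrow> elts x \<subseteq> elts y"
  by (simp add: Ord_def trans_set_def)

lemma OrdI: "(\<And>x y. x \<in> elts y \<Longrightarrow> y \<in> elts z \<Longrightarrow> x \<in> elts z) \<Longrightarrow> (\<And>y. y \<in> elts z \<Longrightarrow> Ord y) \<Longrightarrow> Ord z"
  unfolding Ord_def trans_set_def by blast

text \<open>Double induction along membership: if \<open>x\<close> and \<open>y\<close> are
  incomparable, each element of one is comparable with the other by an induction hypothesis, and
  transitivity leaves only membership. Hence \<open>x\<close> and \<open>y\<close> have the same
  elements.\<close>

lemma Ord_linear: "Ord x \<Longrightarrow> Ord y \<Longrightarrow> x \<in> elts y \<or> x = y \<or> y \<in> elts x"
proof (induction x arbitrary: y rule: elts_induct)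
  case (step x)
  note IHx = step.IH and Ox = step.prems(1)
  from step.prems(2) show ?case
  proof (induction y rule: elts_induct)
    case (step y)
    show ?case
    proof (rule ccontr)
      assume n: "\<not> ?case"
      have "elts x = elts y"
      proof (intro equalityI subsetI)
        fix z assume z: "z \<in> elts x"
        then show "z \<in> elts y" using IHx[OF z _ step.prems] n Ox Ord_in Ord_trans by blast
      next
        fix z assume z: "z \<in> elts y"
        then show "z \<in> elts x" using step.IH[OF z] n step.prems Ord_in Ord_trans by blast
      qed
      then show False using n by simp
    qed
  qed
qed

lemma Ord_subset: "Ord x \<Longrightarrow> Ord y \<Longrightarrow> elts x \<subseteq> elts y \<Longrightarrow> x \<in> elts y \<or> x = y"
  using Ord_linear mem_irrefl by blast

definition osucc :: "'v::zfc \<Rightarrow> 'v" where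
  "osucc x = mkset (insert x (elts x))"

lemma elts_osucc [simp]: "elts (osucc x) = insert x (elts x)"
  unfolding osucc_def by simp

lemma Ord_osucc [simp]: "Ord x \<Longrightarrow> Ord (osucc x)"
  by (rule OrdI) (auto dest: Ord_in Ord_trans)

lemma Ord_ord_of_nat [simp]: "Ord (ord_of_nat n)"
proof (induction n)
  case 0 then show ?case by (auto intro: OrdI)
next
  case (Suc n) then show ?case using Ord_osucc[OF Suc] by (simp add: osucc_def)
qed

lemma ord_of_nat_less: "m < n \<Longrightarrow> ord_of_nat m \<in> elts (ord_of_nat n)"
  by (induction n) (auto simp: less_Suc_eq)

lemma inj_ord_of_nat: "inj ord_of_nat"
proof (rule injI)
  fix m n :: nat assume "ord_of_nat m = (ord_of_nat n :: 'a)"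
  then show "m = n"
    using ord_of_nat_less[of m n, where 'a='a] ord_of_nat_less[of n m, where 'a='a] mem_irrefl
    by (metis linorder_neqE_nat)
qed

text \<open>The inductive set given by the axiom of infinity may contain more than the natural
  numbers; it serves to bound the range of \<open>ord_of_nat\<close>, which makes that range a
  set.\<close>

lemma elts_omega: "elts (omega :: 'v::zfc) = range ord_of_nat"
proof -
  obtain z :: 'v and e where z: "e \<in> elts z" "elts e = {}"
    "\<forall>y\<in>elts z. \<exists>s\<in>elts z. elts s = insert y (elts y)"
    using infinity by blast
  have "ord_of_nat n \<in> elts z" for n
  proof (induction n)
    case 0
    have "e = mkset {}" using z(2) by (metis mkset_elts)
    then show ?case using z by simp
  next
    case (Suc n) then show ?case using z(3) by simp (metis mkset_elts)
  qed
  then have "small (range ord_of_nat :: 'v set)" by (intro small_subset[OF small_elts]) blast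
  then show ?thesis unfolding omega_def by simp
qed

lemma countable_omega: "countable (elts omega)"
  by (simp add: elts_omega)

lemma infinite_omega: "infinite (elts omega)"
  by (simp add: elts_omega inj_ord_of_nat range_inj_infinite)

lemma countable_iff_lepoll_omega: "countable X \<longleftrightarrow> X \<lesssim> elts (omega :: 'v)" for X :: "'v::zfc set"
proof
  assume "countable X"
  then have "inj_on (ord_of_nat \<circ> to_nat_on X :: 'v \<Rightarrow> 'v) X"
    by (meson comp_inj_on inj_on_subset inj_on_to_nat_on inj_ord_of_nat subset_UNIV)
  moreover have "(ord_of_nat \<circ> to_nat_on X) ` X \<subseteq> elts (omega :: 'v)" unfolding elts_omega by auto
  ultimately show "X \<lesssim> elts (omega :: 'v)" unfolding lepoll_def by blast
next
  assume "X \<lesssim> elts (omega :: 'v)"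
  then show "countable X" using countable_lepoll countable_omega by blast
qed

text \<open>An ordinal is recovered from the relation that an injection into \<open>X\<close> transports to \<open>X\<close>; the
  relation is taken reflexive so that the ordinal \<open>1\<close> is not confused with \<open>0\<close>.\<close>

lemma small_Ord_lepoll:
  fixes X :: "'v::zfc set"
  assumes "small X" shows "small {\<alpha> :: 'v. Ord \<alpha> \<and> elts \<alpha> \<lesssim> X}" (is "small ?C")
proof -
  define f where "f \<alpha> = (SOME f. inj_on f (elts \<alpha>) \<and> f ` elts \<alpha> \<subseteq> X)" for \<alpha> :: 'v
  have f: "inj_on (f \<alpha>) (elts \<alpha>)" "f \<alpha> ` elts \<alpha> \<subseteq> X" if "elts \<alpha> \<lesssim> X" for \<alpha> :: 'v
    using someI_ex[OF that[unfolded lepoll_def]] unfolding f_def by blast+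
  define R where "R \<alpha> = {opair (f \<alpha> \<xi>) (f \<alpha> \<eta>) |\<xi> \<eta>. \<xi> \<in> elts \<alpha> \<and> \<eta> \<in> elts \<alpha> \<and> (\<xi> = \<eta> \<or> \<xi> \<in> elts \<eta>)}" for \<alpha> :: 'v
  have R_sub: "R \<alpha> \<subseteq> (\<Union>x\<in>X. opair x ` X)" if "elts \<alpha> \<lesssim> X" for \<alpha>
    using f(2)[OF that] unfolding R_def by blast
  have sm: "small (\<Union>x\<in>X. opair x ` X)" using assms by auto
  have smR: "small (R \<alpha>)" if "elts \<alpha> \<lesssim> X" for \<alpha> using small_subset[OF sm R_sub[OF that]] .
  \<comment> \<open>Induction along membership: the code \<open>R\<close> shows which values belong
    to ordinals below \<open>\<xi>\<close>, so equal codes force the two chosen injections to agree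
    at \<open>\<xi>\<close>.\<close>
  have key: "\<xi> \<in> elts \<beta> \<and> f \<alpha> \<xi> = f \<beta> \<xi>"
    if "Ord \<alpha>" "elts \<alpha> \<lesssim> X" "Ord \<beta>" "elts \<beta> \<lesssim> X" "R \<alpha> = R \<beta>" "\<xi> \<in> elts \<alpha>" for \<alpha> \<beta> \<xi>
    using that(6)
  proof (induction \<xi> rule: elts_induct)
    case (step \<xi>)
    have memR: "opair a b \<in> R \<alpha> \<longleftrightarrow> opair a b \<in> R \<beta>" for a b using that(5) by simp
    have R\<beta>: "\<zeta> = \<eta> \<or> \<zeta> \<in> elts \<eta>" if "opair (f \<beta> \<zeta>) (f \<beta> \<eta>) \<in> R \<beta>" "\<zeta> \<in> elts \<beta>" "\<eta> \<in> elts \<beta>" for \<zeta> \<eta>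
      using that f(1)[OF \<open>elts \<beta> \<lesssim> X\<close>] unfolding R_def inj_on_def by auto
    have R\<alpha>: "\<zeta> = \<eta> \<or> \<zeta> \<in> elts \<eta>" if "opair (f \<alpha> \<zeta>) (f \<alpha> \<eta>) \<in> R \<alpha>" "\<zeta> \<in> elts \<alpha>" "\<eta> \<in> elts \<alpha>" for \<zeta> \<eta>
      using that f(1)[OF \<open>elts \<alpha> \<lesssim> X\<close>] unfolding R_def inj_on_def by auto
    have "opair (f \<alpha> \<xi>) (f \<alpha> \<xi>) \<in> R \<beta>" using step.prems memR unfolding R_def by blast
    then obtain \<eta> where \<eta>: "\<eta> \<in> elts \<beta>" "f \<alpha> \<xi> = f \<beta> \<eta>" unfolding R_def by auto
    have "elts \<xi> = elts \<eta>"
    proof (intro equalityI subsetI)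
      fix \<zeta> assume \<zeta>: "\<zeta> \<in> elts \<xi>"
      then have \<zeta>\<alpha>: "\<zeta> \<in> elts \<alpha>" using step.prems that(1) Ord_trans by blast
      have ih: "\<zeta> \<in> elts \<beta>" "f \<alpha> \<zeta> = f \<beta> \<zeta>" using step.IH[OF \<zeta> \<zeta>\<alpha>] by auto
      have "opair (f \<alpha> \<zeta>) (f \<alpha> \<xi>) \<in> R \<alpha>" using \<zeta> \<zeta>\<alpha> step.prems unfolding R_def by blast
      then have "opair (f \<beta> \<zeta>) (f \<beta> \<eta>) \<in> R \<beta>" using memR ih \<eta> by simp
      then have "\<zeta> = \<eta> \<or> \<zeta> \<in> elts \<eta>" using R\<beta> ih \<eta> by blast
      moreover have "\<zeta> \<noteq> \<eta>"
        using ih \<eta> f(1)[OF that(2)] \<zeta> \<zeta>\<alpha> step.prems by (metis inj_onD mem_irrefl)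
      ultimately show "\<zeta> \<in> elts \<eta>" by blast
    next
      fix \<zeta> assume \<zeta>: "\<zeta> \<in> elts \<eta>"
      then have \<zeta>\<beta>: "\<zeta> \<in> elts \<beta>" using \<eta> that(3) Ord_trans by blast
      have "opair (f \<beta> \<zeta>) (f \<beta> \<eta>) \<in> R \<beta>" using \<zeta> \<zeta>\<beta> \<eta> unfolding R_def by blast
      then have "opair (f \<beta> \<zeta>) (f \<beta> \<eta>) \<in> R \<alpha>" using memR by simp
      then obtain \<zeta>' where \<zeta>': "\<zeta>' \<in> elts \<alpha>" "f \<beta> \<zeta> = f \<alpha> \<zeta>'" unfolding R_def by auto
      have "opair (f \<alpha> \<zeta>') (f \<alpha> \<xi>) \<in> R \<alpha>" using memR \<zeta>' \<eta> \<open>opair (f \<beta> \<zeta>) (f \<beta> \<eta>) \<in> R \<alpha>\<close> by simp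
      then have "\<zeta>' = \<xi> \<or> \<zeta>' \<in> elts \<xi>" using R\<alpha> \<zeta>' step.prems by blast
      moreover have "\<zeta>' \<noteq> \<xi>"
        using \<zeta>' \<eta> \<zeta> \<zeta>\<beta> f(1)[OF that(4)] by (metis inj_onD mem_irrefl)
      ultimately have "\<zeta>' \<in> elts \<xi>" by blast
      with step.IH[OF this \<zeta>'(1)] have "\<zeta>' \<in> elts \<beta>" "f \<beta> \<zeta> = f \<beta> \<zeta>'" using \<zeta>' by auto
      then have "\<zeta> = \<zeta>'" using f(1)[OF that(4)] \<zeta>\<beta> by (meson inj_onD)
      then show "\<zeta> \<in> elts \<xi>" using \<open>\<zeta>' \<in> elts \<xi>\<close> by simp
    qed
    then have "\<xi> = \<eta>" by simp
    then show ?case using \<eta> by simp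
  qed
  have inj: "inj_on (\<lambda>\<alpha>. mkset (R \<alpha>)) ?C"
  proof (rule inj_onI)
    fix \<alpha> \<beta> assume a: "\<alpha> \<in> ?C" "\<beta> \<in> ?C" "mkset (R \<alpha>) = mkset (R \<beta>)"
    then have O: "Ord \<alpha>" "elts \<alpha> \<lesssim> X" "Ord \<beta>" "elts \<beta> \<lesssim> X" by auto
    have R: "R \<alpha> = R \<beta>" using a(3) mkset_inject[OF smR smR] O by blast
    have "elts \<alpha> = elts \<beta>"
      using key[OF O R] key[OF O(3,4,1,2) R[symmetric]] by blast
    then show "\<alpha> = \<beta>" by simp
  qed
  have "(\<lambda>\<alpha>. mkset (R \<alpha>)) ` ?C \<subseteq> {y. elts y \<subseteq> (\<Union>x\<in>X. opair x ` X)}"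
    using R_sub smR by fastforce
  then have "small ((\<lambda>\<alpha>. mkset (R \<alpha>)) ` ?C)" using small_subset small_Pow[OF sm] by blast
  \<comment> \<open>Replacement along the inverse of the injective coding: the ordinals in question
    are the image of a set of codes.\<close>
  then have "small (the_inv_into ?C (\<lambda>\<alpha>. mkset (R \<alpha>)) ` ((\<lambda>\<alpha>. mkset (R \<alpha>)) ` ?C))" by blast
  then show ?thesis
    using the_inv_into_onto[OF inj] by simp
qed

section \<open>Hartogs numbers as regular cardinals\<close>

definition hartogs :: "'v::zfc set \<Rightarrow> 'v" where
  "hartogs X = mkset {\<alpha>. Ord \<alpha> \<and> elts \<alpha> \<lesssim> X}"

lemma elts_hartogs: "small X \<Longrightarrow> elts (hartogs X) = {\<alpha>. Ord \<alpha> \<and> elts \<alpha> \<lesssim> X}"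
  unfolding hartogs_def by (simp add: small_Ord_lepoll)

lemma Ord_hartogs: "small X \<Longrightarrow> Ord (hartogs X)"
  by (rule OrdI)
    (auto simp: elts_hartogs intro: Ord_in lepoll_trans[OF subset_imp_lepoll[OF Ord_elts_subset]])

text \<open>Were \<open>hartogs X\<close> embeddable into \<open>X\<close>, it would be a member of
  itself; comparability of cardinals turns this failure into a strict inequality.\<close>

lemma lesspoll_hartogs: assumes "small X" shows "X \<prec> elts (hartogs X)"
proof -
  have "\<not> elts (hartogs X) \<lesssim> X"
    using elts_hartogs[OF assms] Ord_hartogs[OF assms] mem_irrefl[of "hartogs X"] by auto
  then show ?thesis
    by (metis lepoll_def card_of_ordLeq card_of_Well_order ordLeq_total lesspoll_def eqpoll_imp_lepoll eqpoll_sym)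
qed

text \<open>Successor cardinals are regular: a union of at most \<open>|X|\<close> sets of size at
  most \<open>|X|\<close> again has size at most \<open>|X|\<close>. The inclusion of
  \<open>omega\<close> in \<open>X\<close> makes every natural number a member of the
  cardinal.\<close>

lemma regular_hartogs:
  fixes X :: "'v::zfc set"
  assumes "small X" "infinite X" "elts omega \<subseteq> X" shows "regular_cardinal (hartogs X)"
  unfolding regular_cardinal_def
proof (intro conjI ballI allI impI)
  show "Ord (hartogs X)" using assms Ord_hartogs by blast
  have "elts (ord_of_nat n) \<subseteq> elts (omega :: 'v)" for n
    by (induction n) (auto simp: elts_omega)
  then have "elts (ord_of_nat n :: 'v) \<lesssim> X" for n
    using assms(3) by (meson order_trans subset_imp_lepoll)
  then show "elts omega \<subseteq> elts (hartogs X)"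
    using assms(1) by (auto simp: elts_hartogs elts_omega)
next
  fix \<alpha> and f :: "'v \<Rightarrow> 'v" assume \<alpha>: "\<alpha> \<in> elts (hartogs X)" "f ` elts \<alpha> \<subseteq> elts (hartogs X)"
  define \<beta> where "\<beta> = mkset (\<Union>\<xi>\<in>elts \<alpha>. elts (f \<xi>))"
  have \<beta>: "elts \<beta> = (\<Union>\<xi>\<in>elts \<alpha>. elts (f \<xi>))" unfolding \<beta>_def by (rule elts_mkset_small) auto
  have fO: "Ord (f \<xi>)" "elts (f \<xi>) \<lesssim> X" if "\<xi> \<in> elts \<alpha>" for \<xi>
    using \<alpha> that assms by (auto simp: elts_hartogs)
  have O: "Ord \<beta>" by (rule OrdI) (auto simp: \<beta> dest: fO Ord_in Ord_trans)
  have "elts \<beta> \<lesssim> X"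
    using card_of_UNION_ordLeq_infinite[OF assms(2), of "elts \<alpha>" "\<lambda>\<xi>. elts (f \<xi>)"] fO \<alpha> assms(1)
    unfolding \<beta> lepoll_def card_of_ordLeq by (auto simp: elts_hartogs lepoll_def card_of_ordLeq)
  then have "elts (osucc \<beta>) \<lesssim> X"
    using assms(2) finite_lepoll_infinite[of X "insert \<beta> (elts \<beta>)"] infinite_insert_lepoll[of "elts \<beta>" \<beta>]
    by (cases "finite (elts \<beta>)") (auto intro: lepoll_trans)
  then have "osucc \<beta> \<in> elts (hartogs X)" using O assms by (simp add: elts_hartogs)
  \<comment> \<open>A value of \<open>f\<close> may be the supremum \<open>\<beta>\<close> itself,
    so the strict bound is its successor.\<close>
  moreover have "f ` elts \<alpha> \<subseteq> elts (osucc \<beta>)"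
    using Ord_subset[OF fO(1) O] by (auto simp: \<beta>)
  ultimately show "\<exists>\<beta>\<in>elts (hartogs X). f ` elts \<alpha> \<subseteq> elts \<beta>" by blast
qed

section \<open>The first uncountable ordinal\<close>

lemma elts_omega1: "elts (omega1 :: 'v::zfc) = {\<alpha>. Ord \<alpha> \<and> countable (elts \<alpha>)}"
  unfolding omega1_def using small_Ord_lepoll[OF small_elts, of "omega :: 'v"]
  by (simp flip: countable_iff_lepoll_omega)

lemma Ord_omega1: "Ord omega1"
  by (rule OrdI) (auto simp: elts_omega1 intro: Ord_in countable_subset[OF Ord_elts_subset])

lemma uncountable_omega1: "\<not> countable (elts omega1)"
  using Ord_omega1 elts_omega1 mem_irrefl by blast

lemma osucc_omega1: "\<alpha> \<in> elts omega1 \<Longrightarrow> osucc \<alpha> \<in> elts omega1"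
  by (simp add: elts_omega1)

lemma omega1_linear:
  "\<alpha> \<in> elts omega1 \<Longrightarrow> \<beta> \<in> elts omega1 \<Longrightarrow> \<alpha> \<in> elts \<beta> \<or> \<alpha> = \<beta> \<or> \<beta> \<in> elts \<alpha>"
  using Ord_linear by (auto simp: elts_omega1)

lemma omega1_trans:
  "\<alpha> \<in> elts \<beta> \<Longrightarrow> \<beta> \<in> elts \<gamma> \<Longrightarrow> \<gamma> \<in> elts omega1 \<Longrightarrow> \<alpha> \<in> elts \<gamma>"
  using Ord_trans by (auto simp: elts_omega1)

lemma omega1_in: "\<alpha> \<in> elts \<beta> \<Longrightarrow> \<beta> \<in> elts omega1 \<Longrightarrow> \<alpha> \<in> elts omega1"
  using Ord_trans[OF Ord_omega1] by blast

lemma omega1_above: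
  assumes "\<alpha> \<in> elts omega1" "\<beta> \<in> elts omega1"
  shows "\<exists>\<gamma>\<in>elts omega1. \<alpha> \<in> elts \<gamma> \<and> \<beta> \<in> elts \<gamma>"
  using omega1_linear[OF assms] assms osucc_omega1
  by (metis elts_osucc insertI1 insertI2)

section \<open>Transitive closures, \<open>H_\<theta>\<close> and the levels
  \<open>L_\<alpha>[A]\<close>\<close>

lemma trcl_mem: "y \<in> elts x \<Longrightarrow> y \<in> trcl x"
  unfolding trcl_def by auto

lemma trcl_mono: "y \<in> elts x \<Longrightarrow> trcl y \<subseteq> trcl x"
  unfolding trcl_def by (auto intro: trancl_into_trancl)

lemma trcl_eq: "trcl x = (\<Union>y\<in>elts x. insert y (trcl y))"
proof
  show "trcl x \<subseteq> (\<Union>y\<in>elts x. insert y (trcl y))"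
    unfolding trcl_def by (auto elim: tranclE)
qed (use trcl_mem trcl_mono in blast)

lemma small_trcl: "small (trcl x)"
proof (induction x rule: elts_induct)
  case (step x) then show ?case by (subst trcl_eq) auto
qed

lemma lesspoll_subset: "X \<subseteq> Y \<Longrightarrow> Y \<prec> Z \<Longrightarrow> X \<prec> Z"
  by (meson lesspoll_trans1 subset_imp_lepoll)

text \<open>Transitive closures grow along membership, so collecting several sets in one
  \<open>x\<close> puts all of them into the same \<open>H_\<theta>\<close>.\<close>

lemma Hset_hartogs: "y \<in> elts x \<Longrightarrow> y \<in> Hset (hartogs (trcl x))"
  unfolding Hset_def using lesspoll_subset[OF trcl_mono lesspoll_hartogs] small_trcl by blast

text \<open>With \<open>omega\<close> as a member of \<open>x\<close>, the transitive closure is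
  infinite and contains every natural number, as regularity of the Hartogs number demands.\<close>

lemma regular_hartogs_trcl: "omega \<in> elts x \<Longrightarrow> regular_cardinal (hartogs (trcl x))"
  using regular_hartogs[OF small_trcl, of x] infinite_omega trcl_mem trcl_mono
  by (metis (no_types, lifting) infinite_super subsetD subsetI)

lemma small_Llevel: "small (Llevel A \<alpha>)"
proof (induction \<alpha> rule: elts_induct)
  case (step \<alpha>)
  have "small (definable_subsets (Llevel A \<beta>) (elts A \<inter> Llevel A \<beta>))" if "\<beta> \<in> elts \<alpha>" for \<beta>
    by (rule small_subset[OF small_Pow[OF step[OF that]]]) (auto simp: definable_subsets_def)
  then show ?case by (subst Llevel.simps) auto
qed

text \<open>A member of a level is a subset of an earlier level; unfolding the recursion once more
  shows that its elements are definable over a still earlier level, whose definable subsets enter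
  stage \<open>\<alpha>\<close> because \<open>\<alpha>\<close> is transitive.\<close>

lemma Llevel_transitive:
  assumes "Ord \<alpha>" "x \<in> Llevel A \<alpha>" shows "elts x \<subseteq> Llevel A \<alpha>"
proof
  fix y assume y: "y \<in> elts x"
  obtain \<beta> where \<beta>: "\<beta> \<in> elts \<alpha>" "x \<in> definable_subsets (Llevel A \<beta>) (elts A \<inter> Llevel A \<beta>)"
    using assms(2) by (subst (asm) Llevel.simps) auto
  then have "y \<in> Llevel A \<beta>" using y unfolding definable_subsets_def by auto
  then obtain \<gamma> where "\<gamma> \<in> elts \<beta>" "y \<in> definable_subsets (Llevel A \<gamma>) (elts A \<inter> Llevel A \<gamma>)"
    by (subst (asm) Llevel.simps) auto
  then show "y \<in> Llevel A \<alpha>" using \<beta> Ord_trans[OF assms(1)] by (subst Llevel.simps) blast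
qed

section \<open>Formulas and elementary embeddings\<close>

text \<open>A fragment of \<open>ZF\<close> without Power Set that suffices to evaluate formulas
  about pairs and functions correctly. It is shared by the good model, the level
  \<open>L_\<chi>[A]\<close> and the model \<open>K \<delta>\<close>.\<close>

definition pairing_class :: "'v::zfc set \<Rightarrow> bool" where
  "pairing_class M \<longleftrightarrow> (\<forall>x\<in>M. elts x \<subseteq> M) \<and> (\<forall>x\<in>M. \<forall>y\<in>M. mkset {x, y} \<in> M)"

lemma pairing_class_trans: "pairing_class M \<Longrightarrow> x \<in> M \<Longrightarrow> y \<in> elts x \<Longrightarrow> y \<in> M"
  unfolding pairing_class_def by blast

lemma pairing_class_opair_iff:
  assumes "pairing_class M" shows "opair x y \<in> M \<longleftrightarrow> x \<in> M \<and> y \<in> M"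
proof
  assume o: "opair x y \<in> M"
  have "mkset {x, y} \<in> M" by (rule pairing_class_trans[OF assms o]) (simp add: elts_opair)
  from pairing_class_trans[OF assms this] show "x \<in> M \<and> y \<in> M" by simp
next
  assume "x \<in> M \<and> y \<in> M"
  then have "mkset {x, x} \<in> M" "mkset {x, y} \<in> M" using assms unfolding pairing_class_def by blast+
  then show "opair x y \<in> M" using assms unfolding pairing_class_def opair_def by simp
qed

lemma mem_opair_pairing_class:
  "pairing_class M \<Longrightarrow> f \<in> M \<Longrightarrow> opair u v \<in> elts f \<Longrightarrow> u \<in> M \<and> v \<in> M"
  using pairing_class_opair_iff pairing_class_trans by blast

lemma mkset_eqI: "elts z = X \<Longrightarrow> mkset X = z"
  using mkset_elts by blast

lemma ZF_minus_pairing_class: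
  assumes "ZF_minus M P" "\<forall>x\<in>M. elts x \<subseteq> M" shows "pairing_class M"
  unfolding pairing_class_def
proof (intro conjI assms(2) ballI)
  fix x y assume xy: "x \<in> M" "y \<in> M"
  have "\<forall>x\<in>M. \<forall>y\<in>M. \<exists>z\<in>M. \<forall>w\<in>M. w \<in> elts z \<longleftrightarrow> w = x \<or> w = y"
    using assms(1) unfolding ZF_minus_def by (elim conjE)
  then obtain z where z: "z \<in> M" "\<forall>w\<in>M. w \<in> elts z \<longleftrightarrow> w = x \<or> w = y" using xy by blast
  then have "elts z = {x, y}" using assms(2) xy by blast
  then show "mkset {x, y} \<in> M" using z(1) mkset_eqI by metis
qed

lemma ZF_minus_Union:
  assumes "ZF_minus M P" "\<forall>x\<in>M. elts x \<subseteq> M" "x \<in> M" shows "mkset (\<Union>y\<in>elts x. elts y) \<in> M"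
proof -
  have "\<forall>x\<in>M. \<exists>u\<in>M. \<forall>z\<in>M. z \<in> elts u \<longleftrightarrow> (\<exists>y\<in>M. y \<in> elts x \<and> z \<in> elts y)"
    using assms(1) unfolding ZF_minus_def by (elim conjE)
  then obtain u where u: "u \<in> M" "\<forall>z\<in>M. z \<in> elts u \<longleftrightarrow> (\<exists>y\<in>M. y \<in> elts x \<and> z \<in> elts y)"
    using assms(3) by blast
  have "elts u = (\<Union>y\<in>elts x. elts y)"
    using u assms(2,3) by blast
  then show ?thesis using u(1) mkset_eqI by metis
qed

lemma ZF_minus_Separation:
  assumes "ZF_minus M P" "\<forall>x\<in>M. elts x \<subseteq> M" "a \<in> M" "\<forall>i. s i \<in> M"
  shows "mkset {x \<in> elts a. sat M P \<phi> (s(0 := x))} \<in> M"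
proof -
  have "\<forall>\<phi> s. range s \<subseteq> M \<longrightarrow>
        (\<forall>a\<in>M. \<exists>b\<in>M. \<forall>x\<in>M. x \<in> elts b \<longleftrightarrow> x \<in> elts a \<and> sat M P \<phi> (s(0 := x)))"
    using assms(1) unfolding ZF_minus_def by (elim conjE)
  moreover have "range s \<subseteq> M" using assms(4) by blast
  ultimately obtain b where
    b: "b \<in> M" "\<forall>x\<in>M. x \<in> elts b \<longleftrightarrow> x \<in> elts a \<and> sat M P \<phi> (s(0 := x))"
    using assms(3) by blast
  have "elts b = {x \<in> elts a. sat M P \<phi> (s(0 := x))}"
    using b assms(2,3) by blast
  then show ?thesis using b(1) mkset_eqI by metis
qed

section \<open>Formulas for pairs, application and injections, and their absoluteness\<close>

definition FOr :: "form \<Rightarrow> form \<Rightarrow> form" where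
  "FOr \<phi> \<psi> = FNeg (FAnd (FNeg \<phi>) (FNeg \<psi>))"

definition FAll :: "nat \<Rightarrow> form \<Rightarrow> form" where
  "FAll i \<phi> = FNeg (FEx i (FNeg \<phi>))"

definition FImp :: "form \<Rightarrow> form \<Rightarrow> form" where
  "FImp \<phi> \<psi> = FNeg (FAnd \<phi> (FNeg \<psi>))"

definition FIff :: "form \<Rightarrow> form \<Rightarrow> form" where
  "FIff \<phi> \<psi> = FAnd (FOr (FNeg \<phi>) \<psi>) (FOr (FNeg \<psi>) \<phi>)"

lemma sat_FOr [simp]: "sat M P (FOr \<phi> \<psi>) s \<longleftrightarrow> sat M P \<phi> s \<or> sat M P \<psi> s"
  by (simp add: FOr_def)

lemma sat_FAll [simp]: "sat M P (FAll i \<phi>) s \<longleftrightarrow> (\<forall>x\<in>M. sat M P \<phi> (s(i := x)))"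
  by (simp add: FAll_def)

lemma sat_FImp [simp]: "sat M P (FImp \<phi> \<psi>) s \<longleftrightarrow> (sat M P \<phi> s \<longrightarrow> sat M P \<psi> s)"
  by (simp add: FImp_def)

lemma sat_FIff [simp]: "sat M P (FIff \<phi> \<psi>) s \<longleftrightarrow> (sat M P \<phi> s \<longleftrightarrow> sat M P \<psi> s)"
  by (auto simp: FIff_def)

text \<open>Bound variables are fixed numbers: 12 here, 11 in \<open>F_opair\<close>, 9 in
  \<open>F_app\<close>. The numerical bounds in the satisfaction lemmas exclude capture.\<close>

definition F_upair :: "nat \<Rightarrow> nat \<Rightarrow> nat \<Rightarrow> form" where
  "F_upair w x y = FAll 12 (FIff (FMem 12 w) (FOr (FEq 12 x) (FEq 12 y)))"

definition F_opair :: "nat \<Rightarrow> nat \<Rightarrow> nat \<Rightarrow> form" where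
  "F_opair z x y = FAll 11 (FIff (FMem 11 z) (FOr (F_upair 11 x x) (F_upair 11 x y)))"

definition F_app :: "nat \<Rightarrow> nat \<Rightarrow> nat \<Rightarrow> form" where
  "F_app f x y = FEx 9 (FAnd (FMem 9 f) (F_opair 9 x y))"

text \<open>Variables 0, 1 and 2 stand for the map, its domain and its target. The conjuncts say
  that the map is a relation between the two, is a total function, and is injective.\<close>

definition F_inj :: form where
  "F_inj =
     FAnd (FAll 3 (FImp (FMem 3 0)
             (FEx 4 (FAnd (FMem 4 1) (FEx 5 (FAnd (FMem 5 2) (F_opair 3 4 5)))))))
    (FAnd (FAll 4 (FImp (FMem 4 1)
             (FEx 5 (FAnd (F_app 0 4 5) (FAll 6 (FImp (F_app 0 4 6) (FEq 6 5)))))))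
          (FAll 4 (FAll 6 (FAll 5 (FImp (FAnd (F_app 0 4 5) (F_app 0 6 5)) (FEq 4 6))))))"

lemma sat_F_upair:
  assumes "pairing_class M" "\<forall>i. s i \<in> M" "w < 12" "x < 12" "y < 12"
  shows "sat M P (F_upair w x y) s \<longleftrightarrow> s w = mkset {s x, s y}"
proof -
  have "sat M P (F_upair w x y) s \<longleftrightarrow> (\<forall>u\<in>M. u \<in> elts (s w) \<longleftrightarrow> u = s x \<or> u = s y)"
    using assms(3-5) by (simp add: F_upair_def)
  also have "\<dots> \<longleftrightarrow> elts (s w) = {s x, s y}"
    using assms(1,2) pairing_class_trans[OF assms(1)] by blast
  also have "\<dots> \<longleftrightarrow> s w = mkset {s x, s y}" by (metis elts_mkset_small mkset_elts small_pair)
  finally show ?thesis .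
qed

lemma sat_F_opair:
  assumes M: "pairing_class M" and s: "\<forall>i. s i \<in> M" and "z < 10" "x < 10" "y < 10"
  shows "sat M P (F_opair z x y) s \<longleftrightarrow> s z = opair (s x) (s y)"
proof -
  have 1: "sat M P (F_upair 11 x y') (s(11 := u)) \<longleftrightarrow> u = mkset {s x, s y'}"
    if "u \<in> M" "y' < 10" for u y'
  proof -
    have "\<forall>i. (s(11 := u)) i \<in> M" using s that by simp
    then show ?thesis
      by (rule trans[OF sat_F_upair[OF M]]) (use assms that in auto)
  qed
  have "sat M P (F_opair z x y) s \<longleftrightarrow>
      (\<forall>u\<in>M. u \<in> elts (s z) \<longleftrightarrow> u = mkset {s x} \<or> u = mkset {s x, s y})"
    using assms(3-5) 1 by (simp add: F_opair_def)
  also have "\<dots> \<longleftrightarrow> elts (s z) = {mkset {s x}, mkset {s x, s y}}"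
  proof -
    have "mkset {s x, s x} \<in> M" "mkset {s x, s y} \<in> M"
      using M s unfolding pairing_class_def by blast+
    then show ?thesis using pairing_class_trans[OF M] s by auto
  qed
  also have "\<dots> \<longleftrightarrow> s z = opair (s x) (s y)" by (metis elts_opair elts_inject)
  finally show ?thesis .
qed

lemma sat_F_app:
  assumes M: "pairing_class M" and s: "\<forall>i. s i \<in> M" and "f < 9" "x < 9" "y < 9"
  shows "sat M P (F_app f x y) s \<longleftrightarrow> opair (s x) (s y) \<in> elts (s f)"
proof -
  have 1: "sat M P (F_opair 9 x y) (s(9 := u)) \<longleftrightarrow> u = opair (s x) (s y)" if "u \<in> M" for u
  proof -
    have "\<forall>i. (s(9 := u)) i \<in> M" using s that by simp
    then show ?thesis
      by (rule trans[OF sat_F_opair[OF M]]) (use assms in auto)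
  qed
  have "sat M P (F_app f x y) s \<longleftrightarrow> (\<exists>u\<in>M. u \<in> elts (s f) \<and> u = opair (s x) (s y))"
    using assms(3-5) 1 by (auto simp: F_app_def)
  then show ?thesis using pairing_class_trans[OF M] s by blast
qed

definition inj_map :: "'v::zfc \<Rightarrow> 'v set \<Rightarrow> 'v set \<Rightarrow> bool" where
  "inj_map f X Y \<longleftrightarrow> is_map f X Y \<and>
     (\<forall>u v n. opair u n \<in> elts f \<and> opair v n \<in> elts f \<longrightarrow> u = v)"

lemma countable_in_iff: "countable_in M x \<longleftrightarrow> (\<exists>f\<in>elts M. inj_map f (elts x) (elts omega))"
  unfolding countable_in_def inj_map_def ..

text \<open>Absoluteness: the components of a pair in \<open>s 0\<close> lie in \<open>M\<close>
  again, so restricting the quantifiers to \<open>M\<close> loses nothing.\<close>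

lemma sat_F_inj:
  assumes M: "pairing_class M" and s: "\<forall>i. s i \<in> M"
  shows "sat M P F_inj s \<longleftrightarrow> inj_map (s 0) (elts (s 1)) (elts (s 2))"
proof -
  have tr: "y \<in> M" if "y \<in> elts (s i)" for y i using pairing_class_trans[OF M] s that by blast
  have op: "u \<in> M" "v \<in> M" if "opair u v \<in> elts (s 0)" for u v
    using mem_opair_pairing_class[OF M _ that] s by auto
  have "sat M P F_inj s \<longleftrightarrow>
     (\<forall>z\<in>M. z \<in> elts (s 0) \<longrightarrow> (\<exists>u\<in>M. u \<in> elts (s 1) \<and> (\<exists>n\<in>M. n \<in> elts (s 2) \<and> z = opair u n))) \<and>
     (\<forall>u\<in>M. u \<in> elts (s 1) \<longrightarrow> (\<exists>n\<in>M. opair u n \<in> elts (s 0) \<and>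
        (\<forall>m\<in>M. opair u m \<in> elts (s 0) \<longrightarrow> m = n))) \<and>
     (\<forall>u\<in>M. \<forall>v\<in>M. \<forall>n\<in>M. opair u n \<in> elts (s 0) \<and> opair v n \<in> elts (s 0) \<longrightarrow> u = v)"
    using s by (simp add: F_inj_def sat_F_opair[OF M] sat_F_app[OF M] cong: ball_cong bex_cong)
  also have "\<dots> \<longleftrightarrow> inj_map (s 0) (elts (s 1)) (elts (s 2))"
    unfolding inj_map_def is_map_def conj_assoc
  proof (intro conj_cong)
    show "(\<forall>z\<in>M. z \<in> elts (s 0) \<longrightarrow> (\<exists>u\<in>M. u \<in> elts (s 1) \<and> (\<exists>n\<in>M. n \<in> elts (s 2) \<and> z = opair u n)))
      \<longleftrightarrow> (\<forall>z\<in>elts (s 0). \<exists>x\<in>elts (s 1). \<exists>y\<in>elts (s 2). z = opair x y)"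
      using tr by blast
    show "(\<forall>u\<in>M. u \<in> elts (s 1) \<longrightarrow> (\<exists>n\<in>M. opair u n \<in> elts (s 0) \<and>
        (\<forall>m\<in>M. opair u m \<in> elts (s 0) \<longrightarrow> m = n))) \<longleftrightarrow> (\<forall>x\<in>elts (s 1). \<exists>!y. opair x y \<in> elts (s 0))"
    proof -
      have "(\<exists>n\<in>M. opair u n \<in> elts (s 0) \<and> (\<forall>m\<in>M. opair u m \<in> elts (s 0) \<longrightarrow> m = n))
        \<longleftrightarrow> (\<exists>!y. opair u y \<in> elts (s 0))" for u
        unfolding Ex1_def using op(2)[of u] by metis
      moreover have "(\<forall>u\<in>M. u \<in> elts (s 1) \<longrightarrow> R u) \<longleftrightarrow> (\<forall>u\<in>elts (s 1). R u)" for R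
        using tr[of _ 1] by blast
      ultimately show ?thesis by simp
    qed
  qed (use op in blast)
  finally show ?thesis .
qed


text \<open>Four parameters suffice for every formula that is transferred. Assignments are total, so
  all variables from 3 on receive the last value, which keeps the range inside the model.\<close>

definition env4 :: "'a \<Rightarrow> 'a \<Rightarrow> 'a \<Rightarrow> 'a \<Rightarrow> nat \<Rightarrow> 'a" where
  "env4 a b c d i = (if i = 0 then a else if i = 1 then b else if i = 2 then c else d)"

lemma env4_simps [simp]:
  "env4 a b c d 0 = a" "env4 a b c d (Suc 0) = b" "env4 a b c d 2 = c" "env4 a b c d 3 = d"
  by (simp_all add: env4_def)

lemma env4_in [simp]: "a \<in> M \<Longrightarrow> b \<in> M \<Longrightarrow> c \<in> M \<Longrightarrow> d \<in> M \<Longrightarrow> env4 a b c d i \<in> M"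
  by (simp add: env4_def)

lemma comp_env4: "\<sigma> \<circ> env4 a b c d = env4 (\<sigma> a) (\<sigma> b) (\<sigma> c) (\<sigma> d)"
  by (auto simp: env4_def)

lemma inj_map_lepoll: assumes "inj_map f X Y" shows "X \<lesssim> Y"
proof -
  have "\<forall>x\<in>X. \<exists>y\<in>Y. opair x y \<in> elts f"
    using assms unfolding inj_map_def is_map_def by (metis opair_inject)
  then obtain h where h: "\<forall>x\<in>X. h x \<in> Y \<and> opair x (h x) \<in> elts f" by metis
  then have "inj_on h X" using assms unfolding inj_map_def inj_on_def by metis
  then show ?thesis using h unfolding lepoll_def by blast
qed

text \<open>The bound on the graph is what later places the injection in the fixed set
  \<open>injections\<close>, and thus in \<open>H_\<theta>\<close>.\<close>

lemma inj_map_exists: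
  fixes x :: "'v::zfc"
  assumes "countable (elts x)"
  shows "\<exists>f. elts f \<subseteq> (\<Union>u\<in>elts x. opair u ` elts omega) \<and> inj_map f (elts x) (elts omega)"
proof -
  obtain h :: "'v \<Rightarrow> 'v" where h: "inj_on h (elts x)" "h ` elts x \<subseteq> elts omega"
    using assms unfolding countable_iff_lepoll_omega lepoll_def by blast
  define f where "f = mkset ((\<lambda>u. opair u (h u)) ` elts x)"
  have f: "elts f = (\<lambda>u. opair u (h u)) ` elts x"
    unfolding f_def by (rule elts_mkset_small) auto
  have "inj_map f (elts x) (elts omega)"
    unfolding inj_map_def is_map_def
  proof (intro conjI)
    have mem: "opair a b \<in> elts f \<longleftrightarrow> a \<in> elts x \<and> b = h a" for a b by (auto simp: f)
    show "\<forall>z\<in>elts f. \<exists>x\<in>elts x. \<exists>y\<in>elts omega. z = opair x y" using h(2) f by blast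
    show "\<forall>x\<in>elts x. \<exists>!y. opair x y \<in> elts f" by (simp add: mem)
    show "\<forall>u v n. opair u n \<in> elts f \<and> opair v n \<in> elts f \<longrightarrow> u = v"
      unfolding mem using inj_onD[OF h(1)] by blast
  qed
  moreover have "elts f \<subseteq> (\<Union>u\<in>elts x. opair u ` elts omega)" using h(2) unfolding f by blast
  ultimately show ?thesis by blast
qed

definition F_succ :: "nat \<Rightarrow> nat \<Rightarrow> form" where
  "F_succ u y = FAll 3 (FIff (FMem 3 u) (FOr (FMem 3 y) (FEq 3 y)))"

lemma sat_F_succ:
  assumes "pairing_class M'" "s u \<in> M'" "s y \<in> M'" "u < 3" "y < 3"
  shows "sat M' P' (F_succ u y) s \<longleftrightarrow> s u = osucc (s y)"
proof -
  have "sat M' P' (F_succ u y) s \<longleftrightarrow> elts (s u) = insert (s y) (elts (s y))"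
    using assms(4,5) pairing_class_trans[OF assms(1,2)] pairing_class_trans[OF assms(1,3)] assms(3)
    by (auto simp: F_succ_def)
  then show ?thesis by (metis elts_osucc elts_inject)
qed

lemma F_empty:
  assumes "pairing_class M'" "e \<in> M'"
  shows "(\<forall>z\<in>M'. z \<notin> elts e) \<longleftrightarrow> e = mkset {}"
  using pairing_class_trans[OF assms] by (metis all_not_in_conv elts_mkset_small mkset_elts small_empty)

section \<open>Elementary embeddings between transitive classes closed under pairing\<close>

locale embedding =
  fixes \<sigma> :: "'v::zfc \<Rightarrow> 'v" and M P N Q :: "'v set"
  assumes M: "pairing_class M" and N: "pairing_class N" and elem: "elementary \<sigma> M P N Q"
begin

lemma in_N: "x \<in> M \<Longrightarrow> \<sigma> x \<in> N"
  using elem unfolding elementary_def by blast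

lemma M_trans: "x \<in> M \<Longrightarrow> y \<in> elts x \<Longrightarrow> y \<in> M"
  using pairing_class_trans[OF M] .

lemma N_trans: "x \<in> N \<Longrightarrow> y \<in> elts x \<Longrightarrow> y \<in> N"
  using pairing_class_trans[OF N] .

lemma transfer:
  assumes "a \<in> M" "b \<in> M" "c \<in> M" "d \<in> M"
  shows "sat M P \<phi> (env4 a b c d) \<longleftrightarrow> sat N Q \<phi> (env4 (\<sigma> a) (\<sigma> b) (\<sigma> c) (\<sigma> d))"
proof -
  have "range (env4 a b c d) \<subseteq> M" using assms by auto
  then show ?thesis using elem unfolding elementary_def by (metis comp_env4)
qed

lemma sigma_mem: "a \<in> M \<Longrightarrow> b \<in> M \<Longrightarrow> \<sigma> a \<in> elts (\<sigma> b) \<longleftrightarrow> a \<in> elts b"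
  using transfer[of a b b b "FMem 0 1"] by simp

lemma sigma_eq: "a \<in> M \<Longrightarrow> b \<in> M \<Longrightarrow> \<sigma> a = \<sigma> b \<longleftrightarrow> a = b"
  using transfer[of a b b b "FEq 0 1"] by simp

lemma sigma_opair: assumes "a \<in> M" "b \<in> M" shows "\<sigma> (opair a b) = opair (\<sigma> a) (\<sigma> b)"
proof -
  have o: "opair a b \<in> M" using assms pairing_class_opair_iff[OF M] by blast
  then have "sat M P (F_opair 0 1 2) (env4 (opair a b) a b b)"
    using assms sat_F_opair[OF M, of "env4 (opair a b) a b b" 0 1 2] by simp
  then have "sat N Q (F_opair 0 1 2) (env4 (\<sigma> (opair a b)) (\<sigma> a) (\<sigma> b) (\<sigma> b))"
    using transfer o assms by blast
  then show ?thesis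
    using assms o in_N sat_F_opair[OF N, of "env4 (\<sigma> (opair a b)) (\<sigma> a) (\<sigma> b) (\<sigma> b)" 0 1 2] by simp
qed

text \<open>The components of \<open>\<sigma> z\<close> lie in \<open>N\<close>, so "is an ordered
  pair" holds there and pulls back to \<open>z\<close>; as \<open>\<sigma>\<close> commutes with
  pairing, the components correspond.\<close>

lemma opair_preimage:
  assumes "z \<in> M" "\<sigma> z = opair u v"
  obtains a b where "a \<in> M" "b \<in> M" "z = opair a b" "\<sigma> a = u" "\<sigma> b = v"
proof -
  have "\<sigma> z \<in> N" using assms in_N by blast
  then have uv: "u \<in> N" "v \<in> N" using assms pairing_class_opair_iff[OF N] by metis+
  have *: "sat N Q (FEx 1 (FEx 2 (F_opair 0 1 2))) (env4 (\<sigma> z) (\<sigma> z) (\<sigma> z) (\<sigma> z))"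
    using uv \<open>\<sigma> z \<in> N\<close> assms by (auto simp: sat_F_opair[OF N] intro!: bexI[of _ u] bexI[of _ v])
  then have "sat M P (FEx 1 (FEx 2 (F_opair 0 1 2))) (env4 z z z z)"
    using transfer assms by blast
  then obtain a b where ab: "a \<in> M" "b \<in> M" "z = opair a b"
    using assms by (auto simp: sat_F_opair[OF M])
  moreover have "\<sigma> a = u" "\<sigma> b = v" using assms ab sigma_opair[of a b] by auto
  ultimately show ?thesis using that by blast
qed

lemma inj_map_transfer:
  assumes "f \<in> M" "x \<in> M" "w \<in> M"
  shows "inj_map f (elts x) (elts w) \<longleftrightarrow> inj_map (\<sigma> f) (elts (\<sigma> x)) (elts (\<sigma> w))"
  using transfer[of f x w w F_inj] sat_F_inj[OF M, of "env4 f x w w"] assms in_N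
    sat_F_inj[OF N, of "env4 (\<sigma> f) (\<sigma> x) (\<sigma> w) (\<sigma> w)"] by simp

lemma ex_inj_map_transfer:
  assumes "x \<in> M" "w \<in> M"
  shows "(\<exists>f\<in>M. inj_map f (elts x) (elts w)) \<longleftrightarrow> (\<exists>f\<in>N. inj_map f (elts (\<sigma> x)) (elts (\<sigma> w)))"
  using transfer[of x x w w "FEx 0 F_inj"] assms in_N
  by (simp add: sat_F_inj[OF M] sat_F_inj[OF N] cong: bex_cong)

text \<open>Here \<open>w\<close> is not yet known to be \<open>omega\<close>. That it contains an
  empty set and the successor of \<open>ord_of_nat n\<close> is pulled back from
  \<open>omega\<close>; being empty or a successor is then pushed forward, which shows that
  \<open>\<sigma>\<close> fixes the number.\<close>

lemma sigma_ord_of_nat: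
  assumes w: "w \<in> M" "\<sigma> w = omega"
  shows "ord_of_nat n \<in> elts w \<and> \<sigma> (ord_of_nat n) = ord_of_nat n"
proof (induction n)
  case 0
  have wN: "omega \<in> N" using w in_N by metis
  have e: "mkset {} \<in> elts (omega :: 'v)" unfolding elts_omega using ord_of_nat.simps(1) by (metis rangeI)
  then have "sat N Q (FEx 1 (FAnd (FMem 1 0) (FAll 2 (FNeg (FMem 2 1))))) (env4 omega omega omega omega)"
    using N_trans[OF wN] F_empty[OF N, of "mkset {}"] by auto
  then have "sat M P (FEx 1 (FAnd (FMem 1 0) (FAll 2 (FNeg (FMem 2 1))))) (env4 w w w w)"
    by (simp only: transfer[OF w(1) w(1) w(1) w(1)] w(2))
  then have ew: "mkset {} \<in> elts w" using F_empty[OF M] by auto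
  then have eM: "mkset {} \<in> M" using M_trans w by blast
  have "sat M P (FAll 2 (FNeg (FMem 2 0))) (env4 (mkset {}) w w w)"
    using F_empty[OF M] eM by auto
  then have "sat N Q (FAll 2 (FNeg (FMem 2 0))) (env4 (\<sigma> (mkset {})) (\<sigma> w) (\<sigma> w) (\<sigma> w))"
    using transfer eM w by blast
  then have "\<sigma> (mkset {}) = mkset {}" using F_empty[OF N] in_N eM by auto
  then show ?case using ew by simp
next
  case (Suc n)
  let ?n = "ord_of_nat n :: 'v"
  have wN: "omega \<in> N" using w in_N by metis
  have nM: "?n \<in> M" using Suc M_trans w by blast
  have S: "osucc ?n = ord_of_nat (Suc n)" by (simp add: osucc_def)
  have SN: "osucc ?n \<in> elts omega" "osucc ?n \<in> N" "?n \<in> N"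
    using N_trans[OF wN] unfolding S elts_omega by blast+
  have "sat N Q (FEx 2 (FAnd (FMem 2 0) (F_succ 2 1))) (env4 omega ?n ?n ?n)"
    using SN by (auto simp: sat_F_succ[OF N] intro!: bexI[of _ "osucc ?n"])
  then have "sat M P (FEx 2 (FAnd (FMem 2 0) (F_succ 2 1))) (env4 w ?n ?n ?n)"
    by (simp only: transfer[OF w(1) nM nM nM] w(2) Suc)
  then have Sw: "osucc ?n \<in> elts w" using nM by (auto simp: sat_F_succ[OF M])
  then have SM: "osucc ?n \<in> M" using M_trans w by blast
  have "sat M P (F_succ 0 1) (env4 (osucc ?n) ?n ?n ?n)"
    using SM nM by (simp add: sat_F_succ[OF M])
  then have "sat N Q (F_succ 0 1) (env4 (\<sigma> (osucc ?n)) ?n ?n ?n)"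
    by (simp only: transfer[OF SM nM nM nM] Suc)
  then have "\<sigma> (osucc ?n) = osucc ?n" using in_N SM SN by (simp add: sat_F_succ[OF N])
  then show ?case using Sw unfolding S by simp
qed

text \<open>An element \<open>y\<close> of \<open>w\<close> is sent to a natural number, and that
  number is also the image of itself; injectivity of \<open>\<sigma>\<close> identifies the
  two.\<close>

lemma omega_preimage:
  assumes w: "w \<in> M" "\<sigma> w = omega" shows "w = omega"
proof -
  have "elts w = elts omega"
  proof (intro equalityI subsetI)
    fix y assume y: "y \<in> elts w"
    then have "\<sigma> y \<in> elts omega" using sigma_mem[of y w] w M_trans by auto
    then obtain n where n: "\<sigma> y = ord_of_nat n" unfolding elts_omega by blast
    then have "\<sigma> y = \<sigma> (ord_of_nat n)" using sigma_ord_of_nat[OF w] by simp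
    then have "y = ord_of_nat n"
      using sigma_eq[of y "ord_of_nat n"] M_trans[OF w(1)] y sigma_ord_of_nat[OF w, of n] by blast
    then show "y \<in> elts omega" unfolding elts_omega by blast
  qed (use sigma_ord_of_nat[OF w] in \<open>auto simp: elts_omega\<close>)
  then show ?thesis by simp
qed

text \<open>An element \<open>y\<close> of \<open>\<sigma> x\<close> has an index \<open>n\<close>
  under \<open>\<sigma> f\<close>, and \<open>\<sigma>\<close> fixes \<open>n\<close>. Hence "some
  element of \<open>x\<close> has index \<open>n\<close>" pulls back to an element \<open>z\<close>,
  and \<open>\<sigma> z\<close> and \<open>y\<close> share their index.\<close>

lemma sigma_countable:
  assumes w: "omega \<in> M" "\<sigma> omega = omega" and x: "x \<in> M"
    and f: "f \<in> M" "inj_map f (elts x) (elts omega)"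
  shows "elts (\<sigma> x) = \<sigma> ` elts x"
proof (intro equalityI subsetI)
  fix y assume y: "y \<in> elts (\<sigma> x)"
  have inj: "inj_map (\<sigma> f) (elts (\<sigma> x)) (elts omega)"
    using inj_map_transfer[OF f(1) x w(1)] f w by simp
  have yN: "y \<in> N" using y N_trans in_N x by blast
  obtain n where n: "opair y n \<in> elts (\<sigma> f)" "n \<in> elts omega"
    using inj y unfolding inj_map_def is_map_def by (metis opair_inject)
  have nM: "n \<in> M" using n w M_trans by blast
  have fix_n: "\<sigma> n = n" using sigma_ord_of_nat[OF w] n(2) unfolding elts_omega by auto
  have nN: "n \<in> N" using fix_n in_N[OF nM] by simp
  have "sat N Q (FEx 3 (FAnd (FMem 3 1) (F_app 0 3 2))) (env4 (\<sigma> f) (\<sigma> x) n n)"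
    using y n yN nN in_N f x by (auto simp: sat_F_app[OF N] intro!: bexI[of _ y])
  then have "sat M P (FEx 3 (FAnd (FMem 3 1) (F_app 0 3 2))) (env4 f x n n)"
    by (simp only: transfer[OF f(1) x nM nM] fix_n)
  then obtain z where z: "z \<in> M" "z \<in> elts x" "opair z n \<in> elts f"
    using f x nM by (auto simp: sat_F_app[OF M])
  have "opair z n \<in> M" using z f M_trans by blast
  then have "opair (\<sigma> z) n \<in> elts (\<sigma> f)"
    using sigma_mem[of "opair z n" f] sigma_opair[of z n] z f nM fix_n by simp
  then have "y = \<sigma> z" using inj n unfolding inj_map_def by blast
  then show "y \<in> \<sigma> ` elts x" using z by blast
next
  fix y assume "y \<in> \<sigma> ` elts x"
  then show "y \<in> elts (\<sigma> x)" using sigma_mem[OF M_trans[OF x] x] by blast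
qed

section \<open>The preimage \<open>d\<close> of \<open>omega1\<close>: the first uncountable ordinal
  of \<open>M\<close>, below which \<open>\<sigma>\<close> is the identity\<close>

context
  fixes d
  assumes w: "omega \<in> M" "\<sigma> omega = omega" and d: "d \<in> M" "\<sigma> d = omega1"
    and inj: "\<And>\<alpha>. \<alpha> \<in> elts omega1 \<Longrightarrow> \<exists>f\<in>N. inj_map f (elts \<alpha>) (elts omega)"
begin

lemma omega1_preimage_iff: "\<alpha> \<in> M \<Longrightarrow> \<alpha> \<in> elts d \<longleftrightarrow> \<sigma> \<alpha> \<in> elts omega1"
  using sigma_mem[of \<alpha> d] d by simp

lemma Ord_omega1_preimage: "Ord d"
proof (rule OrdI)
  show tr: "x \<in> elts d" if "x \<in> elts y" "y \<in> elts d" for x y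
    using that omega1_preimage_iff[of x] omega1_preimage_iff[of y] M_trans[OF d(1), of y]
      M_trans[of y x] sigma_mem[of x y] omega1_in by blast
  show "Ord y" if y: "y \<in> elts d" for y
    using y
  proof (induction y rule: elts_induct)
    case (step y)
    show ?case
    proof (rule OrdI)
      show "Ord z" if "z \<in> elts y" for z using step.IH[OF that] tr[OF that step.prems] by blast
      fix u v assume u: "u \<in> elts v" "v \<in> elts y"
      then have m: "y \<in> M" "v \<in> M" "u \<in> M" using M_trans d step.prems by blast+
      have "\<sigma> u \<in> elts (\<sigma> y)"
        using u omega1_trans[of "\<sigma> u" "\<sigma> v" "\<sigma> y"] sigma_mem m omega1_preimage_iff step.prems by blast
      then show "u \<in> elts y" using sigma_mem m by blast
    qed
  qed
qed

text \<open>This is where the target must contain enough injections: one for the countable ordinal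
  \<open>\<sigma> \<alpha>\<close> exists in \<open>N\<close>, and its existence pulls back.\<close>

lemma ex_inj_map_omega1_preimage: assumes "\<alpha> \<in> elts d" shows "\<exists>f\<in>M. inj_map f (elts \<alpha>) (elts omega)"
  using ex_inj_map_transfer[of \<alpha> omega] inj[of "\<sigma> \<alpha>"] omega1_preimage_iff assms M_trans[OF d(1)] w
  by auto

text \<open>Such a map would be sent to a genuine injection of \<open>omega1\<close> into
  \<open>omega\<close>.\<close>

lemma no_inj_map_omega1_preimage: "\<not> (\<exists>f\<in>M. inj_map f (elts d) (elts omega))"
  using ex_inj_map_transfer[of d omega] d w inj_map_lepoll[of _ "elts omega1" "elts omega"]
    uncountable_omega1 by (metis countable_iff_lepoll_omega)

text \<open>Induction along membership: \<open>\<alpha>\<close> is countable in \<open>M\<close>, so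
  \<open>\<sigma> \<alpha>\<close> consists of the images of the elements of
  \<open>\<alpha>\<close>, which are fixed already.\<close>

lemma sigma_fixes: "\<alpha> \<in> elts d \<Longrightarrow> \<sigma> \<alpha> = \<alpha>"
proof (induction \<alpha> rule: elts_induct)
  case (step \<alpha>)
  obtain f where f: "f \<in> M" "inj_map f (elts \<alpha>) (elts omega)"
    using ex_inj_map_omega1_preimage[OF step.prems] by blast
  have "elts (\<sigma> \<alpha>) = \<sigma> ` elts \<alpha>"
    using sigma_countable[OF w M_trans[OF d(1) step.prems] f] .
  also have "\<dots> = elts \<alpha>" using step.IH Ord_trans[OF Ord_omega1_preimage _ step.prems] by simp
  finally show ?case by simp
qed

end

end

lemma is_omega1_of_unique: "is_omega1_of M d \<Longrightarrow> is_omega1_of M e \<Longrightarrow> d = e"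
  unfolding is_omega1_of_def using Ord_linear by blast

section \<open>Forcing over the ground model\<close>

text \<open>A name \<open>\<pi>\<close> occurring in \<open>\<tau>\<close> is reached from
  \<open>\<tau>\<close> through the pair and its singleton, so the induction runs along the
  transitive closure of membership.\<close>

lemma name_induct [case_names step]:
  assumes "\<And>\<tau>. (\<And>\<pi> s. opair \<pi> s \<in> elts \<tau> \<Longrightarrow> R \<pi>) \<Longrightarrow> R \<tau>" shows "R \<tau>"
proof -
  have "wf ({(x, y). x \<in> elts (y :: 'a::zfc)}\<^sup>+)" using foundation by (rule wf_trancl)
  then show ?thesis
  proof (induction \<tau> rule: wf_induct_rule)
    case (less \<tau>)
    show ?case
    proof (rule assms)
      fix \<pi> s assume "opair \<pi> s \<in> elts \<tau>"
      moreover have "\<pi> \<in> elts (mkset {\<pi>})" "mkset {\<pi>} \<in> elts (opair \<pi> s)" by (simp_all add: elts_opair)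
      ultimately have "(\<pi>, \<tau>) \<in> {(x, y). x \<in> elts y}\<^sup>+"
        by (meson CollectI case_prodI r_into_trancl' trancl_trans)
      then show "R \<pi>" by (rule less)
    qed
  qed
qed

locale forcing =
  fixes P :: "'v::zfc"
  assumes forcing: "forcing_notion P"
begin

abbreviation leq (infix "\<sqsubseteq>" 50) where "p \<sqsubseteq> q \<equiv> le P p q"
abbreviation "feq \<equiv> forces_eq P"
abbreviation "fmem \<equiv> forces_mem P"

lemma le_cond: "q \<sqsubseteq> p \<Longrightarrow> q \<in> cond P \<and> p \<in> cond P"
  unfolding le_def by blast

lemma le_refl: "p \<in> cond P \<Longrightarrow> p \<sqsubseteq> p"
  using forcing unfolding forcing_notion_def by blast

lemma le_refl1: "q \<sqsubseteq> p \<Longrightarrow> q \<sqsubseteq> q"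
  using le_cond le_refl by blast

lemma le_trans: "p \<sqsubseteq> q \<Longrightarrow> q \<sqsubseteq> r \<Longrightarrow> p \<sqsubseteq> r"
  using forcing unfolding forcing_notion_def by blast

lemma largest_ge: "t \<in> largest P \<Longrightarrow> p \<in> cond P \<Longrightarrow> p \<sqsubseteq> t"
  unfolding largest_def by blast

lemma ex_largest: "\<exists>t. t \<in> largest P"
  using forcing unfolding forcing_notion_def by blast

lemma largest_cond: "t \<in> largest P \<Longrightarrow> t \<in> cond P"
  unfolding largest_def by blast

section \<open>Forced equality and membership\<close>

text \<open>Once \<open>q\<close> itself lies below \<open>s\<close>, every \<open>r\<close> below
  \<open>q\<close> does, which discharges the inner implication of the definition. Together with
  \<open>feqD2\<close> and \<open>feqI\<close> this yields the usual density form of forced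
  equality.\<close>

lemma feqD1:
  assumes "feq a b p" "opair \<pi> s \<in> elts a" "q \<sqsubseteq> p" "q \<sqsubseteq> s"
  shows "\<exists>r \<pi>' s'. r \<sqsubseteq> q \<and> opair \<pi>' s' \<in> elts b \<and> r \<sqsubseteq> s' \<and> feq \<pi> \<pi>' r"
  using assms(1)
proof (cases rule: forces_eq.cases)
  case 1
  then have "\<exists>r. r \<sqsubseteq> q \<and> (r \<sqsubseteq> s \<longrightarrow> (\<exists>\<pi>' s'. opair \<pi>' s' \<in> elts b \<and> r \<sqsubseteq> s' \<and> feq \<pi> \<pi>' r))"
    using assms(2,3) by blast
  then show ?thesis using assms(4) le_trans by blast
qed

lemma feqD2:
  assumes "feq a b p" "opair \<pi>' s' \<in> elts b" "q \<sqsubseteq> p" "q \<sqsubseteq> s'"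
  shows "\<exists>r \<pi> s. r \<sqsubseteq> q \<and> opair \<pi> s \<in> elts a \<and> r \<sqsubseteq> s \<and> feq \<pi> \<pi>' r"
  using assms(1)
proof (cases rule: forces_eq.cases)
  case 1
  then have "\<exists>r. r \<sqsubseteq> q \<and> (r \<sqsubseteq> s' \<longrightarrow> (\<exists>\<pi> s. opair \<pi> s \<in> elts a \<and> r \<sqsubseteq> s \<and> feq \<pi> \<pi>' r))"
    using assms(2,3) by blast
  then show ?thesis using assms(4) le_trans by blast
qed

lemma feqI:
  assumes 1: "\<And>\<pi> s q. opair \<pi> s \<in> elts a \<Longrightarrow> q \<sqsubseteq> p \<Longrightarrow> q \<sqsubseteq> s \<Longrightarrow>
      \<exists>r \<pi>' s'. r \<sqsubseteq> q \<and> opair \<pi>' s' \<in> elts b \<and> r \<sqsubseteq> s' \<and> feq \<pi> \<pi>' r"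
    and 2: "\<And>\<pi>' s' q. opair \<pi>' s' \<in> elts b \<Longrightarrow> q \<sqsubseteq> p \<Longrightarrow> q \<sqsubseteq> s' \<Longrightarrow>
      \<exists>r \<pi> s. r \<sqsubseteq> q \<and> opair \<pi> s \<in> elts a \<and> r \<sqsubseteq> s \<and> feq \<pi> \<pi>' r"
  shows "feq a b p"
proof (rule forces_eq.intros; intro allI impI)
  fix \<pi> s q assume A: "opair \<pi> s \<in> elts a" "q \<sqsubseteq> p"
  show "\<exists>r. r \<sqsubseteq> q \<and> (r \<sqsubseteq> s \<longrightarrow> (\<exists>\<pi>' s'. opair \<pi>' s' \<in> elts b \<and> r \<sqsubseteq> s' \<and> feq \<pi> \<pi>' r))"
  proof (cases "q \<sqsubseteq> s")
    case True then show ?thesis using 1[OF A] by blast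
  next
    \<comment> \<open>If \<open>q\<close> is not below \<open>s\<close>, the witness
      \<open>r = q\<close> satisfies the implication vacuously.\<close>
    case False then show ?thesis using le_refl1[OF A(2)] by blast
  qed
next
  fix \<pi>' s' q assume A: "opair \<pi>' s' \<in> elts b" "q \<sqsubseteq> p"
  show "\<exists>r. r \<sqsubseteq> q \<and> (r \<sqsubseteq> s' \<longrightarrow> (\<exists>\<pi> s. opair \<pi> s \<in> elts a \<and> r \<sqsubseteq> s \<and> feq \<pi> \<pi>' r))"
  proof (cases "q \<sqsubseteq> s'")
    case True then show ?thesis using 2[OF A] by blast
  next
    case False then show ?thesis using le_refl1[OF A(2)] by blast
  qed
qed

lemma feq_mono: assumes "feq a b p" "q \<sqsubseteq> p" shows "feq a b q"
  by (rule feqI) (use assms feqD1[OF assms(1)] feqD2[OF assms(1)] le_trans in meson)+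

lemma feq_sym: "feq a b p \<Longrightarrow> feq b a p"
proof (induction a arbitrary: b p rule: name_induct)
  case (step a)
  show ?case
    by (rule feqI) (use feqD1[OF step.prems] feqD2[OF step.prems] step.IH in meson)+
qed

lemma feq_refl: "p \<in> cond P \<Longrightarrow> feq a a p"
proof (induction a arbitrary: p rule: name_induct)
  case (step a)
  show ?case by (rule feqI) (use le_cond le_refl step.IH in meson)+
qed

lemma feq_trans: "feq a b p \<Longrightarrow> feq b c p \<Longrightarrow> feq a c p"
proof (induction a arbitrary: b c p rule: name_induct)
  case (step a)
  show ?case
  proof (rule feqI)
    fix \<pi> s q assume A: "opair \<pi> s \<in> elts a" "q \<sqsubseteq> p" "q \<sqsubseteq> s"
    obtain r \<pi>' s' where 1: "r \<sqsubseteq> q" "opair \<pi>' s' \<in> elts b" "r \<sqsubseteq> s'" "feq \<pi> \<pi>' r"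
      using feqD1[OF step.prems(1) A] by blast
    obtain t \<pi>'' s'' where 2: "t \<sqsubseteq> r" "opair \<pi>'' s'' \<in> elts c" "t \<sqsubseteq> s''" "feq \<pi>' \<pi>'' t"
      using feqD1[OF step.prems(2) 1(2) le_trans[OF 1(1) A(2)] 1(3)] by blast
    have "feq \<pi> \<pi>'' t" using step.IH[OF A(1) feq_mono[OF 1(4) 2(1)] 2(4)] .
    then show "\<exists>r \<pi>' s'. r \<sqsubseteq> q \<and> opair \<pi>' s' \<in> elts c \<and> r \<sqsubseteq> s' \<and> feq \<pi> \<pi>' r"
      using 1 2 le_trans by blast
  next
    fix \<pi>'' s'' q assume A: "opair \<pi>'' s'' \<in> elts c" "q \<sqsubseteq> p" "q \<sqsubseteq> s''"
    obtain r \<pi>' s' where 1: "r \<sqsubseteq> q" "opair \<pi>' s' \<in> elts b" "r \<sqsubseteq> s'" "feq \<pi>' \<pi>'' r"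
      using feqD2[OF step.prems(2) A] by blast
    obtain t \<pi> s where 2: "t \<sqsubseteq> r" "opair \<pi> s \<in> elts a" "t \<sqsubseteq> s" "feq \<pi> \<pi>' t"
      using feqD2[OF step.prems(1) 1(2) le_trans[OF 1(1) A(2)] 1(3)] by blast
    have "feq \<pi> \<pi>'' t" using step.IH[OF 2(2) 2(4) feq_mono[OF 1(4) 2(1)]] .
    then show "\<exists>r \<pi> s. r \<sqsubseteq> q \<and> opair \<pi> s \<in> elts a \<and> r \<sqsubseteq> s \<and> feq \<pi> \<pi>'' r"
      using 1 2 le_trans by blast
  qed
qed

lemma fmem_mono: "fmem a b p \<Longrightarrow> q \<sqsubseteq> p \<Longrightarrow> fmem a b q"
  unfolding forces_mem_def using le_trans by blast

lemma fmemD: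
  assumes "fmem a b p" "p \<in> cond P"
  shows "\<exists>r \<pi> s. r \<sqsubseteq> p \<and> opair \<pi> s \<in> elts b \<and> r \<sqsubseteq> s \<and> feq \<pi> a r"
  using assms le_refl unfolding forces_mem_def by blast

lemma fmem_elem: "opair \<pi> s \<in> elts b \<Longrightarrow> p \<sqsubseteq> s \<Longrightarrow> fmem \<pi> b p"
  unfolding forces_mem_def using le_trans le_cond le_refl feq_refl by meson

lemma fmem_cong_left: "fmem a b p \<Longrightarrow> feq a a' p \<Longrightarrow> fmem a' b p"
  unfolding forces_mem_def using feq_trans feq_mono le_trans by meson

lemma fmem_cong_right: assumes "fmem a b p" "feq b b' p" shows "fmem a b' p"
  unfolding forces_mem_def
proof (intro allI impI)
  fix q assume q: "q \<sqsubseteq> p"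
  obtain r \<pi> s where 1: "r \<sqsubseteq> q" "opair \<pi> s \<in> elts b" "r \<sqsubseteq> s" "feq \<pi> a r"
    using fmemD[OF fmem_mono[OF assms(1) q]] le_cond q by blast
  obtain t \<pi>' s' where 2: "t \<sqsubseteq> r" "opair \<pi>' s' \<in> elts b'" "t \<sqsubseteq> s'" "feq \<pi> \<pi>' t"
    using feqD1[OF assms(2) 1(2) le_trans[OF 1(1) q] 1(3)] by blast
  have "feq \<pi>' a t" using feq_trans[OF feq_sym[OF 2(4)] feq_mono[OF 1(4) 2(1)]] .
  then show "\<exists>r. r \<sqsubseteq> q \<and> (\<exists>\<pi> s. opair \<pi> s \<in> elts b' \<and> r \<sqsubseteq> s \<and> feq \<pi> a r)"
    using 1 2 le_trans by blast
qed

lemma is_name_elem: "is_name P \<tau> \<Longrightarrow> opair \<pi> s \<in> elts \<tau> \<Longrightarrow> is_name P \<pi>"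
  by (cases rule: is_name.cases) auto

text \<open>Extensionality in the forcing language, with inclusion assumed only densely. It suffices
  to test names \<open>\<pi>\<close> occurring in \<open>a\<close> or \<open>b\<close>, since every
  condition below the attached \<open>s\<close> forces \<open>\<pi>\<close> into the name.\<close>

lemma feq_extensional:
  assumes "is_name P a" "is_name P b"
    and "\<And>\<tau> q. is_name P \<tau> \<Longrightarrow> q \<sqsubseteq> p \<Longrightarrow> fmem \<tau> a q \<Longrightarrow> \<exists>r. r \<sqsubseteq> q \<and> fmem \<tau> b r"
    and "\<And>\<tau> q. is_name P \<tau> \<Longrightarrow> q \<sqsubseteq> p \<Longrightarrow> fmem \<tau> b q \<Longrightarrow> \<exists>r. r \<sqsubseteq> q \<and> fmem \<tau> a r"
  shows "feq a b p"
proof (rule feqI)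
  fix \<pi> s q assume A: "opair \<pi> s \<in> elts a" "q \<sqsubseteq> p" "q \<sqsubseteq> s"
  obtain r where r: "r \<sqsubseteq> q" "fmem \<pi> b r"
    using assms(3)[OF is_name_elem[OF assms(1) A(1)] A(2) fmem_elem[OF A(1,3)]] by blast
  then show "\<exists>r \<pi>' s'. r \<sqsubseteq> q \<and> opair \<pi>' s' \<in> elts b \<and> r \<sqsubseteq> s' \<and> feq \<pi> \<pi>' r"
    using fmemD[OF r(2)] le_cond le_trans feq_sym by meson
next
  fix \<pi> s q assume A: "opair \<pi> s \<in> elts b" "q \<sqsubseteq> p" "q \<sqsubseteq> s"
  obtain r where r: "r \<sqsubseteq> q" "fmem \<pi> a r"
    using assms(4)[OF is_name_elem[OF assms(2) A(1)] A(2) fmem_elem[OF A(1,3)]] by blast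
  then show "\<exists>r \<pi>' s'. r \<sqsubseteq> q \<and> opair \<pi>' s' \<in> elts a \<and> r \<sqsubseteq> s' \<and> feq \<pi>' \<pi> r"
    using fmemD[OF r(2)] le_cond le_trans by meson
qed

section \<open>Check names and the atomic statements about them\<close>

lemma small_largest: "small (largest P)"
  by (rule small_subset[of "cond P"]) (auto simp: largest_def cond_def)

lemma elts_check: "elts (check P x) = (\<Union>y\<in>elts x. opair (check P y) ` largest P)"
  by (subst check.simps) (intro elts_mkset_small small_UN small_elts small_image small_largest)

lemma mem_check_iff: "opair \<pi> s \<in> elts (check P x) \<longleftrightarrow> (\<exists>y\<in>elts x. \<pi> = check P y \<and> s \<in> largest P)"
  by (auto simp: elts_check)

lemma is_name_check: "is_name P (check P x)"
proof (induction x rule: elts_induct)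
  case (step x)
  show ?case by (rule is_name.intros) (use step largest_cond in \<open>auto simp: elts_check\<close>)
qed

lemma fmem_checkI: "y \<in> elts x \<Longrightarrow> p \<in> cond P \<Longrightarrow> fmem (check P y) (check P x) p"
  using ex_largest largest_ge fmem_elem[of "check P y"] mem_check_iff[of "check P y"] by blast

lemma fmem_checkD:
  assumes "fmem \<tau> (check P x) p" "p \<in> cond P"
  shows "\<exists>r y. r \<sqsubseteq> p \<and> y \<in> elts x \<and> feq \<tau> (check P y) r"
  using fmemD[OF assms] feq_sym unfolding mem_check_iff by blast

text \<open>Induction on \<open>x\<close>: a largest condition is attached to every member of a
  check name, so the equality clauses apply at \<open>p\<close> itself and return a stronger
  condition equating check names of elements.\<close>

lemma feq_check: "p \<in> cond P \<Longrightarrow> feq (check P x) (check P y) p \<longleftrightarrow> x = y"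
proof
  show "feq (check P x) (check P y) p \<Longrightarrow> p \<in> cond P \<Longrightarrow> x = y"
  proof (induction x arbitrary: y p rule: elts_induct)
    case (step x)
    obtain t where t: "t \<in> largest P" using ex_largest by blast
    note p = le_refl[OF step.prems(2)] largest_ge[OF t step.prems(2)]
    have "elts x = elts y"
    proof (intro equalityI subsetI)
      fix z assume z: "z \<in> elts x"
      then have "opair (check P z) t \<in> elts (check P x)" using t mem_check_iff by blast
      from feqD1[OF step.prems(1) this p] obtain r w where
        "r \<sqsubseteq> p" "w \<in> elts y" "feq (check P z) (check P w) r" unfolding mem_check_iff by blast
      then show "z \<in> elts y" using step.IH[OF z] le_cond by blast
    next
      fix w assume "w \<in> elts y"
      then have "opair (check P w) t \<in> elts (check P y)" using t mem_check_iff by blast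
      from feqD2[OF step.prems(1) this p] obtain r z where
        "r \<sqsubseteq> p" "z \<in> elts x" "feq (check P z) (check P w) r" unfolding mem_check_iff by blast
      then show "w \<in> elts x" using step.IH le_cond by blast
    qed
    then show ?case by simp
  qed
qed (use feq_refl in blast)

lemma feq_check_unique: "feq \<tau> (check P x) p \<Longrightarrow> feq \<tau> (check P y) p \<Longrightarrow> p \<in> cond P \<Longrightarrow> x = y"
  using feq_check feq_sym feq_trans by blast

lemma feq_check_iff:
  assumes "feq a (check P x) p" "feq b (check P y) p" "p \<in> cond P"
  shows "feq a b p \<longleftrightarrow> x = y"
proof
  assume "feq a b p"
  then have "feq a (check P y) p" using assms(2) feq_trans by blast
  then show "x = y" using assms feq_check_unique by blast
next
  assume "x = y"
  then show "feq a b p" using assms feq_trans[OF assms(1) feq_sym] by simp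
qed

lemma fmem_check_iff:
  assumes "feq a (check P x) p" "feq b (check P y) p" "p \<in> cond P"
  shows "fmem a b p \<longleftrightarrow> x \<in> elts y"
proof
  assume "fmem a b p"
  then have "fmem (check P x) (check P y) p"
    using assms fmem_cong_left fmem_cong_right by blast
  then obtain r z where z: "r \<sqsubseteq> p" "z \<in> elts y" "feq (check P x) (check P z) r"
    using fmem_checkD assms(3) by blast
  then have "x = z" using feq_check le_cond[OF z(1)] by blast
  then show "x \<in> elts y" using z(2) by simp
next
  assume "x \<in> elts y"
  then have "fmem (check P x) (check P y) p" using fmem_checkI assms(3) by blast
  then show "fmem a b p" using assms fmem_cong_left fmem_cong_right feq_sym by blast
qed

section \<open>Connectives and quantifiers as density statements below a condition\<close>

lemma f_or_iff: "f_or P \<Phi> \<Psi> p \<longleftrightarrow> (\<forall>q. q \<sqsubseteq> p \<longrightarrow> (\<exists>r. r \<sqsubseteq> q \<and> (\<Phi> r \<or> \<Psi> r)))"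
  unfolding f_or_def f_not_def f_and_def by blast

lemma f_imp_iff: "f_imp P \<Phi> \<Psi> p \<longleftrightarrow> (\<forall>q. q \<sqsubseteq> p \<longrightarrow> \<Phi> q \<longrightarrow> (\<exists>r. r \<sqsubseteq> q \<and> \<Psi> r))"
  unfolding f_imp_def f_not_def f_and_def by blast

lemma f_ex_iff: "f_ex P \<Phi> p \<longleftrightarrow> (\<forall>q. q \<sqsubseteq> p \<longrightarrow> (\<exists>r \<tau>. r \<sqsubseteq> q \<and> is_name P \<tau> \<and> \<Phi> \<tau> r))"
  unfolding f_ex_def f_all_def f_not_def by blast

lemma f_bex_iff:
  "f_bex P M \<Phi> p \<longleftrightarrow> (\<forall>q. q \<sqsubseteq> p \<longrightarrow> (\<exists>r \<tau>. r \<sqsubseteq> q \<and> is_name P \<tau> \<and> fmem \<tau> M r \<and> \<Phi> \<tau> r))"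
  unfolding f_bex_def f_ex_iff f_and_def by blast

lemma f_ball_iff:
  "f_ball P M \<Phi> p \<longleftrightarrow> (\<forall>\<tau> q. is_name P \<tau> \<longrightarrow> q \<sqsubseteq> p \<longrightarrow> fmem \<tau> M q \<longrightarrow> (\<exists>r. r \<sqsubseteq> q \<and> \<Phi> \<tau> r))"
  unfolding f_ball_def f_all_def f_imp_iff by blast

lemma f_iff_mono: "f_iff P \<Phi> \<Psi> p \<Longrightarrow> q \<sqsubseteq> p \<Longrightarrow> f_iff P \<Phi> \<Psi> q"
  unfolding f_iff_def f_and_def f_imp_iff using le_trans by blast

lemma f_is_upair_mono: "f_is_upair P w x y p \<Longrightarrow> q \<sqsubseteq> p \<Longrightarrow> f_is_upair P w x y q"
  unfolding f_is_upair_def f_all_def using f_iff_mono by blast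

lemma f_is_opair_mono: "f_is_opair P z x y p \<Longrightarrow> q \<sqsubseteq> p \<Longrightarrow> f_is_opair P z x y q"
  unfolding f_is_opair_def f_all_def using f_iff_mono by blast

lemma f_bex_mono: "f_bex P M \<Phi> p \<Longrightarrow> q \<sqsubseteq> p \<Longrightarrow> f_bex P M \<Phi> q"
  unfolding f_bex_iff using le_trans by blast

lemma f_apply_mono: "f_apply P f x y p \<Longrightarrow> q \<sqsubseteq> p \<Longrightarrow> f_apply P f x y q"
  unfolding f_apply_def using f_bex_mono by blast

lemma f_sat_mono: "f_sat P M Q \<phi> s p \<Longrightarrow> q \<sqsubseteq> p \<Longrightarrow> f_sat P M Q \<phi> s q"
proof (induction \<phi> arbitrary: s p q)
  case (FEq i j) then show ?case using feq_mono by simp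
next
  case (FMem i j) then show ?case using fmem_mono by simp
next
  case (FPred i) then show ?case using fmem_mono by simp
next
  case (FNeg \<phi>) then show ?case unfolding f_sat.simps f_not_def using le_trans by blast
next
  case (FAnd \<phi> \<psi>) then show ?case unfolding f_sat.simps f_and_def by blast
next
  case (FEx i \<phi>) then show ?case unfolding f_sat.simps using f_bex_mono by blast
qed

section \<open>Unordered and ordered pairs in the forcing language\<close>

lemma f_is_upairD1:
  assumes "f_is_upair P w x y p" "fmem \<tau> w p" "is_name P \<tau>" "p \<in> cond P"
  shows "\<exists>r. r \<sqsubseteq> p \<and> (feq \<tau> x r \<or> feq \<tau> y r)"
proof -
  have "f_imp P (fmem \<tau> w) (f_or P (feq \<tau> x) (feq \<tau> y)) p"
    using assms unfolding f_is_upair_def f_all_def f_iff_def f_and_def by blast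
  then obtain r where "r \<sqsubseteq> p" "f_or P (feq \<tau> x) (feq \<tau> y) r"
    unfolding f_imp_iff using assms le_refl by blast
  then show ?thesis unfolding f_or_iff using le_refl1 le_trans by blast
qed

lemma f_is_upairD2:
  assumes "f_is_upair P w x y p" "feq \<tau> x p \<or> feq \<tau> y p" "is_name P \<tau>" "p \<in> cond P"
  shows "\<exists>r. r \<sqsubseteq> p \<and> fmem \<tau> w r"
proof -
  have "f_imp P (f_or P (feq \<tau> x) (feq \<tau> y)) (fmem \<tau> w) p"
    using assms unfolding f_is_upair_def f_all_def f_iff_def f_and_def by blast
  moreover have "f_or P (feq \<tau> x) (feq \<tau> y) p"
    unfolding f_or_iff using assms(2) feq_mono le_refl1 by blast
  ultimately show ?thesis unfolding f_imp_iff using assms(4) le_refl by blast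
qed

lemma f_is_upairI:
  assumes 1: "\<And>\<tau> q. is_name P \<tau> \<Longrightarrow> q \<sqsubseteq> p \<Longrightarrow> fmem \<tau> w q \<Longrightarrow> \<exists>r. r \<sqsubseteq> q \<and> (feq \<tau> x r \<or> feq \<tau> y r)"
    and 2: "\<And>\<tau> q. is_name P \<tau> \<Longrightarrow> q \<sqsubseteq> p \<Longrightarrow> feq \<tau> x q \<or> feq \<tau> y q \<Longrightarrow> fmem \<tau> w q"
  shows "f_is_upair P w x y p"
  unfolding f_is_upair_def f_all_def f_iff_def f_and_def
proof (intro allI impI conjI)
  fix \<tau> assume \<tau>: "is_name P \<tau>"
  show "f_imp P (fmem \<tau> w) (f_or P (feq \<tau> x) (feq \<tau> y)) p"
    unfolding f_imp_iff
  proof (intro allI impI)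
    fix q assume q: "q \<sqsubseteq> p" "fmem \<tau> w q"
    have "f_or P (feq \<tau> x) (feq \<tau> y) q"
      unfolding f_or_iff using 1[OF \<tau>] fmem_mono[OF q(2)] le_trans[OF _ q(1)] by blast
    then show "\<exists>r. r \<sqsubseteq> q \<and> f_or P (feq \<tau> x) (feq \<tau> y) r" using le_refl1[OF q(1)] by blast
  qed
  show "f_imp P (f_or P (feq \<tau> x) (feq \<tau> y)) (fmem \<tau> w) p"
    unfolding f_imp_iff
  proof (intro allI impI)
    fix q assume q: "q \<sqsubseteq> p" "f_or P (feq \<tau> x) (feq \<tau> y) q"
    then obtain r where "r \<sqsubseteq> q" "feq \<tau> x r \<or> feq \<tau> y r"
      unfolding f_or_iff using le_refl1 by blast
    then show "\<exists>r. r \<sqsubseteq> q \<and> fmem \<tau> w r" using 2[OF \<tau>] le_trans q(1) by blast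
  qed
qed

lemma feq_check_upair:
  assumes "feq x (check P u) p" "feq y (check P v) p" "feq w (check P (mkset {u, v})) p"
  shows "f_is_upair P w x y p"
proof (rule f_is_upairI)
  fix \<tau> q assume q: "is_name P \<tau>" "q \<sqsubseteq> p" "fmem \<tau> w q"
  have "fmem \<tau> (check P (mkset {u, v})) q"
    using fmem_cong_right[OF q(3) feq_mono[OF assms(3) q(2)]] .
  then obtain r z where r: "r \<sqsubseteq> q" "z = u \<or> z = v" "feq \<tau> (check P z) r"
    using fmem_checkD[of \<tau> "mkset {u, v}" q] le_cond[OF q(2)] by auto
  have "feq x (check P u) r" "feq y (check P v) r"
    using assms(1,2) feq_mono le_trans[OF r(1) q(2)] by blast+
  then have "feq \<tau> x r \<or> feq \<tau> y r" using r(2,3) feq_trans feq_sym by blast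
  then show "\<exists>r. r \<sqsubseteq> q \<and> (feq \<tau> x r \<or> feq \<tau> y r)" using r(1) by blast
next
  fix \<tau> q assume q: "is_name P \<tau>" "q \<sqsubseteq> p" "feq \<tau> x q \<or> feq \<tau> y q"
  have xy: "feq x (check P u) q" "feq y (check P v) q" "feq w (check P (mkset {u, v})) q"
    using assms feq_mono[OF _ q(2)] by blast+
  then obtain z where z: "z = u \<or> z = v" "feq \<tau> (check P z) q"
    using q(3) feq_trans by blast
  then show "fmem \<tau> w q" using fmem_check_iff[OF z(2) xy(3)] le_cond[OF q(2)] by auto
qed

text \<open>Two names satisfying the pair formula for the same \<open>x\<close> and \<open>y\<close>
  densely have the same members; forced extensionality then identifies \<open>w\<close> with the
  check name, which satisfies the formula too.\<close>

lemma f_is_upair_check_unique: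
  assumes "feq x (check P u) p" "feq y (check P v) p" "f_is_upair P w x y p"
    "is_name P w" "p \<in> cond P"
  shows "feq w (check P (mkset {u, v})) p"
proof (rule feq_extensional[OF assms(4) is_name_check])
  let ?c = "check P (mkset {u, v})"
  have c: "f_is_upair P ?c x y p"
    using feq_check_upair[OF assms(1,2) feq_refl[OF assms(5)]] .
  {
    fix w w' \<tau> q
    assume A: "f_is_upair P w x y p" "f_is_upair P w' x y p" "is_name P \<tau>" "q \<sqsubseteq> p" "fmem \<tau> w q"
    have "\<exists>r. r \<sqsubseteq> q \<and> fmem \<tau> w' r"
      using f_is_upairD1[OF f_is_upair_mono[OF A(1,4)] A(5,3)]
        f_is_upairD2[OF f_is_upair_mono[OF A(2)] _ A(3)] A(4) le_cond le_trans by meson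
  }
  note key = this
  show "\<exists>r. r \<sqsubseteq> q \<and> fmem \<tau> ?c r" if "is_name P \<tau>" "q \<sqsubseteq> p" "fmem \<tau> w q" for \<tau> q
    using key[OF assms(3) c that] .
  show "\<exists>r. r \<sqsubseteq> q \<and> fmem \<tau> w r" if "is_name P \<tau>" "q \<sqsubseteq> p" "fmem \<tau> ?c q" for \<tau> q
    using key[OF c assms(3) that] .
qed

text \<open>A name for the unordered pair of the values of arbitrary names. It supplies an object
  for the pair formula when \<open>x\<close> and \<open>y\<close> are not yet identified with check
  names.\<close>

definition upair_name :: "'v \<Rightarrow> 'v \<Rightarrow> 'v" where
  "upair_name x y = mkset (opair x ` largest P \<union> opair y ` largest P)"

lemma elts_upair_name: "elts (upair_name x y) = opair x ` largest P \<union> opair y ` largest P"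
  unfolding upair_name_def by (intro elts_mkset_small small_Un small_image small_largest)

lemma is_name_upair_name: "is_name P x \<Longrightarrow> is_name P y \<Longrightarrow> is_name P (upair_name x y)"
  by (rule is_name.intros) (auto simp: elts_upair_name dest: largest_cond)

lemma f_is_upair_upair_name: "f_is_upair P (upair_name x y) x y p"
proof (rule f_is_upairI)
  fix \<tau> q assume "q \<sqsubseteq> p" "fmem \<tau> (upair_name x y) q"
  then obtain r \<pi> s where "r \<sqsubseteq> q" "opair \<pi> s \<in> elts (upair_name x y)" "feq \<pi> \<tau> r"
    using fmemD le_cond by meson
  then show "\<exists>r. r \<sqsubseteq> q \<and> (feq \<tau> x r \<or> feq \<tau> y r)" unfolding elts_upair_name using feq_sym by auto
next
  fix \<tau> q assume q: "q \<sqsubseteq> p" "feq \<tau> x q \<or> feq \<tau> y q"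
  obtain t where t: "t \<in> largest P" using ex_largest by blast
  then have "q \<sqsubseteq> t" using largest_ge le_cond q(1) by blast
  moreover have "opair x t \<in> elts (upair_name x y)" "opair y t \<in> elts (upair_name x y)"
    using t by (auto simp: elts_upair_name)
  ultimately have "fmem x (upair_name x y) q" "fmem y (upair_name x y) q"
    using fmem_elem by blast+
  then show "fmem \<tau> (upair_name x y) q" using q(2) fmem_cong_left feq_sym by blast
qed

lemma f_is_opairI:
  assumes "feq x (check P u) p" "feq y (check P v) p" "feq z (check P (opair u v)) p"
  shows "f_is_opair P z x y p"
  unfolding f_is_opair_def f_all_def f_iff_def f_and_def
proof (intro allI impI conjI)
  fix w assume w: "is_name P w"
  let ?D = "f_or P (f_is_upair P w x x) (f_is_upair P w x y)"
  show "f_imp P (fmem w z) ?D p"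
    unfolding f_imp_iff
  proof (intro allI impI)
    fix q assume q: "q \<sqsubseteq> p" "fmem w z q"
    have "fmem w (check P (opair u v)) q"
      using fmem_cong_right[OF q(2) feq_mono[OF assms(3) q(1)]] .
    then obtain r where r: "r \<sqsubseteq> q"
      "feq w (check P (mkset {u, u})) r \<or> feq w (check P (mkset {u, v})) r"
      using fmem_checkD[of w "opair u v" q] le_cond[OF q(1)] by (auto simp: elts_opair)
    have "f_is_upair P w x x r \<or> f_is_upair P w x y r"
      using r(2) feq_check_upair assms(1,2) feq_mono le_trans[OF r(1) q(1)] by meson
    then have "?D r" unfolding f_or_iff using f_is_upair_mono le_refl1 by blast
    then show "\<exists>r. r \<sqsubseteq> q \<and> ?D r" using r(1) by blast
  qed
  show "f_imp P ?D (fmem w z) p"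
    unfolding f_imp_iff
  proof (intro allI impI)
    fix q assume q: "q \<sqsubseteq> p" "?D q"
    then obtain r where r: "r \<sqsubseteq> q" "f_is_upair P w x x r \<or> f_is_upair P w x y r"
      unfolding f_or_iff using le_refl1 by blast
    have rp: "r \<sqsubseteq> p" using le_trans[OF r(1) q(1)] .
    have rc: "r \<in> cond P" using le_cond rp by blast
    have xy: "feq x (check P u) r" "feq y (check P v) r" "feq z (check P (opair u v)) r"
      using assms feq_mono[OF _ rp] by blast+
    then have "feq w (check P (mkset {u, u})) r \<or> feq w (check P (mkset {u, v})) r"
      using r(2) f_is_upair_check_unique w rc by meson
    then have "fmem w z r"
      using fmem_check_iff[OF _ xy(3) rc] by (auto simp: elts_opair)
    then show "\<exists>r. r \<sqsubseteq> q \<and> fmem w z r" using r(1) by blast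
  qed
qed

lemma f_is_opair_memD:
  assumes "f_is_opair P z x y p" "is_name P w" "fmem w z p" "p \<in> cond P"
  shows "\<exists>r. r \<sqsubseteq> p \<and> (f_is_upair P w x x r \<or> f_is_upair P w x y r)"
proof -
  have "f_imp P (fmem w z) (f_or P (f_is_upair P w x x) (f_is_upair P w x y)) p"
    using assms unfolding f_is_opair_def f_all_def f_iff_def f_and_def by blast
  then obtain r where "r \<sqsubseteq> p" "f_or P (f_is_upair P w x x) (f_is_upair P w x y) r"
    unfolding f_imp_iff using assms le_refl by blast
  then show ?thesis unfolding f_or_iff using le_refl1 le_trans by blast
qed

lemma f_is_opair_upair_mem:
  assumes "f_is_opair P z x y p" "is_name P w" "f_is_upair P w x y p" "p \<in> cond P"
  shows "\<exists>r. r \<sqsubseteq> p \<and> fmem w z r"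
proof -
  have "f_imp P (f_or P (f_is_upair P w x x) (f_is_upair P w x y)) (fmem w z) p"
    using assms unfolding f_is_opair_def f_all_def f_iff_def f_and_def by blast
  moreover have "f_or P (f_is_upair P w x x) (f_is_upair P w x y) p"
    unfolding f_or_iff using f_is_upair_mono[OF assms(3)] le_refl1 by blast
  ultimately show ?thesis unfolding f_imp_iff using assms le_refl by blast
qed

text \<open>The Kuratowski argument below \<open>p\<close>: the member \<open>{u}\<close> of
  \<open>z\<close> is \<open>{x}\<close> or \<open>{x, y}\<close>, so \<open>x\<close> becomes
  \<open>u\<close>; then \<open>v\<close>, a member of \<open>{u, v}\<close>, becomes
  \<open>x\<close> or \<open>y\<close>. Each decision costs a stronger condition.\<close>

lemma f_is_opairD:
  assumes op: "f_is_opair P z x y p" and z: "feq z (check P (opair u v)) p"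
    and names: "is_name P x" "is_name P y" and p: "p \<in> cond P"
  shows "\<exists>r. r \<sqsubseteq> p \<and> feq x (check P u) r \<and> feq y (check P v) r"
proof -
  have memz: "fmem (check P w) z q" if "w = mkset {u} \<or> w = mkset {u, v}" "q \<sqsubseteq> p" for w q
    using fmem_check_iff[OF feq_refl feq_mono[OF z that(2)]] le_cond that by (auto simp: elts_opair)
  obtain r1 where r1: "r1 \<sqsubseteq> p"
    "f_is_upair P (check P (mkset {u})) x x r1 \<or> f_is_upair P (check P (mkset {u})) x y r1"
    using f_is_opair_memD[OF op is_name_check memz p] le_refl[OF p] by blast
  then obtain r2 where r2: "r2 \<sqsubseteq> r1" "fmem x (check P (mkset {u})) r2"
    using f_is_upairD2[of _ x _ r1 x] names(1) feq_refl le_cond by meson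
  obtain r3 where r3: "r3 \<sqsubseteq> r2" "feq x (check P u) r3"
    using fmem_checkD[OF r2(2)] le_cond[OF r2(1)] by auto
  have r3p: "r3 \<sqsubseteq> p" using r1 r2 r3 le_trans by blast
  obtain r4 where r4: "r4 \<sqsubseteq> r3"
    "f_is_upair P (check P (mkset {u, v})) x x r4 \<or> f_is_upair P (check P (mkset {u, v})) x y r4"
    using f_is_opair_memD[OF f_is_opair_mono[OF op r3p] is_name_check memz] le_cond r3p by blast
  have r4c: "r4 \<in> cond P" using le_cond r4 by blast
  have "fmem (check P v) (check P (mkset {u, v})) r4" by (rule fmem_checkI) (use r4c in auto)
  then obtain r5 where r5: "r5 \<sqsubseteq> r4" "feq (check P v) x r5 \<or> feq (check P v) y r5"
    using r4(2) f_is_upairD1 is_name_check r4c by meson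
  have r5c: "r5 \<in> cond P" and r53: "r5 \<sqsubseteq> r3" using le_cond r5 r4 le_trans by blast+
  have x5: "feq x (check P u) r5" using feq_mono[OF r3(2) r53] .
  have "\<exists>r. r \<sqsubseteq> r5 \<and> feq y (check P v) r"
  proof (cases "feq (check P v) y r5")
    case True then show ?thesis using feq_sym le_refl r5c by blast
  next
    case False
    then have "feq (check P v) (check P u) r5" using r5(2) x5 feq_trans by blast
    then have uv: "v = u" using feq_check r5c by blast
    \<comment> \<open>With \<open>u = v\<close> the membership of \<open>v\<close> in
      \<open>{u, v}\<close> says nothing about \<open>y\<close>. But the pair of \<open>x\<close>
      and \<open>y\<close> must belong to \<open>z\<close>, whose only member is \<open>{u}\<close>,
      so \<open>y\<close> is forced to be \<open>u\<close>.\<close>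
    let ?w = "upair_name x y"
    have nw: "is_name P ?w" using is_name_upair_name names by blast
    have r5p: "r5 \<sqsubseteq> p" using r53 r3p le_trans by blast
    obtain r6 where r6: "r6 \<sqsubseteq> r5" "fmem ?w z r6"
      using f_is_opair_upair_mem[OF f_is_opair_mono[OF op r5p] nw f_is_upair_upair_name r5c] by blast
    have "fmem ?w (check P (opair u v)) r6"
      using fmem_cong_right[OF r6(2) feq_mono[OF z le_trans[OF r6(1) r5p]]] .
    then obtain r7 where r7: "r7 \<sqsubseteq> r6" "feq ?w (check P (mkset {u})) r7"
      using fmem_checkD[of ?w "opair u v" r6] le_cond[OF r6(1)] uv by (auto simp: elts_opair)
    obtain r8 where r8: "r8 \<sqsubseteq> r7" "fmem y ?w r8"
      using f_is_upairD2[OF f_is_upair_upair_name, of y x r7 y] names(2) feq_refl le_cond r7 by meson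
    have "fmem y (check P (mkset {u})) r8"
      using fmem_cong_right[OF r8(2) feq_mono[OF r7(2) r8(1)]] .
    then obtain r9 where "r9 \<sqsubseteq> r8" "feq y (check P u) r9"
      using fmem_checkD[of y "mkset {u}" r8] le_cond r8 by auto
    then show ?thesis using uv r8 r7 r6 le_trans by blast
  qed
  then show ?thesis using x5 feq_mono r53 r3p le_trans by blast
qed

section \<open>Functions of the ground model and satisfaction in check structures\<close>

lemma f_applyI:
  assumes "opair u v \<in> elts f" "feq x (check P u) p" "feq y (check P v) p"
  shows "f_apply P (check P f) x y p"
  unfolding f_apply_def f_bex_iff
proof (intro allI impI)
  fix q assume q: "q \<sqsubseteq> p"
  have "fmem (check P (opair u v)) (check P f) q" using fmem_checkI assms(1) le_cond q by blast
  moreover have "f_is_opair P (check P (opair u v)) x y q"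
    by (rule f_is_opairI) (use feq_mono[OF _ q] assms feq_refl le_cond[OF q] in auto)
  ultimately show "\<exists>r \<tau>. r \<sqsubseteq> q \<and> is_name P \<tau> \<and> fmem \<tau> (check P f) r \<and> f_is_opair P \<tau> x y r"
    using is_name_check le_refl1[OF q] by blast
qed

lemma f_applyD:
  assumes "f_apply P (check P f) x y p" "is_name P x" "is_name P y" "p \<in> cond P"
    and rel: "\<forall>z\<in>elts f. \<exists>u v. z = opair u v"
  shows "\<exists>r u v. r \<sqsubseteq> p \<and> opair u v \<in> elts f \<and> feq x (check P u) r \<and> feq y (check P v) r"
proof -
  obtain r \<tau> where r: "r \<sqsubseteq> p" "fmem \<tau> (check P f) r" "f_is_opair P \<tau> x y r"
    using assms(1,4) le_refl unfolding f_apply_def f_bex_iff by blast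
  then obtain q z where q: "q \<sqsubseteq> r" "z \<in> elts f" "feq \<tau> (check P z) q"
    using fmem_checkD le_cond by blast
  obtain u v where uv: "z = opair u v" using rel q(2) by blast
  obtain t where "t \<sqsubseteq> q" "feq x (check P u) t" "feq y (check P v) t"
    using f_is_opairD[OF f_is_opair_mono[OF r(3) q(1)] _ assms(2,3)] q le_cond uv by blast
  then show ?thesis using q r uv le_trans by blast
qed

text \<open>The condition stays arbitrary in the induction, since negation needs the equivalence at
  every stronger condition and an existential witness is a name that becomes a check name only after
  strengthening.\<close>

lemma f_sat_check:
  assumes "p \<in> cond P" "\<forall>i\<in>fv \<phi>. feq (s i) (check P (x i)) p"
  shows "f_sat P (check P M) (check P Q) \<phi> s p \<longleftrightarrow> sat (elts M) (elts Q) \<phi> x"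
  using assms
proof (induction \<phi> arbitrary: s x p)
  case (FEq i j)
  then show ?case using feq_check_iff by simp
next
  case (FMem i j)
  then show ?case using fmem_check_iff by simp
next
  case (FPred i)
  then show ?case using fmem_check_iff[OF _ feq_refl] by simp
next
  case (FNeg \<phi>)
  have "f_sat P (check P M) (check P Q) \<phi> s q \<longleftrightarrow> sat (elts M) (elts Q) \<phi> x" if "q \<sqsubseteq> p" for q
    using FNeg.IH[of q s x] FNeg.prems that le_cond feq_mono[OF _ that] by auto
  then show ?case using le_refl[OF FNeg.prems(1)] by (auto simp: f_not_def)
next
  case (FAnd \<phi> \<psi>)
  have "\<forall>i\<in>fv \<phi>. feq (s i) (check P (x i)) p" "\<forall>i\<in>fv \<psi>. feq (s i) (check P (x i)) p"
    using FAnd.prems(2) by auto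
  then show ?case
    unfolding f_sat.simps sat.simps f_and_def using FAnd.IH FAnd.prems(1) by blast
next
  case (FEx i \<phi>)
  let ?S = "f_sat P (check P M) (check P Q) \<phi>"
  have IH: "?S (s(i := \<tau>)) q \<longleftrightarrow> sat (elts M) (elts Q) \<phi> (x(i := z))"
    if "q \<sqsubseteq> p" "z \<in> elts M" "feq \<tau> (check P z) q" for q z \<tau>
    by (rule FEx.IH) (use FEx.prems that le_cond feq_mono[OF _ that(1)] in auto)
  have "f_sat P (check P M) (check P Q) (FEx i \<phi>) s p \<longleftrightarrow>
      (\<forall>q. q \<sqsubseteq> p \<longrightarrow> (\<exists>r \<tau>. r \<sqsubseteq> q \<and> is_name P \<tau> \<and> fmem \<tau> (check P M) r \<and> ?S (s(i := \<tau>)) r))"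
    by (simp add: f_bex_iff)
  also have "\<dots> \<longleftrightarrow> (\<exists>z\<in>elts M. sat (elts M) (elts Q) \<phi> (x(i := z)))"
  proof
    assume "\<forall>q. q \<sqsubseteq> p \<longrightarrow> (\<exists>r \<tau>. r \<sqsubseteq> q \<and> is_name P \<tau> \<and> fmem \<tau> (check P M) r \<and> ?S (s(i := \<tau>)) r)"
    then obtain r \<tau> where r: "r \<sqsubseteq> p" "fmem \<tau> (check P M) r" "?S (s(i := \<tau>)) r"
      using le_refl FEx.prems(1) by blast
    obtain q z where q: "q \<sqsubseteq> r" "z \<in> elts M" "feq \<tau> (check P z) q"
      using fmem_checkD[OF r(2)] le_cond r(1) by blast
    show "\<exists>z\<in>elts M. sat (elts M) (elts Q) \<phi> (x(i := z))"
      using IH[OF le_trans[OF q(1) r(1)] q(2,3)] f_sat_mono[OF r(3) q(1)] q(2) by blast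
  next
    assume "\<exists>z\<in>elts M. sat (elts M) (elts Q) \<phi> (x(i := z))"
    then obtain z where z: "z \<in> elts M" "sat (elts M) (elts Q) \<phi> (x(i := z))" by blast
    show "\<forall>q. q \<sqsubseteq> p \<longrightarrow> (\<exists>r \<tau>. r \<sqsubseteq> q \<and> is_name P \<tau> \<and> fmem \<tau> (check P M) r \<and> ?S (s(i := \<tau>)) r)"
    proof (intro allI impI)
      fix q assume q: "q \<sqsubseteq> p"
      have "?S (s(i := check P z)) q" using IH[OF q z(1) feq_refl] z(2) le_cond q by blast
      then show "\<exists>r \<tau>. r \<sqsubseteq> q \<and> is_name P \<tau> \<and> fmem \<tau> (check P M) r \<and> ?S (s(i := \<tau>)) r"
        using le_refl1[OF q] is_name_check fmem_checkI[OF z(1)] le_cond q by blast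
    qed
  qed
  finally show ?case by simp
qed

lemma finite_fv: "finite (fv \<phi>)"
  by (induction \<phi>) auto

lemma f_is_map_check:
  assumes f: "elts f = (\<lambda>x. opair x (\<sigma> x)) ` elts M" and MN: "\<sigma> ` elts M \<subseteq> elts N"
  shows "f_is_map P (check P f) (check P M) (check P N) p"
  unfolding f_is_map_def f_and_def
proof
  show "f_ball P (check P f)
      (\<lambda>z. f_bex P (check P M) (\<lambda>x. f_bex P (check P N) (f_is_opair P z x))) p"
    unfolding f_ball_iff
  proof (intro allI impI)
    fix \<tau> q assume "is_name P \<tau>" and q: "q \<sqsubseteq> p" "fmem \<tau> (check P f) q"
    then obtain r u where r: "r \<sqsubseteq> q" "u \<in> elts M" "feq \<tau> (check P (opair u (\<sigma> u))) r"
      using fmem_checkD[OF q(2)] le_cond unfolding f by blast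
    have uN: "\<sigma> u \<in> elts N" using r MN by blast
    have "f_is_opair P \<tau> (check P u) (check P (\<sigma> u)) t" if "t \<sqsubseteq> r" for t
      using f_is_opairI[OF feq_refl feq_refl feq_mono[OF r(3) that]] le_cond that by blast
    then have "f_bex P (check P N) (f_is_opair P \<tau> (check P u)) t" if "t \<sqsubseteq> r" for t
      unfolding f_bex_iff using is_name_check fmem_checkI[OF uN] le_cond le_refl le_trans that
      by meson
    then have "f_bex P (check P M) (\<lambda>x. f_bex P (check P N) (f_is_opair P \<tau> x)) r"
      unfolding f_bex_iff[of "check P M"]
      using is_name_check fmem_checkI[OF r(2)] le_cond le_refl le_trans by meson
    then show "\<exists>r. r \<sqsubseteq> q \<and> f_bex P (check P M) (\<lambda>x. f_bex P (check P N) (f_is_opair P \<tau> x)) r"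
      using r(1) by blast
  qed
  let ?U = "\<lambda>x y. f_all P (\<lambda>y'. f_imp P (f_apply P (check P f) x y') (feq y' y))"
  show "f_ball P (check P M) (\<lambda>x. f_ex P (\<lambda>y p. f_apply P (check P f) x y p \<and> ?U x y p)) p"
    unfolding f_ball_iff
  proof (intro allI impI)
    fix \<tau> q assume \<tau>: "is_name P \<tau>" and q: "q \<sqsubseteq> p" "fmem \<tau> (check P M) q"
    then obtain r u where r: "r \<sqsubseteq> q" "u \<in> elts M" "feq \<tau> (check P u) r"
      using fmem_checkD[OF q(2)] le_cond by blast
    let ?y = "check P (\<sigma> u)"
    have "f_apply P (check P f) \<tau> ?y t \<and> ?U \<tau> ?y t" if t: "t \<sqsubseteq> r" for t
    proof
      have "opair u (\<sigma> u) \<in> elts f" using r(2) unfolding f by blast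
      then show "f_apply P (check P f) \<tau> ?y t"
        using f_applyI feq_mono[OF r(3) t] feq_refl le_cond t by blast
      show "?U \<tau> ?y t"
        unfolding f_all_def f_imp_iff
      proof (intro allI impI)
        fix y' q' assume y': "is_name P y'" and q': "q' \<sqsubseteq> t" "f_apply P (check P f) \<tau> y' q'"
        have rel: "\<forall>z\<in>elts f. \<exists>u v. z = opair u v" unfolding f by blast
        obtain t' u' v' where t': "t' \<sqsubseteq> q'" "opair u' v' \<in> elts f" "feq \<tau> (check P u') t'"
            "feq y' (check P v') t'"
          using f_applyD[OF q'(2) \<tau> y' _ rel] le_cond q'(1) by blast
        have "feq \<tau> (check P u) t'" using feq_mono r(3) t q'(1) t'(1) le_trans by blast
        then have "u' = u" using feq_check_unique t' le_cond by blast
        then have "v' = \<sigma> u" using t'(2) unfolding f by auto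
        then show "\<exists>r. r \<sqsubseteq> q' \<and> feq y' ?y r" using t' by blast
      qed
    qed
    then have "f_ex P (\<lambda>y p. f_apply P (check P f) \<tau> y p \<and> ?U \<tau> y p) r"
      unfolding f_ex_iff using is_name_check le_refl1 by blast
    then show "\<exists>r. r \<sqsubseteq> q \<and> f_ex P (\<lambda>y p. f_apply P (check P f) \<tau> y p \<and> ?U \<tau> y p) r"
      using r(1) by blast
  qed
qed

text \<open>The arguments \<open>s i\<close> and values \<open>t i\<close> are arbitrary names. As
  \<open>\<phi>\<close> has finitely many free variables, one stronger condition turns all of them
  into check names of some \<open>x i\<close> and \<open>\<sigma> (x i)\<close>; below it both sides
  are decided by ground-model truth.\<close>

lemma f_elementary_check:
  assumes f: "elts f = (\<lambda>x. opair x (\<sigma> x)) ` elts M"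
    and el: "elementary \<sigma> (elts M) (elts Q) (elts N) (elts S)"
    and M: "m \<in> elts M"
  shows "f_elementary P (check P f) (check P M) (check P Q) (check P N) (check P S) p"
  unfolding f_elementary_def f_and_def
proof (intro conjI allI impI)
  have MN: "\<sigma> ` elts M \<subseteq> elts N" using el unfolding elementary_def by blast
  show "f_is_map P (check P f) (check P M) (check P N) p" using f_is_map_check[OF f MN] .
  fix \<phi> and s t :: "nat \<Rightarrow> 'v" assume names: "\<forall>i. is_name P (s i) \<and> is_name P (t i)"
  let ?A = "f_sat P (check P M) (check P Q) \<phi> s" and ?B = "f_sat P (check P N) (check P S) \<phi> t"
  show "f_imp P (\<lambda>q. \<forall>i\<in>fv \<phi>. fmem (s i) (check P M) q \<and> f_apply P (check P f) (s i) (t i) q)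
      (f_iff P ?A ?B) p"
    unfolding f_imp_iff
  proof (intro allI impI)
    fix q assume q: "q \<sqsubseteq> p"
      and ap: "\<forall>i\<in>fv \<phi>. fmem (s i) (check P M) q \<and> f_apply P (check P f) (s i) (t i) q"
    have "\<exists>r x. r \<sqsubseteq> q \<and> (\<forall>i. x i \<in> elts M) \<and>
        (\<forall>i\<in>I. feq (s i) (check P (x i)) r \<and> feq (t i) (check P (\<sigma> (x i))) r)"
      if "finite I" "I \<subseteq> fv \<phi>" for I
      using that
    proof (induction I rule: finite_induct)
      case empty
      \<comment> \<open>The default value \<open>m\<close> keeps the assignment inside
        \<open>M\<close> at variables not treated, because elementarity speaks of assignments with
        range in \<open>M\<close>.\<close>
      then show ?case using le_refl1[OF q] M by (intro exI[of _ q] exI[of _ "\<lambda>_. m"]) auto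
    next
      case (insert i I)
      then obtain r x where r: "r \<sqsubseteq> q" "\<forall>i. x i \<in> elts M"
          "\<forall>i\<in>I. feq (s i) (check P (x i)) r \<and> feq (t i) (check P (\<sigma> (x i))) r"
        by blast
      have "f_apply P (check P f) (s i) (t i) r"
        using f_apply_mono[OF _ r(1)] ap insert.prems by blast
      moreover have rel: "\<forall>z\<in>elts f. \<exists>u v. z = opair u v" unfolding f by blast
      ultimately obtain r' u v where r': "r' \<sqsubseteq> r" "opair u v \<in> elts f"
          "feq (s i) (check P u) r'" "feq (t i) (check P v) r'"
        using f_applyD names le_cond[OF r(1)] by meson
      then have uv: "u \<in> elts M" "v = \<sigma> u" unfolding f by auto
      show ?case
      proof (intro exI conjI)
        show "r' \<sqsubseteq> q" using r'(1) r(1) le_trans by blast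
        show "\<forall>j. (x(i := u)) j \<in> elts M" using r(2) uv by simp
        show "\<forall>j\<in>insert i I. feq (s j) (check P ((x(i := u)) j)) r' \<and>
            feq (t j) (check P (\<sigma> ((x(i := u)) j))) r'"
          using r(3) r' uv feq_mono[OF _ r'(1)] by simp
      qed
    qed
    from this[OF finite_fv subset_refl] obtain r x where r: "r \<sqsubseteq> q" "\<forall>i. x i \<in> elts M"
        "\<forall>i\<in>fv \<phi>. feq (s i) (check P (x i)) r \<and> feq (t i) (check P (\<sigma> (x i))) r"
      by blast
    have iff: "?A r' \<longleftrightarrow> ?B r'" if r': "r' \<sqsubseteq> r" for r'
    proof -
      have "?A r' \<longleftrightarrow> sat (elts M) (elts Q) \<phi> x"
        by (rule f_sat_check) (use r(2,3) feq_mono[OF _ r'] le_cond[OF r'] in auto)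
      also have "\<dots> \<longleftrightarrow> sat (elts N) (elts S) \<phi> (\<sigma> \<circ> x)"
        using el r(2) unfolding elementary_def by (metis image_subsetI)
      also have "\<dots> \<longleftrightarrow> ?B r'"
        by (rule f_sat_check[symmetric]) (use r(2,3) MN feq_mono[OF _ r'] le_cond[OF r'] in auto)
      finally show ?thesis .
    qed
    have "f_iff P ?A ?B r"
      unfolding f_iff_def f_and_def f_imp_iff using iff le_refl1 by blast
    then show "\<exists>r. r \<sqsubseteq> q \<and> f_iff P ?A ?B r" using r(1) by blast
  qed
qed

lemma elts_gen_name: "elts (gen_name P) = (\<lambda>p. opair (check P p) p) ` cond P"
  unfolding gen_name_def by (rule elts_mkset_small) (auto simp: cond_def)

text \<open>The embedding is named by \<open>check P f\<close>. A condition below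
  \<open>\<sigma> c\<close> forces \<open>\<sigma> c\<close> into the generic filter, as
  \<open>gen_name P\<close> contains the check name of \<open>\<sigma> c\<close> paired with
  \<open>\<sigma> c\<close>.\<close>

lemma ground_embedding_forced:
  assumes f: "elts f = (\<lambda>x. opair x (\<sigma> x)) ` elts M"
    and el: "elementary \<sigma> (elts M) (elts Q) (elts N) (elts S)"
    and a: "a \<in> elts M" and G: "\<And>c. c \<in> elts G \<Longrightarrow> p \<sqsubseteq> \<sigma> c"
  shows "f_ex P (\<lambda>f. f_and
             (f_elementary P f (check P M) (check P Q) (check P N) (check P S))
             (f_and
               (f_apply P f (check P a) (check P (\<sigma> a)))
               (f_ball P (check P G) (\<lambda>x. f_all P (\<lambda>y.
                  f_imp P (f_apply P f x y) (forces_mem P y (gen_name P))))))) p"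
  unfolding f_ex_iff
proof (intro allI impI)
  fix q assume q: "q \<sqsubseteq> p"
  have qc: "q \<in> cond P" using q le_cond by blast
  have "f_elementary P (check P f) (check P M) (check P Q) (check P N) (check P S) q"
    using f_elementary_check[OF f el a] .
  moreover have "f_apply P (check P f) (check P a) (check P (\<sigma> a)) q"
    by (rule f_applyI[OF _ feq_refl[OF qc] feq_refl[OF qc]]) (use a f in blast)
  moreover have "f_ball P (check P G) (\<lambda>x. f_all P (\<lambda>y.
                  f_imp P (f_apply P (check P f) x y) (forces_mem P y (gen_name P)))) q"
    unfolding f_ball_iff
  proof (intro allI impI)
    fix \<tau> r assume \<tau>: "is_name P \<tau>" and r: "r \<sqsubseteq> q" "fmem \<tau> (check P G) r"
    then obtain t c where t: "t \<sqsubseteq> r" "c \<in> elts G" "feq \<tau> (check P c) t"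
      using fmem_checkD[OF r(2)] le_cond by blast
    have "f_all P (\<lambda>y. f_imp P (f_apply P (check P f) \<tau> y) (fmem y (gen_name P))) t"
      unfolding f_all_def f_imp_iff
    proof (intro allI impI)
      fix y t' assume y: "is_name P y" and t': "t' \<sqsubseteq> t" "f_apply P (check P f) \<tau> y t'"
      have rel: "\<forall>z\<in>elts f. \<exists>u v. z = opair u v" unfolding f by blast
      obtain t'' u v where t'': "t'' \<sqsubseteq> t'" "opair u v \<in> elts f" "feq \<tau> (check P u) t''"
          "feq y (check P v) t''"
        using f_applyD[OF t'(2) \<tau> y _ rel] le_cond t'(1) by blast
      have "feq \<tau> (check P c) t''" using feq_mono t(3) t'(1) t''(1) le_trans by blast
      then have "u = c" using feq_check_unique t'' le_cond by blast
      then have v: "v = \<sigma> c" using t''(2) unfolding f by auto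
      have "t'' \<sqsubseteq> p" using t''(1) t'(1) t(1) r(1) q le_trans by blast
      then have le: "t'' \<sqsubseteq> \<sigma> c" using G[OF t(2)] le_trans by blast
      have "opair (check P (\<sigma> c)) (\<sigma> c) \<in> elts (gen_name P)"
        unfolding elts_gen_name using le_cond le by blast
      then have "fmem (check P (\<sigma> c)) (gen_name P) t''" using fmem_elem le by blast
      then have "fmem y (gen_name P) t''" using fmem_cong_left feq_sym t''(4) v by blast
      then show "\<exists>r. r \<sqsubseteq> t' \<and> fmem y (gen_name P) r" using t''(1) by blast
    qed
    then show "\<exists>t. t \<sqsubseteq> r \<and> f_all P (\<lambda>y. f_imp P (f_apply P (check P f) \<tau> y) (fmem y (gen_name P))) t"
      using t(1) by blast
  qed
  ultimately show "\<exists>r \<tau>. r \<sqsubseteq> q \<and> is_name P \<tau> \<and> f_and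
             (f_elementary P \<tau> (check P M) (check P Q) (check P N) (check P S))
             (f_and
               (f_apply P \<tau> (check P a) (check P (\<sigma> a)))
               (f_ball P (check P G) (\<lambda>x. f_all P (\<lambda>y.
                  f_imp P (f_apply P \<tau> x y) (forces_mem P y (gen_name P)))))) r"
    unfolding f_and_def using le_refl[OF qc] is_name_check by blast
qed

end

section \<open>The club forcing\<close>

text \<open>This says that \<open>\<gamma>\<close> is a limit point of \<open>c\<close>; the first
  conjunct excludes 0, where the second holds vacuously.\<close>

definition unbounded_in :: "'v::zfc set \<Rightarrow> 'v \<Rightarrow> bool" where
  "unbounded_in c \<gamma> \<longleftrightarrow> elts \<gamma> \<noteq> {} \<and> (\<forall>\<alpha>\<in>elts \<gamma>. \<exists>\<beta>\<in>c \<inter> elts \<gamma>. \<alpha> \<in> elts \<beta>)"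

lemma club_iff:
  "club C \<longleftrightarrow> C \<subseteq> elts omega1 \<and> (\<forall>\<alpha>\<in>elts omega1. \<exists>\<beta>\<in>C. \<alpha> \<in> elts \<beta>) \<and>
     (\<forall>\<gamma>\<in>elts omega1. unbounded_in C \<gamma> \<longrightarrow> \<gamma> \<in> C)"
  unfolding club_def unbounded_in_def ..

lemma unbounded_in_cong:
  "(\<And>\<beta>. \<beta> \<in> elts \<gamma> \<Longrightarrow> \<beta> \<in> c \<longleftrightarrow> \<beta> \<in> d) \<Longrightarrow> unbounded_in c \<gamma> \<longleftrightarrow> unbounded_in d \<gamma>"
  unfolding unbounded_in_def by blast

lemma unbounded_in_mono: "c \<subseteq> d \<Longrightarrow> unbounded_in c \<gamma> \<Longrightarrow> unbounded_in d \<gamma>"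
  unfolding unbounded_in_def by blast

lemma club_omega1: "club (elts omega1)"
  unfolding club_iff using osucc_omega1 by (metis elts_osucc insertI1 subset_refl)

text \<open>Passing to a tail is how a stationary set is made to supply a point above a prescribed
  \<open>\<alpha>\<close>.\<close>

lemma club_tail:
  fixes C :: "'v::zfc set"
  assumes "club C" "\<alpha> \<in> elts omega1" shows "club {\<xi> \<in> C. \<alpha> \<in> elts \<xi>}"
  unfolding club_iff
proof (intro conjI ballI impI)
  show "{\<xi> \<in> C. \<alpha> \<in> elts \<xi>} \<subseteq> elts omega1" using assms unfolding club_iff by blast
next
  fix \<beta> :: 'v assume "\<beta> \<in> elts omega1"
  then obtain \<gamma> where \<gamma>: "\<gamma> \<in> elts omega1" "\<alpha> \<in> elts \<gamma>" "\<beta> \<in> elts \<gamma>"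
    using omega1_above[OF assms(2)] by blast
  then obtain \<xi> where \<xi>: "\<xi> \<in> C" "\<gamma> \<in> elts \<xi>" using assms(1) unfolding club_iff by blast
  then have "\<xi> \<in> elts omega1" using assms(1) unfolding club_iff by blast
  then have "\<alpha> \<in> elts \<xi>" "\<beta> \<in> elts \<xi>" using omega1_trans \<gamma> \<xi>(2) by blast+
  then show "\<exists>\<xi>\<in>{\<xi> \<in> C. \<alpha> \<in> elts \<xi>}. \<beta> \<in> elts \<xi>" using \<xi> by blast
next
  fix \<gamma> :: 'v assume \<gamma>: "\<gamma> \<in> elts omega1" "unbounded_in {\<xi> \<in> C. \<alpha> \<in> elts \<xi>} \<gamma>"
  then have "unbounded_in C \<gamma>" using unbounded_in_mono[of "{\<xi> \<in> C. \<alpha> \<in> elts \<xi>}" C] by blast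
  then have "\<gamma> \<in> C" using assms(1) \<gamma>(1) unfolding club_iff by blast
  moreover obtain \<xi> where "\<alpha> \<in> elts \<xi>" "\<xi> \<in> elts \<gamma>" using \<gamma>(2) unfolding unbounded_in_def by blast
  ultimately show "\<gamma> \<in> {\<xi> \<in> C. \<alpha> \<in> elts \<xi>}" using omega1_trans \<gamma>(1) by blast
qed

lemma cond_opair: "cond (opair C R) = elts C"
  unfolding cond_def by simp

lemma le_opair: "le (opair C R) p q \<longleftrightarrow> p \<in> elts C \<and> q \<in> elts C \<and> opair p q \<in> elts R"
  unfolding le_def cond_opair by simp

text \<open>\<open>R d \<xi>\<close> is the demand on a point \<open>\<xi>\<close> whose
  predecessors in the condition form \<open>d\<close>. \<open>R_intro\<close> lets
  \<open>\<delta>\<close> be added on top of the union of a generic filter; \<open>R_ex\<close>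
  gives extendibility.\<close>

locale club_forcing =
  fixes K :: "'v::zfc \<Rightarrow> 'v" and B :: 'v and R :: "'v \<Rightarrow> 'v \<Rightarrow> bool"
  assumes adequate: "adequate K"
    and R_intro: "\<And>\<xi> d. \<xi> \<in> elts omega1 \<Longrightarrow> inter B \<xi> \<in> elts (K \<xi>) \<Longrightarrow> d \<in> elts (K \<xi>) \<Longrightarrow> R d \<xi>"
    and R_ex: "\<And>\<alpha> c. \<alpha> \<in> elts omega1 \<Longrightarrow> elts c \<subseteq> elts \<alpha> \<Longrightarrow> \<exists>\<xi>\<in>elts omega1. \<alpha> \<in> elts \<xi> \<and> R c \<xi>"
begin

definition conds :: "'v set" where
  "conds = {c. (\<exists>\<beta>\<in>elts omega1. elts c \<subseteq> elts \<beta>) \<and>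
     (\<forall>\<gamma>\<in>elts omega1. unbounded_in (elts c) \<gamma> \<longrightarrow> \<gamma> \<in> elts c) \<and>
     (\<forall>\<xi>\<in>elts c. R (inter c \<xi>) \<xi>)}"

definition end_ext :: "'v \<Rightarrow> 'v \<Rightarrow> bool" where
  "end_ext c d \<longleftrightarrow> elts d \<subseteq> elts c \<and> (\<forall>\<xi>\<in>elts c. \<forall>\<eta>\<in>elts d. \<xi> \<in> elts \<eta> \<longrightarrow> \<xi> \<in> elts d)"

definition poset :: 'v where
  "poset = opair (mkset conds)
     (mkset ((\<lambda>(c, d). opair c d) ` {(c, d). c \<in> conds \<and> d \<in> conds \<and> end_ext c d}))"

lemma conds_sub_omega1: "c \<in> conds \<Longrightarrow> \<xi> \<in> elts c \<Longrightarrow> \<xi> \<in> elts omega1"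
  unfolding conds_def using omega1_in by blast

lemma small_conds: "small conds"
  by (rule small_subset[OF small_Pow[OF small_elts[of omega1]]]) (auto intro: conds_sub_omega1)

lemma elts_conds [simp]: "elts (mkset conds) = conds"
  using small_conds by simp

lemma cond_poset [simp]: "cond poset = conds"
  unfolding poset_def cond_opair by simp

lemma le_poset: "le poset c d \<longleftrightarrow> c \<in> conds \<and> d \<in> conds \<and> end_ext c d"
proof -
  let ?X = "(\<lambda>(c, d). opair c d) ` {(c, d). c \<in> conds \<and> d \<in> conds \<and> end_ext c d}"
  have "small (\<Union>x\<in>conds. opair x ` conds)" using small_conds by auto
  then have "small ?X" by (rule small_subset) auto
  then show ?thesis unfolding poset_def le_opair by auto
qed

lemma end_ext_refl: "end_ext c c"
  unfolding end_ext_def by blast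

lemma end_ext_trans: "end_ext c d \<Longrightarrow> end_ext d e \<Longrightarrow> end_ext c e"
  unfolding end_ext_def by blast

text \<open>Only closure below \<open>\<xi>\<close> is asked of \<open>c\<close>, because the union
  of the generic filter is unbounded in \<open>\<delta>\<close> and becomes a condition only when
  \<open>\<delta>\<close> is added.\<close>

lemma top_in_conds:
  assumes "\<xi> \<in> elts omega1" "elts c \<subseteq> elts \<xi>"
    and "\<And>\<gamma>. \<gamma> \<in> elts \<xi> \<Longrightarrow> unbounded_in (elts c) \<gamma> \<Longrightarrow> \<gamma> \<in> elts c"
    and "\<And>\<eta>. \<eta> \<in> elts c \<Longrightarrow> R (inter c \<eta>) \<eta>" and "R c \<xi>"
  shows "mkset (insert \<xi> (elts c)) \<in> conds" (is "?d \<in> _")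
proof -
  have d: "elts ?d = insert \<xi> (elts c)" by simp
  have bd: "elts ?d \<subseteq> elts (osucc \<xi>)" using assms(2) by auto
  have cl: "\<gamma> \<in> elts ?d" if \<gamma>: "\<gamma> \<in> elts omega1" "unbounded_in (elts ?d) \<gamma>" for \<gamma>
  proof -
    have n: "\<xi> \<notin> elts \<gamma>"
    proof
      assume "\<xi> \<in> elts \<gamma>"
      then obtain \<beta> where "\<beta> \<in> elts ?d" "\<xi> \<in> elts \<beta>" using \<gamma>(2) unfolding unbounded_in_def by blast
      then show False using assms(2) mem_asym d by auto
    qed
    then have "unbounded_in (elts c) \<gamma>" using \<gamma>(2) unbounded_in_cong[of \<gamma> "elts ?d" "elts c"] d by auto
    then show ?thesis using n assms(3) omega1_linear[OF \<gamma>(1) assms(1)] d by blast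
  qed
  have "R (inter ?d \<eta>) \<eta>" if "\<eta> \<in> elts ?d" for \<eta>
  proof (cases "\<eta> = \<xi>")
    case True
    have "elts (inter ?d \<xi>) = elts c" using assms(2) by auto
    then have "inter ?d \<xi> = c" by (rule extensionality)
    then show ?thesis using assms(5) True by simp
  next
    case False
    then have \<eta>: "\<eta> \<in> elts c" using that by simp
    then have "elts (inter ?d \<eta>) = elts (inter c \<eta>)" using assms(2) mem_asym by auto
    then have "inter ?d \<eta> = inter c \<eta>" by (rule extensionality)
    then show ?thesis using assms(4) \<eta> by simp
  qed
  then show ?thesis unfolding conds_def using bd cl osucc_omega1[OF assms(1)] by blast
qed

lemma end_ext_top: "elts c \<subseteq> elts \<xi> \<Longrightarrow> end_ext (mkset (insert \<xi> (elts c))) c"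
  unfolding end_ext_def using mem_asym by auto

text \<open>\<open>R_ex\<close> is applied above both \<open>\<alpha>\<close> and a bound of
  \<open>c\<close>; the gap between \<open>c\<close> and the new point creates no limit
  points.\<close>

lemma conds_extend:
  assumes c: "c \<in> conds" and \<alpha>: "\<alpha> \<in> elts omega1"
  shows "\<exists>\<xi>. \<alpha> \<in> elts \<xi> \<and> mkset (insert \<xi> (elts c)) \<in> conds \<and> end_ext (mkset (insert \<xi> (elts c))) c"
proof -
  obtain \<beta> where \<beta>: "\<beta> \<in> elts omega1" "elts c \<subseteq> elts \<beta>" using c unfolding conds_def by blast
  obtain \<gamma> where \<gamma>: "\<gamma> \<in> elts omega1" "\<alpha> \<in> elts \<gamma>" "\<beta> \<in> elts \<gamma>" using omega1_above \<alpha> \<beta>(1) by blast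
  have "elts c \<subseteq> elts \<gamma>" using \<beta> \<gamma> omega1_trans by blast
  then obtain \<xi> where \<xi>: "\<xi> \<in> elts omega1" "\<gamma> \<in> elts \<xi>" "R c \<xi>" using R_ex \<gamma>(1) by blast
  have tr: "elts \<gamma> \<subseteq> elts \<xi>" using \<xi> omega1_trans by blast
  then have c\<xi>: "elts c \<subseteq> elts \<xi>" using \<open>elts c \<subseteq> elts \<gamma>\<close> by blast
  have "mkset (insert \<xi> (elts c)) \<in> conds"
  proof (rule top_in_conds[OF \<xi>(1) c\<xi> _ _ \<xi>(3)])
    show "\<gamma> \<in> elts c" if "\<gamma> \<in> elts \<xi>" "unbounded_in (elts c) \<gamma>" for \<gamma>
      using c that omega1_in[OF that(1) \<xi>(1)] unfolding conds_def by blast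
    show "R (inter c \<eta>) \<eta>" if "\<eta> \<in> elts c" for \<eta> using c that unfolding conds_def by blast
  qed
  then show ?thesis using end_ext_top[OF c\<xi>] tr \<gamma>(2) by blast
qed

lemma empty_in_conds: "mkset {} \<in> conds"
proof -
  have "\<exists>\<beta>. \<beta> \<in> elts (omega1 :: 'v)"
    using uncountable_omega1 by (metis all_not_in_conv countable_empty)
  then show ?thesis by (auto simp: conds_def unbounded_in_def)
qed

lemma forcing_notion_poset: "forcing_notion poset"
  unfolding forcing_notion_def
proof (intro conjI ballI allI impI)
  show "\<exists>C R. poset = opair C R \<and> (\<forall>z\<in>elts R. \<exists>p\<in>elts C. \<exists>q\<in>elts C. z = opair p q)"
  proof -
    let ?X = "(\<lambda>(c, d). opair c d) ` {(c, d). c \<in> conds \<and> d \<in> conds \<and> end_ext c d}"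
    have "small (\<Union>x\<in>conds. opair x ` conds)" using small_conds by auto
    then have "small ?X" by (rule small_subset) auto
    then have "elts (mkset ?X) = ?X" by simp
    then have "\<forall>z\<in>elts (mkset ?X). \<exists>p\<in>elts (mkset conds). \<exists>q\<in>elts (mkset conds). z = opair p q"
      by auto
    then show ?thesis unfolding poset_def by blast
  qed
next
  fix p assume "p \<in> cond poset" then show "le poset p p" by (simp add: le_poset end_ext_refl)
next
  fix p q r assume "le poset p q \<and> le poset q r" then show "le poset p r" using end_ext_trans by (auto simp: le_poset)
next
  fix p q assume pq: "p \<in> cond poset" "q \<in> cond poset" "\<not> le poset p q"
  show "\<exists>r. le poset r p \<and> \<not> (\<exists>t. le poset t r \<and> le poset t q)"
  \<comment> \<open>If \<open>q\<close> is contained in \<open>p\<close> without being an initial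
    part of it, \<open>p\<close> and \<open>q\<close> are already incompatible. Otherwise some
    \<open>\<eta>\<close> of \<open>q\<close> is missing from \<open>p\<close>, and a new point of
    \<open>p\<close> above \<open>\<eta>\<close> keeps it out forever.\<close>
  proof (cases "elts q \<subseteq> elts p")
    case True
    then obtain \<xi> \<eta> where "\<xi> \<in> elts p" "\<eta> \<in> elts q" "\<xi> \<in> elts \<eta>" "\<xi> \<notin> elts q"
      using pq unfolding le_poset end_ext_def by auto
    then have "\<not> (le poset t p \<and> le poset t q)" for t unfolding le_poset end_ext_def by blast
    then show ?thesis using pq(1) by (auto simp: le_poset end_ext_refl)
  next
    case False
    then obtain \<eta> where \<eta>: "\<eta> \<in> elts q" "\<eta> \<notin> elts p" by blast
    have "\<eta> \<in> elts omega1" using pq(2) \<eta> conds_sub_omega1 by auto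
    then obtain \<xi> where \<xi>: "\<eta> \<in> elts \<xi>" "mkset (insert \<xi> (elts p)) \<in> conds"
        "end_ext (mkset (insert \<xi> (elts p))) p"
      using conds_extend pq(1) unfolding cond_poset by blast
    define r where "r = mkset (insert \<xi> (elts p))"
    have r: "\<eta> \<in> elts \<xi>" "\<xi> \<in> elts r" "r \<in> conds" "end_ext r p" "\<eta> \<notin> elts r"
      using \<xi> \<eta>(2) unfolding r_def by auto
    have "\<not> (le poset t r \<and> le poset t q)" for t
      using r \<eta> unfolding le_poset end_ext_def by blast
    then show ?thesis using r pq(1) by (auto simp: le_poset)
  qed
next
  have "mkset {} \<in> largest poset"
    unfolding largest_def using empty_in_conds by (auto simp: le_poset end_ext_def)
  then show "largest poset \<noteq> {}" by blast
qed

end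

section \<open>Subcompleteness of the club forcing\<close>

lemma pfilter_compatible:
  "pfilter P g \<Longrightarrow> c \<in> g \<Longrightarrow> d \<in> g \<Longrightarrow> \<exists>r\<in>g. le P r c \<and> le P r d"
  unfolding pfilter_def by blast

context club_forcing
begin

text \<open>\<open>B\<close> gives the good model access to the set to be guessed;
  \<open>omega1\<close> and \<open>omega\<close> are included so that their preimages exist and can
  be recognised as \<open>\<delta>\<close> and \<open>omega\<close>.\<close>

definition param :: 'v where
  "param = opair (opair B omega1) omega"

text \<open>The set \<open>bound\<close> only serves to make the cardinal \<open>\<theta>\<close> large enough: \<open>H\<^sub>\<theta>\<close> must contain the
  poset, the parameter and an injection into \<open>\<omega>\<close> for each countable ordinal.\<close>

definition injections :: 'v where
  "injections = mkset {f. elts f \<subseteq> (\<Union>u\<in>elts omega1. opair u ` elts omega)}"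

definition bound :: 'v where
  "bound = mkset {poset, param, injections, omega}"

lemma elts_injections: "elts injections = {f. elts f \<subseteq> (\<Union>u\<in>elts omega1. opair u ` elts omega)}"
  unfolding injections_def by (intro elts_mkset_small small_Pow small_UN small_image small_elts)

lemma elts_bound: "elts bound = {poset, param, injections, omega}"
  unfolding bound_def by simp

lemma inj_map_in_Hset:
  assumes "\<alpha> \<in> elts omega1"
  shows "\<exists>f\<in>Hset (hartogs (trcl bound)). inj_map f (elts \<alpha>) (elts omega)"
proof -
  have "countable (elts \<alpha>)" using assms elts_omega1 by blast
  then obtain f where f: "elts f \<subseteq> (\<Union>u\<in>elts \<alpha>. opair u ` elts omega)"
      "inj_map f (elts \<alpha>) (elts omega)"
    using inj_map_exists by blast
  have "elts \<alpha> \<subseteq> elts omega1" using assms omega1_in by blast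
  then have "f \<in> elts injections" using f(1) unfolding elts_injections by blast
  then have "trcl f \<subseteq> trcl injections" by (rule trcl_mono)
  also have "\<dots> \<subseteq> trcl bound" by (rule trcl_mono) (simp add: elts_bound)
  finally have "f \<in> Hset (hartogs (trcl bound))"
    unfolding Hset_def using lesspoll_subset[OF _ lesspoll_hartogs[OF small_trcl]] by blast
  then show ?thesis using f(2) by blast
qed

text \<open>Compatibility in the filter makes the union an end-extension of each member, genericity
  makes it unbounded in \<open>\<delta>\<close>, and closure and \<open>R\<close> below
  \<open>\<delta>\<close> are inherited from the members.\<close>

lemma master_condition:
  assumes good: "good_model K M Q \<delta>" and N: "pairing_class (elts N)"
    and H: "Hset (hartogs (trcl bound)) \<subseteq> elts N"
    and el: "elementary \<sigma> (elts M) (elts Q) (elts N) S"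
    and a: "param \<in> \<sigma> ` elts M" and P': "P' \<in> elts M" "b' \<in> elts M"
    and sP: "\<sigma> (opair P' b') = opair poset b"
    and gen: "generic_over M P' (elts G)" and GK: "G \<in> elts (K \<delta>)"
  shows "\<exists>p\<in>conds. \<forall>c\<in>elts G. le poset p (\<sigma> c)"
proof -
  have ZM: "ZF_minus (elts M) (elts Q)" and trM: "\<forall>x\<in>elts M. elts x \<subseteq> elts M"
    and om: "is_omega1_of M \<delta>" and \<delta>1: "\<delta> \<in> elts omega1" and MK: "opair M Q \<in> elts (K \<delta>)"
    using good unfolding good_model_def ZFC_minus_def trans_set_def by blast+
  interpret embedding \<sigma> "elts M" "elts Q" "elts N" S
    using ZF_minus_pairing_class[OF ZM trM] N el by unfold_locales
  have ZK: "ZF_minus (elts (K \<delta>)) {}" and trK: "\<forall>x\<in>elts (K \<delta>). elts x \<subseteq> elts (K \<delta>)"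
    and \<delta>K: "\<delta> \<in> elts (K \<delta>)"
    using adequate \<delta>1 unfolding adequate_def ZFC_minus_def trans_set_def by blast+
  note K_pairing = ZF_minus_pairing_class[OF ZK trK]
  obtain z where z: "z \<in> elts M" "\<sigma> z = opair (opair B omega1) omega"
    using a unfolding param_def by auto
  obtain y w where y: "y \<in> elts M" "\<sigma> y = opair B omega1" and w: "w \<in> elts M" "\<sigma> w = omega"
    using opair_preimage[OF z] by metis
  obtain B' d where B': "B' \<in> elts M" "\<sigma> B' = B" and d: "d \<in> elts M" "\<sigma> d = omega1"
    using opair_preimage[OF y] by metis
  have omega: "omega \<in> elts M" "\<sigma> omega = omega" using omega_preimage[OF w] w by auto
  have inj: "\<exists>f\<in>elts N. inj_map f (elts \<alpha>) (elts omega)" if "\<alpha> \<in> elts omega1" for \<alpha>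
    using inj_map_in_Hset[OF that] H by blast
  note ctxt = omega d inj
  have "is_omega1_of M d"
    unfolding is_omega1_of_def countable_in_iff
    using d(1) Ord_omega1_preimage[OF ctxt] no_inj_map_omega1_preimage[OF ctxt]
      ex_inj_map_omega1_preimage[OF ctxt] by blast
  then have "d = \<delta>" using om is_omega1_of_unique by blast
  then have \<delta>: "\<delta> \<in> elts M" "\<sigma> \<delta> = omega1" using d by auto
  have fixed: "\<sigma> \<alpha> = \<alpha>" if "\<alpha> \<in> elts \<delta>" for \<alpha>
    using sigma_fixes[OF omega \<delta> inj that] .
  have dM: "\<alpha> \<in> elts M" if "\<alpha> \<in> elts \<delta>" for \<alpha> using M_trans[OF \<delta>(1) that] .
  have sP': "\<sigma> P' = poset" using sP sigma_opair[OF P'] by simp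
  obtain C' R' where CR: "C' \<in> elts M" and R': "R' \<in> elts M"
    and P'_eq: "P' = opair C' R'" and C'_img: "\<sigma> C' = mkset conds"
    and R'_img: "\<sigma> R' = mkset ((\<lambda>(c, d). opair c d) ` {(c, d). c \<in> conds \<and> d \<in> conds \<and> end_ext c d})"
    by (rule opair_preimage[OF P'(1) sP'[unfolded poset_def]])
  note C' = CR C'_img
  have poset_eq: "poset = opair (\<sigma> C') (\<sigma> R')" using C' R'_img unfolding poset_def by simp
  have condP': "cond P' = elts C'" unfolding P'_eq cond_opair ..
  have C'M: "c \<in> elts M" if "c \<in> elts C'" for c using M_trans[OF C'(1) that] .
  have sc: "\<sigma> c \<in> conds" if "c \<in> elts C'" for c
    using sigma_mem[OF C'M[OF that] C'(1)] that C' by simp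
  \<comment> \<open>As \<open>\<sigma> c\<close> is bounded in \<open>omega1\<close>,
    \<open>c\<close> is bounded by some \<open>\<gamma>\<close> below \<open>\<delta>\<close>.
    Pushing this bound forward with \<open>\<sigma> \<gamma> = \<gamma>\<close> puts
    \<open>\<sigma> c\<close> below \<open>\<gamma>\<close> as well, where \<open>\<sigma>\<close>
    is the identity.\<close>
  have c_fix: "\<sigma> c = c \<and> elts c \<subseteq> elts \<delta>" if c: "c \<in> elts C'" for c
  proof -
    let ?\<phi> = "FEx 2 (FAnd (FMem 2 1) (FAll 3 (FImp (FMem 3 0) (FMem 3 2))))"
    obtain \<beta> where \<beta>: "\<beta> \<in> elts omega1" "elts (\<sigma> c) \<subseteq> elts \<beta>" using sc[OF c] unfolding conds_def by blast
    have "\<beta> \<in> elts N" using N_trans[OF in_N[OF \<delta>(1)]] \<beta>(1) \<delta>(2) by simp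
    then have "sat (elts N) S ?\<phi> (env4 (\<sigma> c) (\<sigma> \<delta>) (\<sigma> \<delta>) (\<sigma> \<delta>))" using \<beta> \<delta>(2) by auto
    then have "sat (elts M) (elts Q) ?\<phi> (env4 c \<delta> \<delta> \<delta>)" using transfer C'M[OF c] \<delta>(1) by blast
    then obtain \<gamma> where \<gamma>: "\<gamma> \<in> elts M" "\<gamma> \<in> elts \<delta>" "\<forall>\<xi>\<in>elts M. \<xi> \<in> elts c \<longrightarrow> \<xi> \<in> elts \<gamma>" by auto
    have c\<gamma>: "elts c \<subseteq> elts \<gamma>" using \<gamma>(3) M_trans[OF C'M[OF c]] by blast
    have "sat (elts M) (elts Q) (FAll 3 (FImp (FMem 3 0) (FMem 3 1))) (env4 c \<gamma> \<gamma> \<gamma>)" using \<gamma>(3) by simp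
    then have "sat (elts N) S (FAll 3 (FImp (FMem 3 0) (FMem 3 1))) (env4 (\<sigma> c) (\<sigma> \<gamma>) (\<sigma> \<gamma>) (\<sigma> \<gamma>))"
      using transfer C'M[OF c] \<gamma>(1) by blast
    then have scg: "elts (\<sigma> c) \<subseteq> elts \<gamma>" using fixed[OF \<gamma>(2)] N_trans[OF in_N[OF C'M[OF c]]] by auto
    have \<gamma>\<delta>: "elts \<gamma> \<subseteq> elts \<delta>" using omega1_trans \<gamma>(2) \<delta>1 by blast
    have "\<xi> \<in> elts (\<sigma> c) \<longleftrightarrow> \<xi> \<in> elts c" if "\<xi> \<in> elts \<gamma>" for \<xi>
      using sigma_mem[OF dM C'M[OF c], of \<xi>] fixed that \<gamma>\<delta> by auto
    then have "elts (\<sigma> c) = elts c" using c\<gamma> scg by blast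
    then show ?thesis using c\<gamma> \<gamma>\<delta> by simp
  qed
  have c_conds: "c \<in> conds" if "c \<in> elts C'" for c using c_fix[OF that] sc[OF that] by simp
  have le_ext: "end_ext c e" if "le P' c e" for c e
  proof -
    have ce: "c \<in> elts C'" "e \<in> elts C'" "opair c e \<in> elts R'"
      using that unfolding P'_eq le_opair by blast+
    then have "opair c e \<in> elts M" using M_trans[OF R'] by blast
    then have "\<sigma> (opair c e) \<in> elts (\<sigma> R')" using sigma_mem R' ce(3) by blast
    then have "opair c e \<in> elts (\<sigma> R')" using sigma_opair C'M c_fix ce by simp
    then have "le poset c e" using ce c_conds C'(2) unfolding poset_eq le_opair by simp
    then show ?thesis by (simp add: le_poset)
  qed
  have G_sub: "elts G \<subseteq> elts C'" and G_filter: "pfilter P' (elts G)"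
    using gen condP' unfolding generic_over_def pfilter_def by auto
  have G_below: "\<xi> \<in> elts c" if ce: "c \<in> elts G" "e \<in> elts G" "\<xi> \<in> elts e" "\<eta> \<in> elts c" "\<xi> \<in> elts \<eta>" for c e \<xi> \<eta>
  proof -
    obtain r where "le P' r c" "le P' r e" using pfilter_compatible[OF G_filter ce(1,2)] by blast
    then have "end_ext r c" "end_ext r e" using le_ext by blast+
    then show ?thesis using ce(3-5) unfolding end_ext_def by blast
  qed
  have G_unbounded: "\<exists>c\<in>elts G. \<exists>\<xi>\<in>elts c. \<alpha> \<in> elts \<xi>" if \<alpha>: "\<alpha> \<in> elts \<delta>" for \<alpha>
  proof -
    define D where "D = mkset {c \<in> elts C'. \<exists>\<xi>\<in>elts c. \<alpha> \<in> elts \<xi>}"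
    have D: "elts D = {c \<in> elts C'. \<exists>\<xi>\<in>elts c. \<alpha> \<in> elts \<xi>}"
      unfolding D_def by (intro elts_mkset_small small_subset[OF small_elts[of C']]) blast
    let ?\<phi> = "FEx 3 (FAnd (FMem 3 0) (FMem 1 3))"
    have "mkset {x \<in> elts C'. sat (elts M) (elts Q) ?\<phi> ((env4 \<alpha> \<alpha> \<alpha> \<alpha>)(0 := x))} \<in> elts M"
      by (rule ZF_minus_Separation[OF ZM trM C'(1)]) (use dM[OF \<alpha>] in simp)
    moreover have "sat (elts M) (elts Q) ?\<phi> ((env4 \<alpha> \<alpha> \<alpha> \<alpha>)(0 := x)) \<longleftrightarrow> (\<exists>\<xi>\<in>elts x. \<alpha> \<in> elts \<xi>)"
      if "x \<in> elts C'" for x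
      using M_trans[OF C'M[OF that]] by auto
    ultimately have DM: "D \<in> elts M" unfolding D_def by (simp cong: conj_cong)
    have "dense_in P' (elts D)"
      unfolding dense_in_def condP'
    proof (intro conjI ballI)
      show "elts D \<subseteq> elts C'" using D by blast
      fix c assume c: "c \<in> elts C'"
      \<comment> \<open>The extension from \<open>conds_extend\<close> is found in the target and
        need not come from \<open>M\<close>. Its existence is a formula about \<open>C'\<close>,
        \<open>R'\<close>, \<open>c\<close> and \<open>\<alpha>\<close>, which is pulled back to
        give a condition in \<open>C'\<close>.\<close>
      let ?\<psi> = "FEx 4 (FAnd (FMem 4 0) (FAnd (F_app 1 4 2) (FEx 5 (FAnd (FMem 5 4) (FMem 3 5)))))"
      have \<alpha>1: "\<alpha> \<in> elts omega1" using omega1_in \<alpha> \<delta>1 by blast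
      obtain \<xi> where \<xi>: "\<alpha> \<in> elts \<xi>" "mkset (insert \<xi> (elts c)) \<in> conds"
          "end_ext (mkset (insert \<xi> (elts c))) c"
        using conds_extend[OF c_conds[OF c] \<alpha>1] by blast
      define e where "e = mkset (insert \<xi> (elts c))"
      have e: "e \<in> elts (\<sigma> C')" "opair e c \<in> elts (\<sigma> R')" "\<xi> \<in> elts e"
      proof -
        show "e \<in> elts (\<sigma> C')" using \<xi>(2) C'(2) e_def by simp
        have "le poset e c" using \<xi> c_conds[OF c] e_def le_poset by blast
        then show "opair e c \<in> elts (\<sigma> R')" unfolding poset_eq le_opair by blast
        show "\<xi> \<in> elts e" unfolding e_def by simp
      qed
      have eN: "e \<in> elts N" using N_trans[OF in_N[OF C'(1)] e(1)] .
      have xN: "\<xi> \<in> elts N" using N_trans[OF eN e(3)] .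
      have inN: "\<sigma> C' \<in> elts N" "\<sigma> R' \<in> elts N" "\<sigma> c \<in> elts N" "\<sigma> \<alpha> \<in> elts N"
        using in_N C'(1) R' C'M[OF c] dM[OF \<alpha>] by blast+
      have "sat (elts N) S ?\<psi> (env4 (\<sigma> C') (\<sigma> R') (\<sigma> c) (\<sigma> \<alpha>)) \<longleftrightarrow>
          (\<exists>e\<in>elts N. e \<in> elts (\<sigma> C') \<and> opair e (\<sigma> c) \<in> elts (\<sigma> R') \<and>
            (\<exists>\<xi>\<in>elts N. \<xi> \<in> elts e \<and> \<sigma> \<alpha> \<in> elts \<xi>))"
        using inN by (simp add: sat_F_app[OF N] env4_def cong: bex_cong)
      moreover have "opair e (\<sigma> c) \<in> elts (\<sigma> R')" "\<sigma> \<alpha> \<in> elts \<xi>"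
        using e(2) c_fix[OF c] fixed[OF \<alpha>] \<xi>(1) by simp_all
      ultimately have "sat (elts N) S ?\<psi> (env4 (\<sigma> C') (\<sigma> R') (\<sigma> c) (\<sigma> \<alpha>))"
        using e(1,3) eN xN by blast
      then have "sat (elts M) (elts Q) ?\<psi> (env4 C' R' c \<alpha>)"
        using transfer C'(1) R' C'M[OF c] dM[OF \<alpha>] by blast
      then obtain e' where "e' \<in> elts C'" "opair e' c \<in> elts R'" "\<exists>\<xi>\<in>elts e'. \<alpha> \<in> elts \<xi>"
        using C'(1) R' C'M[OF c] dM[OF \<alpha>] by (auto simp: sat_F_app[OF M] env4_def cong: bex_cong)
      then show "\<exists>q\<in>elts D. le P' q c" using c unfolding D P'_eq le_opair by blast
    qed
    then have "elts G \<inter> elts D \<noteq> {}" using gen DM unfolding generic_over_def by blast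
    then show ?thesis unfolding D by blast
  qed
  define c where "c = mkset (\<Union>e\<in>elts G. elts e)"
  have c: "elts c = (\<Union>e\<in>elts G. elts e)" unfolding c_def by (rule elts_mkset_small) auto
  have cK: "c \<in> elts (K \<delta>)" unfolding c_def using ZF_minus_Union[OF ZK trK GK] .
  have cd: "elts c \<subseteq> elts \<delta>" using c c_fix G_sub by blast
  \<comment> \<open>The preimage \<open>B'\<close> lies in \<open>M\<close>, hence in the transitive
    set \<open>K \<delta>\<close>, and agrees with \<open>B\<close> below \<open>\<delta>\<close>
    because \<open>\<sigma>\<close> fixes those ordinals.\<close>
  have BK: "inter B \<delta> \<in> elts (K \<delta>)"
  proof -
    have "M \<in> elts (K \<delta>)" using MK pairing_class_opair_iff[OF K_pairing] by blast
    then have B'K: "B' \<in> elts (K \<delta>)" using B'(1) trK by blast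
    have "mkset {x \<in> elts \<delta>. sat (elts (K \<delta>)) {} (FMem 0 1) ((env4 B' B' B' B')(0 := x))} \<in> elts (K \<delta>)"
      by (rule ZF_minus_Separation[OF ZK trK \<delta>K]) (use B'K in simp)
    moreover have "{x \<in> elts \<delta>. x \<in> elts B'} = elts B \<inter> elts \<delta>"
      using sigma_mem[OF dM B'(1)] fixed B'(2) by auto
    ultimately show ?thesis by (simp add: inter_def)
  qed
  have below: "elts (inter c \<eta>) = elts (inter e \<eta>)" if "e \<in> elts G" "\<eta> \<in> elts e" for e \<eta>
    using G_below[OF that(1) _ _ that(2)] that c by auto
  define p where "p = mkset (insert \<delta> (elts c))"
  have "p \<in> conds"
    unfolding p_def
  proof (rule top_in_conds[OF \<delta>1 cd])
    show "R c \<delta>" using R_intro[OF \<delta>1 BK cK] .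
    show "R (inter c \<eta>) \<eta>" if "\<eta> \<in> elts c" for \<eta>
    proof -
      from that obtain e where e: "e \<in> elts G" "\<eta> \<in> elts e" using c by blast
      then have "R (inter e \<eta>) \<eta>" using c_conds G_sub unfolding conds_def by blast
      then show ?thesis using extensionality[OF below[OF e]] by simp
    qed
    show "\<gamma> \<in> elts c" if \<gamma>: "\<gamma> \<in> elts \<delta>" "unbounded_in (elts c) \<gamma>" for \<gamma>
    proof -
      \<comment> \<open>Some member of the filter reaches beyond \<open>\<gamma>\<close>; below that
        point it agrees with \<open>c\<close>, so its own closure puts \<open>\<gamma>\<close> into
        it.\<close>
      obtain e \<xi> where e: "e \<in> elts G" "\<xi> \<in> elts e" "\<gamma> \<in> elts \<xi>" using G_unbounded[OF \<gamma>(1)] by blast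
      have \<xi>1: "\<xi> \<in> elts omega1" using conds_sub_omega1 c_conds G_sub e by blast
      have "\<beta> \<in> elts c \<longleftrightarrow> \<beta> \<in> elts e" if "\<beta> \<in> elts \<gamma>" for \<beta>
        using below[OF e(1,2)] omega1_trans[OF that e(3) \<xi>1] by auto
      then have "unbounded_in (elts e) \<gamma>" using \<gamma>(2) unbounded_in_cong[of \<gamma> "elts c" "elts e"] by blast
      then have "\<gamma> \<in> elts e"
        using c_conds G_sub e(1) omega1_in[OF \<gamma>(1) \<delta>1] unfolding conds_def by blast
      then show ?thesis using c e(1) by blast
    qed
  qed
  moreover have "le poset p (\<sigma> e)" if e: "e \<in> elts G" for e
  proof -
    have "end_ext c e" using G_below[OF e] e c unfolding end_ext_def by blast
    then have "end_ext p e" using end_ext_trans[OF end_ext_top[OF cd]] p_def by simp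
    then show ?thesis using \<open>p \<in> conds\<close> c_conds c_fix G_sub e by (auto simp: le_poset)
  qed
  ultimately show ?thesis by blast
qed

lemma verifies_subcomplete_poset:
  "verifies_subcomplete K (hartogs (trcl bound)) param poset"
  unfolding verifies_subcomplete_def
proof (intro conjI allI impI)
  show "regular_cardinal (hartogs (trcl bound))"
    by (rule regular_hartogs_trcl) (simp add: elts_bound)
  show "param \<in> Hset (hartogs (trcl bound))" "poset \<in> Hset (hartogs (trcl bound))"
    by (rule Hset_hartogs; simp add: elts_bound)+
next
  fix A \<chi> M Q \<delta> P' b' :: 'v and \<sigma> and b G :: 'v
  let ?L = "Llevel A \<chi>"
  assume h: "Ord \<chi> \<and> Hset (hartogs (trcl bound)) \<subseteq> ?L \<and> ZFC_minus ?L (elts A \<inter> ?L) \<and>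
        good_model K M Q \<delta> \<and> P' \<in> elts M \<and> b' \<in> elts M \<and>
        elementary \<sigma> (elts M) (elts Q) ?L (elts A \<inter> ?L) \<and>
        param \<in> \<sigma> ` elts M \<and> \<sigma> (opair P' b') = opair poset b \<and>
        generic_over M P' (elts G) \<and> G \<in> elts (K \<delta>)"
  then have O\<chi>: "Ord \<chi>" and H: "Hset (hartogs (trcl bound)) \<subseteq> ?L"
    and ZL: "ZF_minus ?L (elts A \<inter> ?L)" and good: "good_model K M Q \<delta>"
    and P': "P' \<in> elts M" "b' \<in> elts M"
    and el: "elementary \<sigma> (elts M) (elts Q) ?L (elts A \<inter> ?L)"
    and a: "param \<in> \<sigma> ` elts M" and sP: "\<sigma> (opair P' b') = opair poset b"
    and gen: "generic_over M P' (elts G)" and GK: "G \<in> elts (K \<delta>)"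
    unfolding ZFC_minus_def by blast+
  define N where "N = mkset ?L"
  define S where "S = mkset (elts A \<inter> ?L)"
  have N: "elts N = ?L" unfolding N_def by (rule elts_mkset_small[OF small_Llevel])
  have S: "elts S = elts A \<inter> ?L"
    unfolding S_def by (rule elts_mkset_small[OF small_subset[OF small_elts[of A]]]) blast
  have "\<forall>x\<in>?L. elts x \<subseteq> ?L" using Llevel_transitive[OF O\<chi>] by blast
  then have pN: "pairing_class (elts N)" unfolding N by (rule ZF_minus_pairing_class[OF ZL])
  obtain p where p: "p \<in> conds" "\<forall>c\<in>elts G. le poset p (\<sigma> c)"
    using master_condition[OF good pN H[folded N] el[folded N S] a P' sP gen GK] by blast
  interpret forcing poset by unfold_locales (rule forcing_notion_poset)
  \<comment> \<open>The graph of \<open>\<sigma>\<close> on \<open>M\<close> is a set of the ground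
    model; its check name will be the name of the new embedding.\<close>
  define f where "f = mkset ((\<lambda>x. opair x (\<sigma> x)) ` elts M)"
  have f: "elts f = (\<lambda>x. opair x (\<sigma> x)) ` elts M" unfolding f_def by (rule elts_mkset_small) auto
  have ZM: "ZF_minus (elts M) (elts Q)" and trM: "\<forall>x\<in>elts M. elts x \<subseteq> elts M"
    using good unfolding good_model_def ZFC_minus_def trans_set_def by blast+
  note pM = ZF_minus_pairing_class[OF ZM trM]
  have oM: "opair P' b' \<in> elts M" using pairing_class_opair_iff[OF pM] P' by blast
  show "\<exists>p\<in>cond poset.
           f_ex poset (\<lambda>f. f_and
             (f_elementary poset f (check poset M) (check poset Q)
                (check poset (mkset ?L)) (check poset (mkset (elts A \<inter> ?L))))
             (f_and
               (f_apply poset f (check poset (opair P' b')) (check poset (opair poset b)))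
               (f_ball poset (check poset G) (\<lambda>x. f_all poset (\<lambda>y.
                  f_imp poset (f_apply poset f x y) (forces_mem poset y (gen_name poset)))))))
           p"
    using ground_embedding_forced[OF f el[folded N S] oM, of G p] p
    unfolding N_def[symmetric] S_def[symmetric] sP by auto
qed

lemma subcomplete_poset: "subcomplete K poset"
  unfolding subcomplete_def using forcing_notion_poset verifies_subcomplete_poset by blast

text \<open>One dense set for each \<open>\<alpha>\<close> below \<open>omega1\<close> makes the
  union of the filter unbounded. Below any point of a member the union agrees with that member, so
  closure and \<open>R\<close> carry over.\<close>

lemma club_of_SCFA:
  assumes "SCFA K" shows "\<exists>C. club (elts C) \<and> (\<forall>\<xi>\<in>elts C. R (inter C \<xi>) \<xi>)"
proof -
  define D where "D \<alpha> = {c \<in> conds. \<exists>\<xi>\<in>elts c. \<alpha> \<in> elts \<xi>}" for \<alpha>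
  have dense: "dense_in poset (D \<alpha>)" if "\<alpha> \<in> elts omega1" for \<alpha>
    unfolding dense_in_def
  proof (intro conjI ballI)
    show "D \<alpha> \<subseteq> cond poset" by (auto simp: D_def)
    fix c assume "c \<in> cond poset"
    then have c: "c \<in> conds" by simp
    obtain \<xi> where \<xi>: "\<alpha> \<in> elts \<xi>" "mkset (insert \<xi> (elts c)) \<in> conds"
        "end_ext (mkset (insert \<xi> (elts c))) c"
      using conds_extend[OF c \<open>\<alpha> \<in> elts omega1\<close>] by blast
    then have "mkset (insert \<xi> (elts c)) \<in> D \<alpha>" unfolding D_def by auto
    moreover have "le poset (mkset (insert \<xi> (elts c))) c" using \<xi> c by (simp add: le_poset)
    ultimately show "\<exists>q\<in>D \<alpha>. le poset q c" by blast
  qed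
  have card: "D ` elts omega1 \<lesssim> elts (omega1 :: 'v)" by (rule image_lepoll)
  have "\<exists>g. pfilter poset g \<and> (\<forall>E\<in>D ` elts omega1. g \<inter> E \<noteq> {})"
    by (rule assms[unfolded SCFA_def, rule_format]) (use subcomplete_poset dense card in blast)
  then obtain g where g: "pfilter poset g" "\<forall>E\<in>D ` elts omega1. g \<inter> E \<noteq> {}" by (elim exE conjE)
  have g_sub: "g \<subseteq> conds" using g(1) unfolding pfilter_def by simp
  define C where "C = mkset (\<Union>c\<in>g. elts c)"
  have C: "elts C = (\<Union>c\<in>g. elts c)"
    unfolding C_def by (rule elts_mkset_small) (use small_subset[OF small_conds g_sub] in auto)
  have below: "elts (inter C \<eta>) = elts (inter c \<eta>)" if "c \<in> g" "\<eta> \<in> elts c" for c \<eta>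
  proof -
    have "\<xi> \<in> elts c" if e: "\<xi> \<in> elts e" "\<xi> \<in> elts \<eta>" "e \<in> g" for e \<xi>
    proof -
      obtain r where "le poset r c" "le poset r e"
        using pfilter_compatible[OF g(1) \<open>c \<in> g\<close> e(3)] by blast
      then show ?thesis using e \<open>\<eta> \<in> elts c\<close> unfolding le_poset end_ext_def by blast
    qed
    then show ?thesis using that C by auto
  qed
  have C1: "elts C \<subseteq> elts omega1" using C g_sub conds_sub_omega1 by blast
  have unb: "\<exists>c\<in>g. \<exists>\<xi>\<in>elts c. \<alpha> \<in> elts \<xi>" if "\<alpha> \<in> elts omega1" for \<alpha>
    using bspec[OF g(2) imageI[OF that]] unfolding D_def by blast
  have "club (elts C)"
    unfolding club_iff
  proof (intro conjI ballI impI)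
    show "elts C \<subseteq> elts omega1" using C1 .
    show "\<exists>\<beta>\<in>elts C. \<alpha> \<in> elts \<beta>" if "\<alpha> \<in> elts omega1" for \<alpha> using unb[OF that] C by blast
    show "\<gamma> \<in> elts C" if \<gamma>: "\<gamma> \<in> elts omega1" "unbounded_in (elts C) \<gamma>" for \<gamma>
    proof -
      obtain c \<xi> where c: "c \<in> g" "\<xi> \<in> elts c" "\<gamma> \<in> elts \<xi>" using unb[OF \<gamma>(1)] by blast
      have \<xi>1: "\<xi> \<in> elts omega1" using C1 C c by blast
      have "\<beta> \<in> elts C \<longleftrightarrow> \<beta> \<in> elts c" if "\<beta> \<in> elts \<gamma>" for \<beta>
        using below[OF c(1,2)] omega1_trans[OF that c(3) \<xi>1] by auto
      then have "unbounded_in (elts c) \<gamma>" using \<gamma>(2) unbounded_in_cong[of \<gamma> "elts C" "elts c"] by blast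
      then have "\<gamma> \<in> elts c" using g_sub c(1) \<gamma>(1) unfolding conds_def by blast
      then show ?thesis using C c(1) by blast
    qed
  qed
  moreover have "R (inter C \<xi>) \<xi>" if "\<xi> \<in> elts C" for \<xi>
  proof -
    from that obtain c where c: "c \<in> g" "\<xi> \<in> elts c" using C by blast
    then have "R (inter c \<xi>) \<xi>" using g_sub unfolding conds_def by blast
    then show ?thesis using extensionality[OF below[OF c]] by simp
  qed
  ultimately show ?thesis by blast
qed

end

section \<open>The two instances of the club forcing\<close>

lemma adequate_club_guess:
  assumes "adequate K" "elts B \<subseteq> elts omega1" "club C"
  shows "\<exists>\<xi>\<in>C. inter B \<xi> \<in> elts (K \<xi>)"
  using assms unfolding adequate_def stationary_def by blast

lemma inter_absorb: "elts c \<subseteq> elts \<alpha> \<Longrightarrow> \<alpha> \<in> elts \<xi> \<Longrightarrow> \<xi> \<in> elts omega1 \<Longrightarrow> inter c \<xi> = c"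
  by (rule extensionality) (auto dest: omega1_trans)

lemma SCFA_strongly_adequate:
  fixes K :: "'v::zfc \<Rightarrow> 'v"
  assumes K: "adequate K" and S: "SCFA K" and B: "elts B \<subseteq> elts omega1"
  shows "\<exists>C. club C \<and> (\<forall>\<xi>\<in>C. inter B \<xi> \<in> elts (K \<xi>))"
proof -
  \<comment> \<open>The demand ignores the initial segment \<open>d\<close>, so extendibility only
    asks that the stationary set for \<open>B\<close> meet each tail.\<close>
  interpret club_forcing K B "\<lambda>d \<xi>. inter B \<xi> \<in> elts (K \<xi>)"
  proof (unfold_locales; (intro K)?)
    fix \<alpha> :: 'v assume "\<alpha> \<in> elts omega1"
    from adequate_club_guess[OF K B club_tail[OF club_omega1 this]]
    show "\<exists>\<xi>\<in>elts omega1. \<alpha> \<in> elts \<xi> \<and> inter B \<xi> \<in> elts (K \<xi>)" by blast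
  qed
  show ?thesis using club_of_SCFA[OF S] by blast
qed

lemma SCFA_diamond_plus_club:
  fixes K :: "'v::zfc \<Rightarrow> 'v"
  assumes K: "adequate K" and S: "SCFA K" and B: "elts B \<subseteq> elts omega1"
  shows "\<exists>C. club (elts C) \<and> (\<forall>\<xi>\<in>elts C. inter B \<xi> \<in> elts (K \<xi>) \<and> inter C \<xi> \<in> elts (K \<xi>))"
proof -
  obtain E where E: "club E" "\<forall>\<xi>\<in>E. inter B \<xi> \<in> elts (K \<xi>)"
    using SCFA_strongly_adequate[OF assms] by blast
  interpret club_forcing K B "\<lambda>d \<xi>. inter B \<xi> \<in> elts (K \<xi>) \<and> d \<in> elts (K \<xi>)"
  proof (unfold_locales; (intro K)?)
    fix \<alpha> c :: 'v assume \<alpha>: "\<alpha> \<in> elts omega1" and c: "elts c \<subseteq> elts \<alpha>"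
    have "elts c \<subseteq> elts omega1" using c \<alpha> omega1_in by blast
    \<comment> \<open>Adequacy is applied to the condition \<open>c\<close> itself, along the part
      of \<open>E\<close> above \<open>\<alpha>\<close>. Since \<open>c\<close> lies below
      \<open>\<xi>\<close>, guessing \<open>c\<close> at \<open>\<xi>\<close> puts all of
      \<open>c\<close> into \<open>K \<xi>\<close>, while membership of \<open>\<xi>\<close> in
      \<open>E\<close> takes care of \<open>B\<close>.\<close>
    from adequate_club_guess[OF K this club_tail[OF E(1) \<alpha>]]
    obtain \<xi> where \<xi>: "\<xi> \<in> E" "\<alpha> \<in> elts \<xi>" "inter c \<xi> \<in> elts (K \<xi>)" by blast
    have "\<xi> \<in> elts omega1" using E(1) \<xi>(1) unfolding club_iff by blast
    then show "\<exists>\<xi>\<in>elts omega1. \<alpha> \<in> elts \<xi> \<and> inter B \<xi> \<in> elts (K \<xi>) \<and> c \<in> elts (K \<xi>)"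
      using \<xi> E(2) inter_absorb[OF c \<xi>(2)] by auto
  qed auto
  show ?thesis using club_of_SCFA[OF S] by blast
qed

theorem proposition5p4:
  fixes K :: "'v::zfc \<Rightarrow> 'v"
  assumes "adequate K"
    and "SCFA K"
  shows "strongly_adequate K \<and> (diamond_model_sequence K \<longrightarrow> diamond_plus_sequence K)"
proof (intro conjI impI)
  show "strongly_adequate K"
    unfolding strongly_adequate_def
  proof (intro conjI assms(1) allI impI)
    fix B :: 'v assume "elts B \<subseteq> elts omega1"
    then obtain C where C: "club C" "\<forall>\<xi>\<in>C. inter B \<xi> \<in> elts (K \<xi>)"
      using SCFA_strongly_adequate[OF assms] by blast
    moreover have "C \<subseteq> elts omega1" using C(1) unfolding club_iff by (elim conjE)
    ultimately show "\<exists>C. club C \<and> C \<subseteq> {\<xi> \<in> elts omega1. inter B \<xi> \<in> elts (K \<xi>)}" by blast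
  qed
next
  assume "diamond_model_sequence K"
  then show "diamond_plus_sequence K"
    unfolding diamond_plus_sequence_def diamond_model_sequence_def
    using SCFA_diamond_plus_club[OF assms] by blast
qed

end
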